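(* Let $R$ be a commutative ring, let $Z$ be a proper Thomason subset of $\mathrm{Spec}\,R$, and let $\Phi$ be the Thomason filtration given by $\Phi(n)=Z$ for $n\le0$ and $\Phi(n)=\emptyset$ for $n>0$. Then the AJS heart $\mathcal H^\#_Z$ associated with $\Phi$ is equivalent to the torsion class $\mathcal T_Z$.
   Context: For an ideal $J$ of $R$, $V(J)=\{p\in\mathrm{Spec}\,R\mid p\supseteq J\}$. A subset of $\mathrm{Spec}\,R$ is Thomason if it is a union of sets $V(J)$ with $J$ finitely generated. For a Thomason set $Z$, $\mathcal T_Z=\{M\in R\text{-Mod}\mid\mathrm{Supp}\,M\subseteq Z\}$. For a decreasing family $\Phi=(\Phi(n))_{n\in\mathbb Z}$ of Thomason subsets, the AJS (Alonso–Jeremías–Saorín) heart is $\mathcal U^\#\cap(\mathcal U^\#)^{\perp_0}[1]$ in the unbounded derived category $\mathcal D(R)$, where $\mathcal U^\#=\{M\in\mathcal D(R)\mid H^n(M)\in\mathcal T_{\Phi(n)}\ \forall n\in\mathbb Z\}$ is the aisle of a t-structure and $(\mathcal U^\#)^{\perp_0}=\{M\in\mathcal D(R)\mid\mathrm{Hom}_{\mathcal D(R)}(\mathcal U^\#,M)=0\}$. *)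

theory Defs
  imports "HOL-Algebra.Module" "HOL-Algebra.Ideal"
begin

section \<open>Categories\<close>

text \<open>
  The sets \<open>Hom C X Y\<close> for different pairs of objects may overlap, so source and target are
  explicit arguments of composition: \<open>Comp C X Y Z g f\<close> is \<open>g \<circ> f\<close> for \<open>f : X \<rightarrow> Y\<close> and
  \<open>g : Y \<rightarrow> Z\<close>, and the action of a functor on morphisms is given for each pair of objects.
\<close>

record ('o, 'a) cat =
  Ob :: "'o set"
  Hom :: "'o \<Rightarrow> 'o \<Rightarrow> 'a set"
  Ident :: "'o \<Rightarrow> 'a"
  Comp :: "'o \<Rightarrow> 'o \<Rightarrow> 'o \<Rightarrow> 'a \<Rightarrow> 'a \<Rightarrow> 'a"

locale category =
  fixes C :: "('o, 'a) cat"
  assumes ident_closed: "X \<in> Ob C \<Longrightarrow> Ident C X \<in> Hom C X X"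
    and comp_closed:
      "\<lbrakk>X \<in> Ob C; Y \<in> Ob C; Z \<in> Ob C; f \<in> Hom C X Y; g \<in> Hom C Y Z\<rbrakk>
        \<Longrightarrow> Comp C X Y Z g f \<in> Hom C X Z"
    and comp_ident_right:
      "\<lbrakk>X \<in> Ob C; Y \<in> Ob C; f \<in> Hom C X Y\<rbrakk> \<Longrightarrow> Comp C X X Y f (Ident C X) = f"
    and comp_ident_left:
      "\<lbrakk>X \<in> Ob C; Y \<in> Ob C; f \<in> Hom C X Y\<rbrakk> \<Longrightarrow> Comp C X Y Y (Ident C Y) f = f"
    and comp_assoc:
      "\<lbrakk>W \<in> Ob C; X \<in> Ob C; Y \<in> Ob C; Z \<in> Ob C;
        f \<in> Hom C W X; g \<in> Hom C X Y; h \<in> Hom C Y Z\<rbrakk>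
        \<Longrightarrow> Comp C W Y Z h (Comp C W X Y g f) = Comp C W X Z (Comp C X Y Z h g) f"

record ('o, 'a, 'p, 'b) functor_data =
  on_ob :: "'o \<Rightarrow> 'p"
  on_hom :: "'o \<Rightarrow> 'o \<Rightarrow> 'a \<Rightarrow> 'b"

definition is_functor :: "('o, 'a) cat \<Rightarrow> ('p, 'b) cat \<Rightarrow> ('o, 'a, 'p, 'b) functor_data \<Rightarrow> bool" where
  "is_functor C D F \<longleftrightarrow>
    (\<forall>X\<in>Ob C. on_ob F X \<in> Ob D) \<and>
    (\<forall>X\<in>Ob C. \<forall>Y\<in>Ob C. \<forall>f\<in>Hom C X Y. on_hom F X Y f \<in> Hom D (on_ob F X) (on_ob F Y)) \<and>
    (\<forall>X\<in>Ob C. on_hom F X X (Ident C X) = Ident D (on_ob F X)) \<and>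
    (\<forall>X\<in>Ob C. \<forall>Y\<in>Ob C. \<forall>Z\<in>Ob C. \<forall>f\<in>Hom C X Y. \<forall>g\<in>Hom C Y Z.
      on_hom F X Z (Comp C X Y Z g f) =
        Comp D (on_ob F X) (on_ob F Y) (on_ob F Z) (on_hom F Y Z g) (on_hom F X Y f))"

definition id_functor :: "('o, 'a, 'o, 'a) functor_data" where
  "id_functor = \<lparr>on_ob = (\<lambda>X. X), on_hom = (\<lambda>X Y f. f)\<rparr>"

definition comp_functor ::
  "('p, 'b, 'q, 'c) functor_data \<Rightarrow> ('o, 'a, 'p, 'b) functor_data \<Rightarrow> ('o, 'a, 'q, 'c) functor_data" where
  "comp_functor G F =
    \<lparr>on_ob = (\<lambda>X. on_ob G (on_ob F X)),
     on_hom = (\<lambda>X Y f. on_hom G (on_ob F X) (on_ob F Y) (on_hom F X Y f))\<rparr>"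

definition is_iso :: "('o, 'a) cat \<Rightarrow> 'o \<Rightarrow> 'o \<Rightarrow> 'a \<Rightarrow> bool" where
  "is_iso C X Y f \<longleftrightarrow> f \<in> Hom C X Y \<and>
    (\<exists>g\<in>Hom C Y X. Comp C X Y X g f = Ident C X \<and> Comp C Y X Y f g = Ident C Y)"

definition naturally_isomorphic ::
  "('o, 'a) cat \<Rightarrow> ('p, 'b) cat \<Rightarrow> ('o, 'a, 'p, 'b) functor_data \<Rightarrow> ('o, 'a, 'p, 'b) functor_data \<Rightarrow> bool" where
  "naturally_isomorphic C D F G \<longleftrightarrow>
    (\<exists>\<eta>. (\<forall>X\<in>Ob C. is_iso D (on_ob F X) (on_ob G X) (\<eta> X)) \<and>
      (\<forall>X\<in>Ob C. \<forall>Y\<in>Ob C. \<forall>f\<in>Hom C X Y.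
        Comp D (on_ob F X) (on_ob F Y) (on_ob G Y) (\<eta> Y) (on_hom F X Y f) =
        Comp D (on_ob F X) (on_ob G X) (on_ob G Y) (on_hom G X Y f) (\<eta> X)))"

definition equivalent_categories :: "('o, 'a) cat \<Rightarrow> ('p, 'b) cat \<Rightarrow> bool" where
  "equivalent_categories C D \<longleftrightarrow> category C \<and> category D \<and>
    (\<exists>F G. is_functor C D F \<and> is_functor D C G \<and>
      naturally_isomorphic C C (comp_functor G F) id_functor \<and>
      naturally_isomorphic D D (comp_functor F G) id_functor)"

definition full_subcategory :: "('o, 'a) cat \<Rightarrow> 'o set \<Rightarrow> ('o, 'a) cat" where
  "full_subcategory C S = C\<lparr>Ob := Ob C \<inter> S\<rparr>"


section \<open>Localization of a category at a class of morphisms\<close>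

text \<open>
  The Gabriel--Zisman construction. \<open>W X Y\<close> is the set of morphisms \<open>X \<rightarrow> Y\<close> to be inverted.
  A morphism of the localization is a class of zigzags, written in diagrammatic order:
  \<open>Fwd X f Y\<close> is a step from \<open>X\<close> to \<open>Y\<close> along \<open>f : X \<rightarrow> Y\<close>, and \<open>Bwd X s Y\<close> is a step from
  \<open>X\<close> to \<open>Y\<close> along the formal inverse of \<open>s : Y \<rightarrow> X\<close> in \<open>W\<close>.
\<close>

datatype ('o, 'a) step = Fwd 'o 'a 'o | Bwd 'o 'a 'o

inductive zigzag ::
  "('o, 'a) cat \<Rightarrow> ('o \<Rightarrow> 'o \<Rightarrow> 'a set) \<Rightarrow> 'o \<Rightarrow> 'o \<Rightarrow> ('o, 'a) step list \<Rightarrow> bool"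
  for C W where
  nil: "X \<in> Ob C \<Longrightarrow> zigzag C W X X []"
| fwd: "\<lbrakk>X \<in> Ob C; Y \<in> Ob C; f \<in> Hom C X Y; zigzag C W Y Z u\<rbrakk>
    \<Longrightarrow> zigzag C W X Z (Fwd X f Y # u)"
| bwd: "\<lbrakk>X \<in> Ob C; Y \<in> Ob C; s \<in> Hom C Y X; s \<in> W Y X; zigzag C W Y Z u\<rbrakk>
    \<Longrightarrow> zigzag C W X Z (Bwd X s Y # u)"

inductive zigzag_rel ::
  "('o, 'a) cat \<Rightarrow> ('o \<Rightarrow> 'o \<Rightarrow> 'a set) \<Rightarrow> 'o \<Rightarrow> 'o \<Rightarrow> ('o, 'a) step list \<Rightarrow> ('o, 'a) step list \<Rightarrow> bool"
  for C W where
  ident: "X \<in> Ob C \<Longrightarrow> zigzag_rel C W X X [Fwd X (Ident C X) X] []"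
| comp: "\<lbrakk>X \<in> Ob C; Y \<in> Ob C; Z \<in> Ob C; f \<in> Hom C X Y; g \<in> Hom C Y Z\<rbrakk>
    \<Longrightarrow> zigzag_rel C W X Z [Fwd X f Y, Fwd Y g Z] [Fwd X (Comp C X Y Z g f) Z]"
| fwd_bwd: "\<lbrakk>X \<in> Ob C; Y \<in> Ob C; s \<in> Hom C X Y; s \<in> W X Y\<rbrakk>
    \<Longrightarrow> zigzag_rel C W X X [Fwd X s Y, Bwd Y s X] []"
| bwd_fwd: "\<lbrakk>X \<in> Ob C; Y \<in> Ob C; s \<in> Hom C X Y; s \<in> W X Y\<rbrakk>
    \<Longrightarrow> zigzag_rel C W Y Y [Bwd Y s X, Fwd X s Y] []"

inductive zigzag_eq ::
  "('o, 'a) cat \<Rightarrow> ('o \<Rightarrow> 'o \<Rightarrow> 'a set) \<Rightarrow> 'o \<Rightarrow> 'o \<Rightarrow> ('o, 'a) step list \<Rightarrow> ('o, 'a) step list \<Rightarrow> bool"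
  for C W where
  rel: "\<lbrakk>zigzag C W X X' u; zigzag_rel C W X' Y' v v'; zigzag C W Y' Y w\<rbrakk>
    \<Longrightarrow> zigzag_eq C W X Y (u @ v @ w) (u @ v' @ w)"
| refl: "zigzag C W X Y u \<Longrightarrow> zigzag_eq C W X Y u u"
| sym: "zigzag_eq C W X Y u v \<Longrightarrow> zigzag_eq C W X Y v u"
| trans: "\<lbrakk>zigzag_eq C W X Y u v; zigzag_eq C W X Y v w\<rbrakk> \<Longrightarrow> zigzag_eq C W X Y u w"

definition zigzag_class ::
  "('o, 'a) cat \<Rightarrow> ('o \<Rightarrow> 'o \<Rightarrow> 'a set) \<Rightarrow> 'o \<Rightarrow> 'o \<Rightarrow> ('o, 'a) step list \<Rightarrow> ('o, 'a) step list set" where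
  "zigzag_class C W X Y u = {v. zigzag_eq C W X Y u v}"

definition localization ::
  "('o, 'a) cat \<Rightarrow> ('o \<Rightarrow> 'o \<Rightarrow> 'a set) \<Rightarrow> ('o, ('o, 'a) step list set) cat" where
  "localization C W =
    \<lparr>Ob = Ob C,
     Hom = (\<lambda>X Y. {zigzag_class C W X Y u |u. zigzag C W X Y u}),
     Ident = (\<lambda>X. zigzag_class C W X X []),
     Comp = (\<lambda>X Y Z G F. \<Union>u\<in>F. \<Union>v\<in>G. zigzag_class C W X Z (u @ v))\<rparr>"

definition localization_map ::
  "('o, 'a) cat \<Rightarrow> ('o \<Rightarrow> 'o \<Rightarrow> 'a set) \<Rightarrow> 'o \<Rightarrow> 'o \<Rightarrow> 'a \<Rightarrow> ('o, 'a) step list set" where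
  "localization_map C W X Y f = zigzag_class C W X Y [Fwd X f Y]"


section \<open>Modules\<close>

text \<open>
  \<open>R\<close>-modules are those of \<^theory>\<open>HOL-Algebra.Module\<close>, with elements in an arbitrary type
  \<open>'m\<close> that plays the role of the universe. The ring multiplication and unit that the record
  type of modules carries along are not constrained and never used. Homomorphisms are extensional
  functions, so that equality of morphisms is equality on the carrier.
\<close>

definition module_homs ::
  "('r, 'x) ring_scheme \<Rightarrow> ('r, 'm) module \<Rightarrow> ('r, 'n) module \<Rightarrow> ('m \<Rightarrow> 'n) set" where
  "module_homs R M N = {f \<in> carrier M \<rightarrow>\<^sub>E carrier N.
    (\<forall>x\<in>carrier M. \<forall>y\<in>carrier M. f (x \<oplus>\<^bsub>M\<^esub> y) = f x \<oplus>\<^bsub>N\<^esub> f y) \<and>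
    (\<forall>r\<in>carrier R. \<forall>x\<in>carrier M. f (r \<odot>\<^bsub>M\<^esub> x) = r \<odot>\<^bsub>N\<^esub> f x)}"

definition Mod_cat :: "('r, 'x) ring_scheme \<Rightarrow> (('r, 'm) module, 'm \<Rightarrow> 'm) cat" where
  "Mod_cat R =
    \<lparr>Ob = {M. module R M},
     Hom = module_homs R,
     Ident = (\<lambda>M. \<lambda>x\<in>carrier M. x),
     Comp = (\<lambda>L M N g f. compose (carrier L) g f)\<rparr>"


section \<open>Spectrum, Thomason sets, supports\<close>

definition Spec :: "('r, 'x) ring_scheme \<Rightarrow> 'r set set" where
  "Spec R = {p. primeideal p R}"

definition zero_locus :: "('r, 'x) ring_scheme \<Rightarrow> 'r set \<Rightarrow> 'r set set" where
  "zero_locus R J = {p \<in> Spec R. J \<subseteq> p}"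

definition fg_ideal :: "('r, 'x) ring_scheme \<Rightarrow> 'r set \<Rightarrow> bool" where
  "fg_ideal R J \<longleftrightarrow> (\<exists>S. finite S \<and> S \<subseteq> carrier R \<and> J = Idl\<^bsub>R\<^esub> S)"

definition thomason :: "('r, 'x) ring_scheme \<Rightarrow> 'r set set \<Rightarrow> bool" where
  "thomason R Z \<longleftrightarrow> (\<exists>\<J>. (\<forall>J\<in>\<J>. fg_ideal R J) \<and> Z = (\<Union>J\<in>\<J>. zero_locus R J))"

text \<open>The fraction \<open>m / s\<close> in the localized module \<open>M\<^sub>p\<close>, and the set \<open>M\<^sub>p\<close> itself.\<close>

definition fraction ::
  "('r, 'x) ring_scheme \<Rightarrow> ('r, 'm) module \<Rightarrow> 'r set \<Rightarrow> 'm \<Rightarrow> 'r \<Rightarrow> ('m \<times> 'r) set" where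
  "fraction R M p m s = {(n, t). n \<in> carrier M \<and> t \<in> carrier R - p \<and>
    (\<exists>u\<in>carrier R - p. u \<odot>\<^bsub>M\<^esub> (t \<odot>\<^bsub>M\<^esub> m) = u \<odot>\<^bsub>M\<^esub> (s \<odot>\<^bsub>M\<^esub> n))}"

definition localized_module ::
  "('r, 'x) ring_scheme \<Rightarrow> ('r, 'm) module \<Rightarrow> 'r set \<Rightarrow> ('m \<times> 'r) set set" where
  "localized_module R M p = {fraction R M p m s |m s. m \<in> carrier M \<and> s \<in> carrier R - p}"

definition Supp :: "('r, 'x) ring_scheme \<Rightarrow> ('r, 'm) module \<Rightarrow> 'r set set" where
  "Supp R M = {p \<in> Spec R. localized_module R M p \<noteq> {fraction R M p \<zero>\<^bsub>M\<^esub> \<one>\<^bsub>R\<^esub>}}"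

definition torsion_class :: "('r, 'x) ring_scheme \<Rightarrow> 'r set set \<Rightarrow> ('r, 'm) module set" where
  "torsion_class R Z = {M. module R M \<and> Supp R M \<subseteq> Z}"

definition torsion_cat ::
  "('r, 'x) ring_scheme \<Rightarrow> 'r set set \<Rightarrow> (('r, 'm) module, 'm \<Rightarrow> 'm) cat" where
  "torsion_cat R Z = full_subcategory (Mod_cat R) (torsion_class R Z)"


section \<open>The unbounded derived category\<close>

record ('r, 'm) cochain =
  term_at :: "int \<Rightarrow> ('r, 'm) module"
  diff :: "int \<Rightarrow> 'm \<Rightarrow> 'm"

definition is_complex :: "('r, 'x) ring_scheme \<Rightarrow> ('r, 'm) cochain \<Rightarrow> bool" where
  "is_complex R X \<longleftrightarrow>
    (\<forall>n. module R (term_at X n)) \<and>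
    (\<forall>n. diff X n \<in> module_homs R (term_at X n) (term_at X (n + 1))) \<and>
    (\<forall>n. \<forall>x\<in>carrier (term_at X n). diff X (n + 1) (diff X n x) = \<zero>\<^bsub>term_at X (n + 2)\<^esub>)"

definition chain_maps ::
  "('r, 'x) ring_scheme \<Rightarrow> ('r, 'm) cochain \<Rightarrow> ('r, 'm) cochain \<Rightarrow> (int \<Rightarrow> 'm \<Rightarrow> 'm) set" where
  "chain_maps R X Y = {f.
    (\<forall>n. f n \<in> module_homs R (term_at X n) (term_at Y n)) \<and>
    (\<forall>n. \<forall>x\<in>carrier (term_at X n). diff Y n (f n x) = f (n + 1) (diff X n x))}"

definition zero_chain_map :: "('r, 'm) cochain \<Rightarrow> ('r, 'm) cochain \<Rightarrow> int \<Rightarrow> 'm \<Rightarrow> 'm" where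
  "zero_chain_map X Y n = (\<lambda>x\<in>carrier (term_at X n). \<zero>\<^bsub>term_at Y n\<^esub>)"

definition Ch_cat :: "('r, 'x) ring_scheme \<Rightarrow> (('r, 'm) cochain, int \<Rightarrow> 'm \<Rightarrow> 'm) cat" where
  "Ch_cat R =
    \<lparr>Ob = {X. is_complex R X},
     Hom = chain_maps R,
     Ident = (\<lambda>X n. \<lambda>x\<in>carrier (term_at X n). x),
     Comp = (\<lambda>X Y Z g f n. compose (carrier (term_at X n)) (g n) (f n))\<rparr>"

definition cocycles :: "('r, 'm) cochain \<Rightarrow> int \<Rightarrow> 'm set" where
  "cocycles X n = {x \<in> carrier (term_at X n). diff X n x = \<zero>\<^bsub>term_at X (n + 1)\<^esub>}"

definition coboundaries :: "('r, 'm) cochain \<Rightarrow> int \<Rightarrow> 'm set" where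
  "coboundaries X n = diff X (n - 1) ` carrier (term_at X (n - 1))"

text \<open>
  \<open>H\<^sup>n(X)\<close> as a module whose elements are the cosets of the coboundaries in the cocycles;
  the two irrelevant fields of the record are left undefined.
\<close>

definition cohomology :: "('r, 'm) cochain \<Rightarrow> int \<Rightarrow> ('r, 'm set) module" where
  "cohomology X n =
    \<lparr>carrier = {coboundaries X n +>\<^bsub>term_at X n\<^esub> x |x. x \<in> cocycles X n},
     mult = undefined,
     one = undefined,
     zero = coboundaries X n,
     add = (\<lambda>A B. A <+>\<^bsub>term_at X n\<^esub> B),
     smult = (\<lambda>r A. \<Union>x\<in>A. coboundaries X n +>\<^bsub>term_at X n\<^esub> (r \<odot>\<^bsub>term_at X n\<^esub> x))\<rparr>"

definition cohomology_map ::
  "('r, 'm) cochain \<Rightarrow> ('r, 'm) cochain \<Rightarrow> (int \<Rightarrow> 'm \<Rightarrow> 'm) \<Rightarrow> int \<Rightarrow> 'm set \<Rightarrow> 'm set" where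
  "cohomology_map X Y f n =
    (\<lambda>A\<in>carrier (cohomology X n). \<Union>x\<in>A. coboundaries Y n +>\<^bsub>term_at Y n\<^esub> f n x)"

definition quasi_isos ::
  "('r, 'x) ring_scheme \<Rightarrow> ('r, 'm) cochain \<Rightarrow> ('r, 'm) cochain \<Rightarrow> (int \<Rightarrow> 'm \<Rightarrow> 'm) set" where
  "quasi_isos R X Y = {f \<in> chain_maps R X Y.
    \<forall>n. bij_betw (cohomology_map X Y f n) (carrier (cohomology X n)) (carrier (cohomology Y n))}"

text \<open>
  Homotopy equivalences are quasi-isomorphisms and homotopic maps become equal once these are
  inverted, so \<open>D(R)\<close> is obtained directly from the category of complexes, without passing
  through the homotopy category.
\<close>

type_synonym ('r, 'm) derived_hom = "(('r, 'm) cochain, int \<Rightarrow> 'm \<Rightarrow> 'm) step list set"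

definition derived_cat ::
  "('r, 'x) ring_scheme \<Rightarrow> (('r, 'm) cochain, ('r, 'm) derived_hom) cat" where
  "derived_cat R = localization (Ch_cat R) (quasi_isos R)"

definition derived_zero ::
  "('r, 'x) ring_scheme \<Rightarrow> ('r, 'm) cochain \<Rightarrow> ('r, 'm) cochain \<Rightarrow> ('r, 'm) derived_hom" where
  "derived_zero R X Y = localization_map (Ch_cat R) (quasi_isos R) X Y (zero_chain_map X Y)"

text \<open>\<open>shift k X\<close> is \<open>X[k]\<close>, with \<open>X[k]\<^sup>n = X\<^sup>n\<^sup>+\<^sup>k\<close> and differential multiplied by \<open>(-1)\<^sup>k\<close>.\<close>

definition shift :: "int \<Rightarrow> ('r, 'm) cochain \<Rightarrow> ('r, 'm) cochain" where
  "shift k X =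
    \<lparr>term_at = (\<lambda>n. term_at X (n + k)),
     diff = (\<lambda>n. \<lambda>x\<in>carrier (term_at X (n + k)).
       if even k then diff X (n + k) x else \<ominus>\<^bsub>term_at X (n + k + 1)\<^esub> diff X (n + k) x)\<rparr>"


section \<open>The AJS heart of a Thomason filtration\<close>

definition thomason_filtration :: "('r, 'x) ring_scheme \<Rightarrow> (int \<Rightarrow> 'r set set) \<Rightarrow> bool" where
  "thomason_filtration R \<Phi> \<longleftrightarrow> (\<forall>n. thomason R (\<Phi> n)) \<and> (\<forall>m n. m \<le> n \<longrightarrow> \<Phi> n \<subseteq> \<Phi> m)"

definition ajs_aisle ::
  "('r, 'x) ring_scheme \<Rightarrow> (int \<Rightarrow> 'r set set) \<Rightarrow> ('r, 'm) cochain set" where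
  "ajs_aisle R \<Phi> = {X \<in> Ob (derived_cat R). \<forall>n. cohomology X n \<in> torsion_class R (\<Phi> n)}"

text \<open>\<open>Hom(U, Y) = 0\<close>: the zero of \<open>Hom(X, Y)\<close> in \<open>D(R)\<close> is the image of the zero chain map.\<close>

definition right_perp ::
  "('r, 'x) ring_scheme \<Rightarrow> ('r, 'm) cochain set \<Rightarrow> ('r, 'm) cochain set" where
  "right_perp R U = {Y \<in> Ob (derived_cat R). \<forall>X\<in>U. Hom (derived_cat R) X Y = {derived_zero R X Y}}"

definition ajs_heart ::
  "('r, 'x) ring_scheme \<Rightarrow> (int \<Rightarrow> 'r set set) \<Rightarrow> (('r, 'm) cochain, ('r, 'm) derived_hom) cat" where
  "ajs_heart R \<Phi> =
    full_subcategory (derived_cat R) (ajs_aisle R \<Phi> \<inter> shift 1 ` right_perp R (ajs_aisle R \<Phi>))"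

lemma thomason_filtration_step:
  assumes "thomason R Z" and "\<And>n. n \<le> 0 \<Longrightarrow> \<Phi> n = Z" and "\<And>n. n > 0 \<Longrightarrow> \<Phi> n = {}"
  shows "thomason_filtration R \<Phi>"
proof -
  have empty: "thomason R {}"
    unfolding thomason_def by (intro exI[of _ "{}"]) simp
  have \<Phi>: "\<Phi> n = (if n \<le> 0 then Z else {})" for n
    using assms by simp
  show ?thesis
    using assms(1) empty by (simp add: thomason_filtration_def \<Phi>)
qed

end

theory Submission
  imports Defs
begin

text \<open>
  Write \<open>\<tau>\<close> for the truncation \<open>\<tau>\<^sup>\<le>\<^sup>0\<close> of complexes. The whole argument rests on two natural families
  of chain maps, the inclusion \<open>\<tau> X \<rightarrow> X\<close> and the projection \<open>\<tau> X \<rightarrow> H\<^sup>0(X)[0]\<close>. The first is a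
  quasi-isomorphism when \<open>X\<close> has no cohomology in positive degrees, the second when it has none in
  negative degrees.

  Since \<open>\<tau>\<close> and \<open>H\<^sup>0\<close> turn quasi-isomorphisms into isomorphisms, they descend to \<open>D(R)\<close>, and so do
  the two families (\<open>derived_incl_natural\<close>, \<open>derived_proj_natural\<close>). This is the universal property of
  the localization, including its two-dimensional part \<open>natural_on_localization\<close>: a family of
  morphisms that is natural for chain maps is natural for all zigzags. Every statement about
  morphisms of \<open>D(R)\<close> is reduced in this way to chain maps, without resolutions and without a
  calculus of fractions. So it is enough that the modules with elements in the given type are
  closed under submodules and quotients; a quotient is realized on a set of coset representatives.

  The heart consists, up to isomorphism, of the complexes \<open>M[0]\<close> with \<open>M\<close> in the torsion class:

  \<^item> Let \<open>X = Y[1]\<close> belong to the heart. As \<open>X\<close> is in the aisle, its cohomology vanishes in positive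
    degrees and is torsion in the others. Then \<open>\<tau> Y\<close> is in the aisle as well, so its inclusion into
    \<open>Y\<close>, which is bijective on cohomology in degrees \<open>\<le> 0\<close>, is zero in \<open>D(R)\<close>. Hence \<open>H\<^sup>n(Y) = 0\<close> for
    \<open>n \<le> 0\<close>, that is, \<open>H\<^sup>n(X) = 0\<close> for \<open>n < 0\<close> (\<open>heart_cohomology\<close>).

  \<^item> Conversely, let \<open>U\<close> be in the aisle and \<open>Y = M[-1]\<close>. Naturality of the inclusion along a morphism
    \<open>U \<rightarrow> Y\<close> gives a factorization through \<open>\<tau> Y = 0\<close>, because \<open>\<tau> U \<rightarrow> U\<close> is invertible. So \<open>M[0]\<close> is in
    the heart (\<open>conc_in_heart\<close>).

  The functors \<open>H\<^sup>0\<close> and \<open>M \<mapsto> M[0]\<close> are then mutually inverse: \<open>H\<^sup>0(M[0]) = M\<close>, and on the heart both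
  maps in \<open>X \<leftarrow> \<tau> X \<rightarrow> H\<^sup>0(X)[0]\<close> are invertible and natural (\<open>conc_H_natural_iso\<close>).
\<close>

section \<open>Functors, natural isomorphisms and full subcategories\<close>

definition inverse_in :: "('o, 'a) cat \<Rightarrow> 'o \<Rightarrow> 'o \<Rightarrow> 'a \<Rightarrow> 'a" where
  "inverse_in C X Y f =
    (SOME g. g \<in> Hom C Y X \<and> Comp C X Y X g f = Ident C X \<and> Comp C Y X Y f g = Ident C Y)"

lemma inverse_in:
  assumes "is_iso C X Y f"
  shows "inverse_in C X Y f \<in> Hom C Y X"
    and "Comp C X Y X (inverse_in C X Y f) f = Ident C X"
    and "Comp C Y X Y f (inverse_in C X Y f) = Ident C Y"
proof -
  have "\<exists>g. g \<in> Hom C Y X \<and> Comp C X Y X g f = Ident C X \<and> Comp C Y X Y f g = Ident C Y"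
    using assms by (auto simp: is_iso_def)
  from someI_ex[OF this]
  show "inverse_in C X Y f \<in> Hom C Y X"
    and "Comp C X Y X (inverse_in C X Y f) f = Ident C X"
    and "Comp C Y X Y f (inverse_in C X Y f) = Ident C Y"
    by (auto simp: inverse_in_def)
qed

lemma is_isoI:
  assumes "f \<in> Hom C X Y" "g \<in> Hom C Y X" "Comp C X Y X g f = Ident C X"
    "Comp C Y X Y f g = Ident C Y"
  shows "is_iso C X Y f"
  using assms by (auto simp: is_iso_def)

lemma is_iso_inverse_in: "is_iso C X Y f \<Longrightarrow> is_iso C Y X (inverse_in C X Y f)"
  using inverse_in[of C X Y f] by (intro is_isoI[where g = f]) (simp_all add: is_iso_def[of C X Y f])

lemma is_functorD:
  assumes "is_functor C D F"
  shows "X \<in> Ob C \<Longrightarrow> on_ob F X \<in> Ob D"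
    and "X \<in> Ob C \<Longrightarrow> Y \<in> Ob C \<Longrightarrow> f \<in> Hom C X Y \<Longrightarrow> on_hom F X Y f \<in> Hom D (on_ob F X) (on_ob F Y)"
    and "X \<in> Ob C \<Longrightarrow> on_hom F X X (Ident C X) = Ident D (on_ob F X)"
    and "X \<in> Ob C \<Longrightarrow> Y \<in> Ob C \<Longrightarrow> Z \<in> Ob C \<Longrightarrow> f \<in> Hom C X Y \<Longrightarrow> g \<in> Hom C Y Z \<Longrightarrow>
      on_hom F X Z (Comp C X Y Z g f) =
        Comp D (on_ob F X) (on_ob F Y) (on_ob F Z) (on_hom F Y Z g) (on_hom F X Y f)"
  using assms by (auto simp: is_functor_def)

lemma comp_functor_simps [simp]:
  "on_ob (comp_functor G F) X = on_ob G (on_ob F X)"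
  "on_hom (comp_functor G F) X Y f = on_hom G (on_ob F X) (on_ob F Y) (on_hom F X Y f)"
  by (simp_all add: comp_functor_def)

lemma id_functor_simps [simp]: "on_ob id_functor X = X" "on_hom id_functor X Y f = f"
  by (simp_all add: id_functor_def)

lemma is_functor_comp:
  assumes "is_functor C D F" "is_functor D E G"
  shows "is_functor C E (comp_functor G F)"
  unfolding is_functor_def by (auto simp: is_functorD[OF assms(1)] is_functorD[OF assms(2)])

lemma is_functor_id: "is_functor C C id_functor"
  by (auto simp: is_functor_def)

lemma full_subcategory_simps [simp]:
  "Ob (full_subcategory C S) = Ob C \<inter> S"
  "Hom (full_subcategory C S) = Hom C"
  "Ident (full_subcategory C S) = Ident C"
  "Comp (full_subcategory C S) = Comp C"
  by (simp_all add: full_subcategory_def)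

lemma category_full_subcategory: "category C \<Longrightarrow> category (full_subcategory C S)"
  unfolding category_def by (simp; blast)

lemma is_iso_full_subcategory [simp]: "is_iso (full_subcategory C S) = is_iso C"
  by (intro ext) (simp add: is_iso_def)

lemma is_functor_full_subcategory:
  assumes "is_functor C D F" "\<And>X. X \<in> Ob C \<Longrightarrow> X \<in> S \<Longrightarrow> on_ob F X \<in> T"
  shows "is_functor (full_subcategory C S) (full_subcategory D T) F"
  using assms by (simp add: is_functor_def)

context category
begin

text \<open>
  A commutative square may be read against the direction of two opposite invertible sides; this is
  how naturality with respect to a morphism passes to its formal inverse.
\<close>

lemma square_invert:
  assumes ob: "X \<in> Ob C" "X' \<in> Ob C" "Y \<in> Ob C" "Y' \<in> Ob C"
    and a: "a \<in> Hom C X X'" "a' \<in> Hom C X' X" "Comp C X' X X' a a' = Ident C X'"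
    and b: "b \<in> Hom C Y Y'" "b' \<in> Hom C Y' Y" "Comp C Y Y' Y b' b = Ident C Y"
    and f: "f \<in> Hom C X Y" "g \<in> Hom C X' Y'"
    and sq: "Comp C X X' Y' g a = Comp C X Y Y' b f"
  shows "Comp C X' Y' Y b' g = Comp C X' X Y f a'"
proof -
  have "Comp C X' Y' Y b' g = Comp C X' Y' Y b' (Comp C X' X' Y' g (Comp C X' X X' a a'))"
    using a f ob comp_ident_right by simp
  also have "\<dots> = Comp C X' Y' Y b' (Comp C X' X Y' (Comp C X X' Y' g a) a')"
    using comp_assoc[OF ob(2,1,2,4) a(2,1) f(2)] by simp
  also have "\<dots> = Comp C X' Y' Y b' (Comp C X' Y Y' b (Comp C X' X Y f a'))"
    using comp_assoc[OF ob(2,1,3,4) a(2) f(1) b(1)] sq by simp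
  also have "\<dots> = Comp C X' Y Y (Comp C Y Y' Y b' b) (Comp C X' X Y f a')"
    by (rule comp_assoc) (use ob a b f comp_closed in auto)
  also have "\<dots> = Comp C X' X Y f a'"
    using b(3) comp_ident_left ob a f comp_closed by auto
  finally show ?thesis .
qed

lemma is_iso_cancel_right:
  assumes ob: "X \<in> Ob C" "Y \<in> Ob C" "Z \<in> Ob C" and a: "is_iso C X Y a"
    and f: "f \<in> Hom C Y Z" and g: "g \<in> Hom C Y Z" and eq: "Comp C X Y Z f a = Comp C X Y Z g a"
  shows "f = g"
proof -
  obtain b where ab: "a \<in> Hom C X Y" "b \<in> Hom C Y X" "Comp C Y X Y a b = Ident C Y"
    using a by (auto simp: is_iso_def)
  have "f = Comp C Y X Z (Comp C X Y Z f a) b"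
    using comp_assoc[of Y X Y Z b a f] ab ob f comp_ident_right by simp
  also have "\<dots> = g"
    using comp_assoc[of Y X Y Z b a g] ab ob g comp_ident_right unfolding eq by simp
  finally show ?thesis .
qed

lemma is_iso_comp:
  assumes ob: "X \<in> Ob C" "Y \<in> Ob C" "Z \<in> Ob C" and f: "is_iso C X Y f" and g: "is_iso C Y Z g"
  shows "is_iso C X Z (Comp C X Y Z g f)"
proof -
  obtain f' where f': "f \<in> Hom C X Y" "f' \<in> Hom C Y X" "Comp C X Y X f' f = Ident C X"
    "Comp C Y X Y f f' = Ident C Y"
    using f by (auto simp: is_iso_def)
  obtain g' where g': "g \<in> Hom C Y Z" "g' \<in> Hom C Z Y" "Comp C Y Z Y g' g = Ident C Y"
    "Comp C Z Y Z g g' = Ident C Z"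
    using g by (auto simp: is_iso_def)
  show ?thesis
  proof (rule is_isoI[where g = "Comp C Z Y X f' g'"])
    have "Comp C X Z X (Comp C Z Y X f' g') (Comp C X Y Z g f)
        = Comp C X Y X f' (Comp C X Z Y g' (Comp C X Y Z g f))"
      using comp_assoc[of X Z Y X "Comp C X Y Z g f" g' f'] comp_closed[OF ob f'(1) g'(1)] f' g' ob
      by simp
    also have "\<dots> = Comp C X Y X f' f"
      using comp_assoc[of X Y Z Y f g g'] comp_ident_left f' g' ob by simp
    finally show "Comp C X Z X (Comp C Z Y X f' g') (Comp C X Y Z g f) = Ident C X"
      using f' by simp
    have "Comp C Z X Z (Comp C X Y Z g f) (Comp C Z Y X f' g')
        = Comp C Z Y Z g (Comp C Z X Y f (Comp C Z Y X f' g'))"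
      using comp_assoc[of Z X Y Z "Comp C Z Y X f' g'" f g] comp_closed[OF ob(3,2,1) g'(2) f'(2)] f' g' ob
      by simp
    also have "\<dots> = Comp C Z Y Z g g'"
      using comp_assoc[of Z Y X Y g' f' f] comp_ident_left f' g' ob by simp
    finally show "Comp C Z X Z (Comp C X Y Z g f) (Comp C Z Y X f' g') = Ident C Z"
      using g' by simp
  qed (use comp_closed ob f' g' in auto)
qed

end


section \<open>The localization and its universal property\<close>

lemma zigzag_append:
  "zigzag C W X Y u \<Longrightarrow> zigzag C W Y Z v \<Longrightarrow> zigzag C W X Z (u @ v)"
  by (induction rule: zigzag.induct) (auto intro: zigzag.intros)

lemma zigzag_Ob: "zigzag C W X Y u \<Longrightarrow> X \<in> Ob C \<and> Y \<in> Ob C"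
  by (induction rule: zigzag.induct) auto

lemma zigzag_Fwd: "X \<in> Ob C \<Longrightarrow> Y \<in> Ob C \<Longrightarrow> f \<in> Hom C X Y \<Longrightarrow> zigzag C W X Y [Fwd X f Y]"
  by (auto intro: zigzag.intros)

lemma zigzag_Bwd:
  "X \<in> Ob C \<Longrightarrow> Y \<in> Ob C \<Longrightarrow> s \<in> Hom C Y X \<Longrightarrow> s \<in> W Y X \<Longrightarrow> zigzag C W X Y [Bwd X s Y]"
  by (auto intro: zigzag.intros)

text \<open>
  The relation replaces a subword in the middle of a zigzag, hence is stable under composition on
  both sides; composition of classes is well defined for this reason.
\<close>

lemma zigzag_eq_cong:
  assumes "zigzag_eq C W X Y u v" "zigzag C W X' X p" "zigzag C W Y Y' q"
  shows "zigzag_eq C W X' Y' (p @ u @ q) (p @ v @ q)"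
  using assms
proof (induction rule: zigzag_eq.induct)
  case (rel X A u B v v' Y w)
  then have "zigzag_eq C W X' Y' ((p @ u) @ v @ (w @ q)) ((p @ u) @ v' @ (w @ q))"
    by (intro zigzag_eq.rel zigzag_append)
  then show ?case by simp
qed (auto intro: zigzag_eq.intros zigzag_append)

definition localization_functor where
  "localization_functor C W = \<lparr>on_ob = (\<lambda>X. X), on_hom = localization_map C W\<rparr>"

lemma localization_functor_simps [simp]:
  "on_ob (localization_functor C W) X = X"
  "on_hom (localization_functor C W) X Y f = localization_map C W X Y f"
  by (simp_all add: localization_functor_def)

context category
begin

lemma zigzag_rel_zigzag:
  "zigzag_rel C W X Y u v \<Longrightarrow> zigzag C W X Y u \<and> zigzag C W X Y v"
  by (induction rule: zigzag_rel.induct)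
    (auto intro!: zigzag.intros intro: ident_closed comp_closed)

lemma zigzag_eq_zigzag:
  "zigzag_eq C W X Y u v \<Longrightarrow> zigzag C W X Y u \<and> zigzag C W X Y v"
  by (induction rule: zigzag_eq.induct) (auto dest: zigzag_rel_zigzag intro: zigzag_append)

lemma zigzag_eq_relI: "zigzag_rel C W X Y u v \<Longrightarrow> zigzag_eq C W X Y u v"
  using zigzag_eq.rel[of C W X X "[]" Y u v Y "[]"] zigzag_rel_zigzag[of W X Y u v] zigzag_Ob[of C W X Y u]
  by (auto intro: zigzag.intros)

lemma zigzag_class_eq_iff:
  assumes "zigzag C W X Y u"
  shows "zigzag_class C W X Y u = zigzag_class C W X Y v \<longleftrightarrow> zigzag_eq C W X Y u v"
proof
  assume "zigzag_class C W X Y u = zigzag_class C W X Y v"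
  then have "u \<in> zigzag_class C W X Y v"
    using zigzag_eq.refl[OF assms] by (auto simp: zigzag_class_def)
  then show "zigzag_eq C W X Y u v"
    by (simp add: zigzag_class_def zigzag_eq.sym)
next
  assume "zigzag_eq C W X Y u v"
  then have "zigzag_eq C W X Y u w \<longleftrightarrow> zigzag_eq C W X Y v w" for w
    by (meson zigzag_eq.sym zigzag_eq.trans)
  then show "zigzag_class C W X Y u = zigzag_class C W X Y v"
    by (simp add: zigzag_class_def)
qed

lemma zigzag_class_relI:
  "zigzag_rel C W X Y u v \<Longrightarrow> zigzag_class C W X Y u = zigzag_class C W X Y v"
  using zigzag_eq_relI zigzag_rel_zigzag zigzag_class_eq_iff by blast

lemma zigzag_class_self: "zigzag C W X Y u \<Longrightarrow> u \<in> zigzag_class C W X Y u"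
  by (simp add: zigzag_class_def zigzag_eq.refl)

lemma localization_simps [simp]:
  "Ob (localization C W) = Ob C"
  "Ident (localization C W) X = zigzag_class C W X X []"
  by (simp_all add: localization_def)

lemma localization_Hom_iff:
  "c \<in> Hom (localization C W) X Y \<longleftrightarrow> (\<exists>u. zigzag C W X Y u \<and> c = zigzag_class C W X Y u)"
  by (auto simp: localization_def)

lemma zigzag_class_in_Hom:
  "zigzag C W X Y u \<Longrightarrow> zigzag_class C W X Y u \<in> Hom (localization C W) X Y"
  by (auto simp: localization_Hom_iff)

lemma localization_Comp_class:
  assumes u: "zigzag C W X Y u" and v: "zigzag C W Y Z v"
  shows "Comp (localization C W) X Y Z (zigzag_class C W Y Z v) (zigzag_class C W X Y u) =
    zigzag_class C W X Z (u @ v)"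
proof -
  have "zigzag_class C W X Z (u' @ v') = zigzag_class C W X Z (u @ v)"
    if "zigzag_eq C W X Y u u'" "zigzag_eq C W Y Z v v'" for u' v'
  proof -
    have "zigzag_eq C W X Z (u @ v) (u' @ v)"
      using zigzag_eq_cong[OF that(1), of X "[]" Z v] zigzag_Ob[OF u] v
      by (auto intro: zigzag.nil)
    moreover have "zigzag_eq C W X Z (u' @ v) (u' @ v')"
      using zigzag_eq_cong[OF that(2), of X u' Z "[]"] zigzag_Ob[OF v] zigzag_eq_zigzag[OF that(1)]
      by (auto intro: zigzag.nil)
    ultimately have "zigzag_eq C W X Z (u @ v) (u' @ v')" by (rule zigzag_eq.trans)
    then show ?thesis
      using zigzag_class_eq_iff[OF zigzag_append[OF u v], of "u' @ v'"] by simp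
  qed
  then have "(\<Union>u'\<in>zigzag_class C W X Y u. \<Union>v'\<in>zigzag_class C W Y Z v. zigzag_class C W X Z (u' @ v')) =
      (\<Union>u'\<in>zigzag_class C W X Y u. \<Union>v'\<in>zigzag_class C W Y Z v. zigzag_class C W X Z (u @ v))"
    by (intro SUP_cong HOL.refl) (simp_all add: zigzag_class_def[of C W X Y] zigzag_class_def[of C W Y Z])
  also have "\<dots> = zigzag_class C W X Z (u @ v)"
    using zigzag_class_self[OF u] zigzag_class_self[OF v] by auto
  finally show ?thesis
    by (simp add: localization_def)
qed

lemma category_localization: "category (localization C W)"
proof
  fix X assume "X \<in> Ob (localization C W)"
  then show "Ident (localization C W) X \<in> Hom (localization C W) X X"
    by (auto intro!: zigzag_class_in_Hom zigzag.nil)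
next
  fix X Y Z f g
  assume "f \<in> Hom (localization C W) X Y" "g \<in> Hom (localization C W) Y Z"
  then show "Comp (localization C W) X Y Z g f \<in> Hom (localization C W) X Z"
    by (auto simp: localization_Hom_iff localization_Comp_class) (metis zigzag_append)
next
  fix X Y f
  assume "X \<in> Ob (localization C W)" "Y \<in> Ob (localization C W)" "f \<in> Hom (localization C W) X Y"
  then show "Comp (localization C W) X X Y f (Ident (localization C W) X) = f"
    and "Comp (localization C W) X Y Y (Ident (localization C W) Y) f = f"
    by (auto simp: localization_Hom_iff localization_Comp_class zigzag.nil)
next
  fix A X Y Z f g h
  assume "f \<in> Hom (localization C W) A X" "g \<in> Hom (localization C W) X Y"
    "h \<in> Hom (localization C W) Y Z"
  then obtain u v w where "zigzag C W A X u" "zigzag C W X Y v" "zigzag C W Y Z w"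
    and "f = zigzag_class C W A X u" "g = zigzag_class C W X Y v" "h = zigzag_class C W Y Z w"
    by (auto simp: localization_Hom_iff)
  then show "Comp (localization C W) A Y Z h (Comp (localization C W) A X Y g f) =
    Comp (localization C W) A X Z (Comp (localization C W) X Y Z h g) f"
    by (simp add: localization_Comp_class zigzag_append)
qed

lemma localization_map_in_Hom:
  "X \<in> Ob C \<Longrightarrow> Y \<in> Ob C \<Longrightarrow> f \<in> Hom C X Y \<Longrightarrow>
    localization_map C W X Y f \<in> Hom (localization C W) X Y"
  by (simp add: localization_map_def zigzag_class_in_Hom zigzag_Fwd)

lemma localization_map_comp:
  assumes "X \<in> Ob C" "Y \<in> Ob C" "Z \<in> Ob C" "f \<in> Hom C X Y" "g \<in> Hom C Y Z"
  shows "localization_map C W X Z (Comp C X Y Z g f) =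
    Comp (localization C W) X Y Z (localization_map C W Y Z g) (localization_map C W X Y f)"
  using zigzag_class_relI[OF zigzag_rel.comp[of X C Y Z f g W]] assms
  by (simp add: localization_map_def localization_Comp_class zigzag_Fwd)

lemma localization_map_ident:
  "X \<in> Ob C \<Longrightarrow> localization_map C W X X (Ident C X) = zigzag_class C W X X []"
  using zigzag_class_relI[OF zigzag_rel.ident[of X C W]] by (simp add: localization_map_def)

lemma localization_map_inverse:
  assumes "X \<in> Ob C" "Y \<in> Ob C" "s \<in> Hom C X Y" "s \<in> W X Y"
  shows "Comp (localization C W) X Y X (zigzag_class C W Y X [Bwd Y s X]) (localization_map C W X Y s) =
      Ident (localization C W) X"
    and "Comp (localization C W) Y X Y (localization_map C W X Y s) (zigzag_class C W Y X [Bwd Y s X]) =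
      Ident (localization C W) Y"
  using zigzag_class_relI[OF zigzag_rel.fwd_bwd[of X C Y s W]]
    zigzag_class_relI[OF zigzag_rel.bwd_fwd[of X C Y s W]] assms
  by (simp_all add: localization_map_def localization_Comp_class zigzag_Fwd zigzag_Bwd)

lemma localization_map_iso:
  assumes "X \<in> Ob C" "Y \<in> Ob C" "s \<in> Hom C X Y" "s \<in> W X Y"
  shows "is_iso (localization C W) X Y (localization_map C W X Y s)"
  using assms localization_map_inverse[of X Y s W, OF assms]
  by (intro is_isoI[where g = "zigzag_class C W Y X [Bwd Y s X]"])
    (auto simp del: localization_simps intro: localization_map_in_Hom zigzag_class_in_Hom zigzag_Bwd)

lemma is_functor_localization: "is_functor C (localization C W) (localization_functor C W)"
  unfolding is_functor_def
  by (auto simp: localization_map_in_Hom localization_map_comp localization_map_ident)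

text \<open>
  Every morphism of the localization is a composite of images of morphisms of \<open>C\<close> and of inverses
  of such images. So a property of morphisms that holds for identities and survives composition
  with these two kinds of generators holds for all of them.
\<close>

lemma localization_Hom_induct [consumes 1, case_names ident fwd bwd]:
  assumes c: "c \<in> Hom (localization C W) X Y"
    and "\<And>X. X \<in> Ob C \<Longrightarrow> P X X (Ident (localization C W) X)"
    and "\<And>X Y Z f u. X \<in> Ob C \<Longrightarrow> Y \<in> Ob C \<Longrightarrow> Z \<in> Ob C \<Longrightarrow> f \<in> Hom C X Y \<Longrightarrow>
      u \<in> Hom (localization C W) Y Z \<Longrightarrow> P Y Z u \<Longrightarrow>
      P X Z (Comp (localization C W) X Y Z u (localization_map C W X Y f))"
    and "\<And>X Y Z s s' u. X \<in> Ob C \<Longrightarrow> Y \<in> Ob C \<Longrightarrow> Z \<in> Ob C \<Longrightarrow> s \<in> Hom C Y X \<Longrightarrow> s \<in> W Y X \<Longrightarrow>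
      s' \<in> Hom (localization C W) X Y \<Longrightarrow>
      Comp (localization C W) Y X Y s' (localization_map C W Y X s) = Ident (localization C W) Y \<Longrightarrow>
      Comp (localization C W) X Y X (localization_map C W Y X s) s' = Ident (localization C W) X \<Longrightarrow>
      u \<in> Hom (localization C W) Y Z \<Longrightarrow> P Y Z u \<Longrightarrow>
      P X Z (Comp (localization C W) X Y Z u s')"
  shows "P X Y c"
proof -
  obtain u where u: "zigzag C W X Y u" and c: "c = zigzag_class C W X Y u"
    using c by (auto simp: localization_Hom_iff)
  from u have "P X Y (zigzag_class C W X Y u)"
  proof (induction rule: zigzag.induct)
    case (nil X)
    then show ?case using assms(2)[of X] by simp
  next
    case (fwd X Y f Z u)
    then show ?case
      using assms(3)[of X Y Z f "zigzag_class C W Y Z u"] zigzag_Ob[of C W Y Z u]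
      by (auto simp: localization_map_def localization_Comp_class zigzag_Fwd zigzag_class_in_Hom)
  next
    case (bwd X Y s Z u)
    have "P X Z (Comp (localization C W) X Y Z (zigzag_class C W Y Z u) (zigzag_class C W X Y [Bwd X s Y]))"
      using bwd zigzag_Ob[of C W Y Z u] localization_map_inverse[of Y X s W]
      by (intro assms(4)[where s = s] zigzag_class_in_Hom zigzag_Bwd) auto
    then show ?case using bwd
      by (simp add: localization_Comp_class zigzag_Bwd)
  qed
  then show ?thesis using c by simp
qed

text \<open>
  The two-dimensional part of the universal property: naturality of a family of morphisms between
  two functors on the localization need only be tested on morphisms that come from \<open>C\<close>, because a
  naturality square for an isomorphism can be read backwards as one for its inverse.
\<close>

lemma natural_on_localization:
  assumes D: "category D"
    and K: "is_functor (localization C W) D K" and L: "is_functor (localization C W) D L"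
    and \<nu>: "\<And>X. X \<in> Ob C \<Longrightarrow> \<nu> X \<in> Hom D (on_ob K X) (on_ob L X)"
    and nat: "\<And>X Y f. X \<in> Ob C \<Longrightarrow> Y \<in> Ob C \<Longrightarrow> f \<in> Hom C X Y \<Longrightarrow>
      Comp D (on_ob K X) (on_ob K Y) (on_ob L Y) (\<nu> Y) (on_hom K X Y (localization_map C W X Y f)) =
      Comp D (on_ob K X) (on_ob L X) (on_ob L Y) (on_hom L X Y (localization_map C W X Y f)) (\<nu> X)"
    and c: "c \<in> Hom (localization C W) X Y"
  shows "Comp D (on_ob K X) (on_ob K Y) (on_ob L Y) (\<nu> Y) (on_hom K X Y c) =
    Comp D (on_ob K X) (on_ob L X) (on_ob L Y) (on_hom L X Y c) (\<nu> X)"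
  using c
proof (induction rule: localization_Hom_induct)
  interpret D: category D by fact
  note KD = is_functorD[OF K, unfolded localization_simps(1)]
  note LD = is_functorD[OF L, unfolded localization_simps(1)]
  note [simp del] = localization_simps(2)
  have step: "Comp D (on_ob K X) (on_ob K Z) (on_ob L Z) (\<nu> Z)
        (on_hom K X Z (Comp (localization C W) X Y Z u t)) =
      Comp D (on_ob K X) (on_ob L X) (on_ob L Z)
        (on_hom L X Z (Comp (localization C W) X Y Z u t)) (\<nu> X)"
    if ob: "X \<in> Ob C" "Y \<in> Ob C" "Z \<in> Ob C"
      and t: "t \<in> Hom (localization C W) X Y" and u: "u \<in> Hom (localization C W) Y Z"
      and tn: "Comp D (on_ob K X) (on_ob K Y) (on_ob L Y) (\<nu> Y) (on_hom K X Y t) =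
        Comp D (on_ob K X) (on_ob L X) (on_ob L Y) (on_hom L X Y t) (\<nu> X)"
      and un: "Comp D (on_ob K Y) (on_ob K Z) (on_ob L Z) (\<nu> Z) (on_hom K Y Z u) =
        Comp D (on_ob K Y) (on_ob L Y) (on_ob L Z) (on_hom L Y Z u) (\<nu> Y)" for X Y Z t u
  proof -
    note mem = ob[THEN KD(1)] ob[THEN LD(1)] ob[THEN \<nu>] KD(2)[OF ob(1,2) t] KD(2)[OF ob(2,3) u]
      LD(2)[OF ob(1,2) t] LD(2)[OF ob(2,3) u]
    have "Comp D (on_ob K X) (on_ob K Z) (on_ob L Z) (\<nu> Z)
        (on_hom K X Z (Comp (localization C W) X Y Z u t)) =
      Comp D (on_ob K X) (on_ob K Y) (on_ob L Z)
        (Comp D (on_ob K Y) (on_ob K Z) (on_ob L Z) (\<nu> Z) (on_hom K Y Z u)) (on_hom K X Y t)"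
      using mem by (simp add: KD(4)[OF ob t u] D.comp_assoc)
    also have "\<dots> = Comp D (on_ob K X) (on_ob L Y) (on_ob L Z) (on_hom L Y Z u)
        (Comp D (on_ob K X) (on_ob K Y) (on_ob L Y) (\<nu> Y) (on_hom K X Y t))"
      using mem by (simp add: un D.comp_assoc)
    also have "\<dots> = Comp D (on_ob K X) (on_ob L X) (on_ob L Z)
        (Comp D (on_ob L X) (on_ob L Y) (on_ob L Z) (on_hom L Y Z u) (on_hom L X Y t)) (\<nu> X)"
      using mem by (simp add: tn D.comp_assoc)
    finally show ?thesis by (simp add: LD(4)[OF ob t u])
  qed
  {
    case (ident X)
    then show ?case by (simp add: KD LD \<nu> D.comp_ident_left D.comp_ident_right)
  next
    case (fwd X Y Z f u)
    then show ?case
      by (intro step nat localization_map_in_Hom)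
  next
    case (bwd X Y Z s s' u)
    note sL = localization_map_in_Hom[OF bwd(2,1,4), of W]
    have K1: "Comp D (on_ob K X) (on_ob K Y) (on_ob K X) (on_hom K Y X (localization_map C W Y X s)) (on_hom K X Y s')
        = Ident D (on_ob K X)"
      using bwd sL KD(3)[of X] KD(4)[of X Y X s' "localization_map C W Y X s"] by simp
    have L1: "Comp D (on_ob L Y) (on_ob L X) (on_ob L Y) (on_hom L X Y s') (on_hom L Y X (localization_map C W Y X s))
        = Ident D (on_ob L Y)"
      using bwd sL LD(3)[of Y] LD(4)[of Y X Y "localization_map C W Y X s" s'] by simp
    have "Comp D (on_ob K X) (on_ob L X) (on_ob L Y) (on_hom L X Y s') (\<nu> X) =
        Comp D (on_ob K X) (on_ob K Y) (on_ob L Y) (\<nu> Y) (on_hom K X Y s')"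
      by (rule D.square_invert[where a = "on_hom K Y X (localization_map C W Y X s)"
            and b = "on_hom L Y X (localization_map C W Y X s)"])
        (use bwd K1 L1 KD(1) LD(1) KD(2)[of X Y s'] KD(2)[OF bwd(2,1) sL] LD(2)[of X Y s']
          LD(2)[OF bwd(2,1) sL] \<nu> nat[OF bwd(2,1,4)] in simp_all)
    then show ?case
      using bwd by (intro step) auto
  }
qed

text \<open>
  A family of morphisms of \<open>C\<close> into a fixed object that is stable under precomposition, such as the zero maps,
  stays stable under precomposition in the localization: for \<open>s : Y \<rightarrow> X\<close> in \<open>W\<close> the member at \<open>Y\<close> is the
  member at \<open>X\<close> composed with \<open>s\<close>, so composing it with \<open>s\<inverse>\<close> gives back the member at \<open>X\<close>.
\<close>

lemma localization_map_absorbs: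
  assumes Y: "Y \<in> Ob C" and z: "\<And>X. X \<in> Ob C \<Longrightarrow> z X \<in> Hom C X Y"
    and absorb: "\<And>X X' f. X \<in> Ob C \<Longrightarrow> X' \<in> Ob C \<Longrightarrow> f \<in> Hom C X X' \<Longrightarrow> Comp C X X' Y (z X') f = z X"
    and c: "c \<in> Hom (localization C W) X X'"
  shows "Comp (localization C W) X X' Y (localization_map C W X' Y (z X')) c =
    localization_map C W X Y (z X)"
  using c
proof (induction rule: localization_Hom_induct)
  interpret L: category "localization C W" by (rule category_localization)
  let ?z = "\<lambda>X. localization_map C W X Y (z X)"
  note [simp del] = localization_simps(2)
  have zH: "?z X \<in> Hom (localization C W) X Y" if "X \<in> Ob C" for X
    using that Y z by (intro localization_map_in_Hom)
  have zf: "Comp (localization C W) X X' Y (?z X') (localization_map C W X X' f) = ?z X"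
    if "X \<in> Ob C" "X' \<in> Ob C" "f \<in> Hom C X X'" for X X' f
    using localization_map_comp[OF that(1,2) Y that(3) z[OF that(2)], of W] absorb[OF that] by simp
  {
    case (ident X)
    then show ?case using zH L.comp_ident_right[of X Y "?z X"] Y by simp
  next
    case (fwd X Y' Z f u)
    then show ?case
      using L.comp_assoc[of X Y' Z Y "localization_map C W X Y' f" u "?z Z"] Y zH zf
        localization_map_in_Hom[of X Y' f W] by simp
  next
    case (bwd X Y' Z s s' u)
    have "Comp (localization C W) X Z Y (?z Z) (Comp (localization C W) X Y' Z u s') =
        Comp (localization C W) X Y' Y (?z Y') s'"
      using L.comp_assoc[of X Y' Z Y s' u "?z Z"] bwd Y zH by simp
    also have "\<dots> = Comp (localization C W) X Y' Y
        (Comp (localization C W) Y' X Y (?z X) (localization_map C W Y' X s)) s'"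
      using bwd zf[of Y' X s] by simp
    also have "\<dots> = ?z X"
      using L.comp_assoc[of X Y' X Y s' "localization_map C W Y' X s" "?z X"] bwd Y zH
        localization_map_in_Hom[of Y' X s W] L.comp_ident_right[of X Y "?z X"] by simp
    finally show ?case .
  }
qed

end

text \<open>
  The extension of \<open>F\<close> to formal composites. Zigzags are written in diagrammatic order, so the first
  step becomes the rightmost factor; \<open>Z\<close> is the endpoint of the zigzag, which the empty list does not record.
\<close>

primrec zigzag_value where
  "zigzag_value D F Z [] = Ident D (on_ob F Z)"
| "zigzag_value D F Z (a # u) = (case a of
    Fwd X f Y \<Rightarrow> Comp D (on_ob F X) (on_ob F Y) (on_ob F Z) (zigzag_value D F Z u) (on_hom F X Y f)
  | Bwd X s Y \<Rightarrow> Comp D (on_ob F X) (on_ob F Y) (on_ob F Z) (zigzag_value D F Z u)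
      (inverse_in D (on_ob F Y) (on_ob F X) (on_hom F Y X s)))"

text \<open>
  A morphism of the localization is a class of zigzags; evaluating any representative will do by
  \<open>zigzag_value_eq\<close>.
\<close>

definition lift_functor where
  "lift_functor D F = \<lparr>on_ob = on_ob F, on_hom = (\<lambda>X Y c. zigzag_value D F Y (SOME u. u \<in> c))\<rparr>"

locale inverting_functor = C: category C + D: category D
  for C :: "('o, 'a) cat" and D :: "('p, 'b) cat" +
  fixes W :: "'o \<Rightarrow> 'o \<Rightarrow> 'a set" and F :: "('o, 'a, 'p, 'b) functor_data"
  assumes is_functor: "is_functor C D F"
    and inverts: "X \<in> Ob C \<Longrightarrow> Y \<in> Ob C \<Longrightarrow> s \<in> Hom C X Y \<Longrightarrow> s \<in> W X Y \<Longrightarrow>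
      is_iso D (on_ob F X) (on_ob F Y) (on_hom F X Y s)"
begin

lemmas F = is_functorD[OF is_functor]

lemma zigzag_value_closed:
  "zigzag C W X Y u \<Longrightarrow> zigzag_value D F Y u \<in> Hom D (on_ob F X) (on_ob F Y)"
proof (induction rule: zigzag.induct)
  case (bwd X Y s Z u)
  then show ?case using inverse_in(1)[OF inverts[of Y X s]] F zigzag_Ob[OF bwd(5)]
    by (auto intro!: D.comp_closed)
qed (auto dest!: zigzag_Ob intro!: D.comp_closed D.ident_closed F)

lemma zigzag_value_append:
  assumes "zigzag C W X Y u" "zigzag C W Y Z v"
  shows "zigzag_value D F Z (u @ v) =
    Comp D (on_ob F X) (on_ob F Y) (on_ob F Z) (zigzag_value D F Z v) (zigzag_value D F Y u)"
  using assms
proof (induction rule: zigzag.induct)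
  case (nil X)
  then show ?case
    using F zigzag_value_closed[OF nil(2)] zigzag_Ob[OF nil(2)] by (simp add: D.comp_ident_right)
next
  case (fwd X Y' f Y u)
  then show ?case
    using F zigzag_value_closed zigzag_Ob[OF fwd(4)] zigzag_Ob[OF fwd(6)]
    by (simp add: D.comp_assoc)
next
  case (bwd X Y' s Y u)
  then show ?case
    using F zigzag_value_closed zigzag_Ob[OF bwd(5)] zigzag_Ob[OF bwd(7)]
      inverse_in(1)[OF inverts[of Y' X s]]
    by (simp add: D.comp_assoc)
qed

text \<open>
  The four relations imposed on zigzags hold in \<open>D\<close>: two are functoriality of \<open>F\<close>, the other two say
  that \<open>F s\<close> is invertible.
\<close>

lemma zigzag_value_rel:
  "zigzag_rel C W X Y u v \<Longrightarrow> zigzag_value D F Y u = zigzag_value D F Y v"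
proof (induction rule: zigzag_rel.induct)
  case (fwd_bwd X Y s)
  then show ?case
    using inverse_in[OF inverts[of X Y s]] F by (simp add: D.comp_ident_left)
next
  case (bwd_fwd X Y s)
  then show ?case
    using inverse_in[OF inverts[of X Y s]] F by (simp add: D.comp_ident_left)
next
  case (comp X Y Z f g)
  then show ?case
    using F D.comp_ident_left C.comp_closed D.comp_closed by simp
qed (use F D.comp_ident_left D.ident_closed in auto)

lemma zigzag_value_eq:
  "zigzag_eq C W X Y u v \<Longrightarrow> zigzag_value D F Y u = zigzag_value D F Y v"
proof (induction rule: zigzag_eq.induct)
  case (rel X X' u Y' v v' Y w)
  have v: "zigzag C W X' Y' v" "zigzag C W X' Y' v'"
    using C.zigzag_rel_zigzag[OF rel(2)] by auto
  show ?case
    using zigzag_value_append[OF rel(1) zigzag_append[OF v(1) rel(3)]]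
      zigzag_value_append[OF rel(1) zigzag_append[OF v(2) rel(3)]]
      zigzag_value_append[OF v(1) rel(3)] zigzag_value_append[OF v(2) rel(3)]
      zigzag_value_rel[OF rel(2)] by simp
qed auto

lemma lift_functor_on_ob [simp]: "on_ob (lift_functor D F) X = on_ob F X"
  by (simp add: lift_functor_def)

lemma lift_functor_class:
  assumes "zigzag C W X Y u"
  shows "on_hom (lift_functor D F) X Y (zigzag_class C W X Y u) = zigzag_value D F Y u"
proof -
  have "(SOME v. v \<in> zigzag_class C W X Y u) \<in> zigzag_class C W X Y u"
    using C.zigzag_class_self[OF assms] by (rule someI)
  then show ?thesis
    unfolding lift_functor_def using zigzag_value_eq[of X Y u] by (simp add: zigzag_class_def)
qed

lemma lift_functor_localization_map:
  assumes "X \<in> Ob C" "Y \<in> Ob C" "f \<in> Hom C X Y"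
  shows "on_hom (lift_functor D F) X Y (localization_map C W X Y f) = on_hom F X Y f"
  using assms F by (simp add: localization_map_def lift_functor_class zigzag_Fwd D.comp_ident_left)

lemma is_functor_lift: "is_functor (localization C W) D (lift_functor D F)"
  unfolding is_functor_def
  by (auto simp: C.localization_Hom_iff lift_functor_class zigzag_value_closed zigzag.nil
      C.localization_Comp_class zigzag_append zigzag_value_append F)

end


section \<open>Modules\<close>

lemma module_homsI:
  assumes "\<And>x. x \<in> carrier M \<Longrightarrow> f x \<in> carrier N" and "f \<in> extensional (carrier M)"
    and "\<And>x y. x \<in> carrier M \<Longrightarrow> y \<in> carrier M \<Longrightarrow> f (x \<oplus>\<^bsub>M\<^esub> y) = f x \<oplus>\<^bsub>N\<^esub> f y"
    and "\<And>r x. r \<in> carrier R \<Longrightarrow> x \<in> carrier M \<Longrightarrow> f (r \<odot>\<^bsub>M\<^esub> x) = r \<odot>\<^bsub>N\<^esub> f x"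
  shows "f \<in> module_homs R M N"
  using assms by (auto simp: module_homs_def PiE_def)

lemma module_homsD:
  assumes "f \<in> module_homs R M N"
  shows "x \<in> carrier M \<Longrightarrow> f x \<in> carrier N" and "f \<in> extensional (carrier M)"
    and "x \<in> carrier M \<Longrightarrow> y \<in> carrier M \<Longrightarrow> f (x \<oplus>\<^bsub>M\<^esub> y) = f x \<oplus>\<^bsub>N\<^esub> f y"
    and "r \<in> carrier R \<Longrightarrow> x \<in> carrier M \<Longrightarrow> f (r \<odot>\<^bsub>M\<^esub> x) = r \<odot>\<^bsub>N\<^esub> f x"
  using assms by (auto simp: module_homs_def PiE_def)

lemma module_homs_eqI:
  assumes "f \<in> module_homs R M N" "g \<in> module_homs R M N'"
    and "\<And>x. x \<in> carrier M \<Longrightarrow> f x = g x"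
  shows "f = g"
  using module_homsD(2)[OF assms(1)] module_homsD(2)[OF assms(2)] assms(3)
  by (rule extensionalityI)

lemma module_ring_closed:
  assumes "module R M"
  shows "\<zero>\<^bsub>R\<^esub> \<in> carrier R" and "\<one>\<^bsub>R\<^esub> \<in> carrier R" and "\<ominus>\<^bsub>R\<^esub> \<one>\<^bsub>R\<^esub> \<in> carrier R"
proof -
  interpret module R M by fact
  show "\<zero>\<^bsub>R\<^esub> \<in> carrier R" and "\<one>\<^bsub>R\<^esub> \<in> carrier R" and "\<ominus>\<^bsub>R\<^esub> \<one>\<^bsub>R\<^esub> \<in> carrier R" by auto
qed

lemma module_closed:
  assumes "module R M"
  shows "\<zero>\<^bsub>M\<^esub> \<in> carrier M"
    and "x \<in> carrier M \<Longrightarrow> y \<in> carrier M \<Longrightarrow> x \<oplus>\<^bsub>M\<^esub> y \<in> carrier M"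
    and "r \<in> carrier R \<Longrightarrow> x \<in> carrier M \<Longrightarrow> r \<odot>\<^bsub>M\<^esub> x \<in> carrier M"
    and "x \<in> carrier M \<Longrightarrow> \<ominus>\<^bsub>M\<^esub> x \<in> carrier M"
proof -
  interpret module R M by fact
  show "\<zero>\<^bsub>M\<^esub> \<in> carrier M" and "x \<in> carrier M \<Longrightarrow> y \<in> carrier M \<Longrightarrow> x \<oplus>\<^bsub>M\<^esub> y \<in> carrier M"
    and "r \<in> carrier R \<Longrightarrow> x \<in> carrier M \<Longrightarrow> r \<odot>\<^bsub>M\<^esub> x \<in> carrier M"
    and "x \<in> carrier M \<Longrightarrow> \<ominus>\<^bsub>M\<^esub> x \<in> carrier M" by auto
qed

lemma module_zero_simps:
  assumes "module R M"
  shows "\<zero>\<^bsub>M\<^esub> \<oplus>\<^bsub>M\<^esub> \<zero>\<^bsub>M\<^esub> = \<zero>\<^bsub>M\<^esub>" and "r \<in> carrier R \<Longrightarrow> r \<odot>\<^bsub>M\<^esub> \<zero>\<^bsub>M\<^esub> = \<zero>\<^bsub>M\<^esub>"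
    and "\<ominus>\<^bsub>M\<^esub> \<zero>\<^bsub>M\<^esub> = \<zero>\<^bsub>M\<^esub>" and "x \<in> carrier M \<Longrightarrow> x \<oplus>\<^bsub>M\<^esub> \<zero>\<^bsub>M\<^esub> = x"
    and "x \<in> carrier M \<Longrightarrow> \<zero>\<^bsub>R\<^esub> \<odot>\<^bsub>M\<^esub> x = \<zero>\<^bsub>M\<^esub>"
    and "x \<in> carrier M \<Longrightarrow> \<one>\<^bsub>R\<^esub> \<odot>\<^bsub>M\<^esub> x = x"
    and "x \<in> carrier M \<Longrightarrow> \<ominus>\<^bsub>M\<^esub> x = (\<ominus>\<^bsub>R\<^esub> \<one>\<^bsub>R\<^esub>) \<odot>\<^bsub>M\<^esub> x"
    and "x \<in> carrier M \<Longrightarrow> \<ominus>\<^bsub>M\<^esub> (\<ominus>\<^bsub>M\<^esub> x) = x"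
proof -
  interpret module R M by fact
  show "\<zero>\<^bsub>M\<^esub> \<oplus>\<^bsub>M\<^esub> \<zero>\<^bsub>M\<^esub> = \<zero>\<^bsub>M\<^esub>" and "r \<in> carrier R \<Longrightarrow> r \<odot>\<^bsub>M\<^esub> \<zero>\<^bsub>M\<^esub> = \<zero>\<^bsub>M\<^esub>"
    and "\<ominus>\<^bsub>M\<^esub> \<zero>\<^bsub>M\<^esub> = \<zero>\<^bsub>M\<^esub>" and "x \<in> carrier M \<Longrightarrow> x \<oplus>\<^bsub>M\<^esub> \<zero>\<^bsub>M\<^esub> = x"
    and "x \<in> carrier M \<Longrightarrow> \<zero>\<^bsub>R\<^esub> \<odot>\<^bsub>M\<^esub> x = \<zero>\<^bsub>M\<^esub>"
    and "x \<in> carrier M \<Longrightarrow> \<one>\<^bsub>R\<^esub> \<odot>\<^bsub>M\<^esub> x = x"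
    and "x \<in> carrier M \<Longrightarrow> \<ominus>\<^bsub>M\<^esub> x = (\<ominus>\<^bsub>R\<^esub> \<one>\<^bsub>R\<^esub>) \<odot>\<^bsub>M\<^esub> x"
    and "x \<in> carrier M \<Longrightarrow> \<ominus>\<^bsub>M\<^esub> (\<ominus>\<^bsub>M\<^esub> x) = x"
    by (auto simp: smult_l_minus)
qed

lemma module_hom_zero:
  assumes M: "module R M" and N: "module R N" and f: "f \<in> module_homs R M N"
  shows "f \<zero>\<^bsub>M\<^esub> = \<zero>\<^bsub>N\<^esub>"
proof -
  have "f (\<zero>\<^bsub>R\<^esub> \<odot>\<^bsub>M\<^esub> \<zero>\<^bsub>M\<^esub>) = \<zero>\<^bsub>R\<^esub> \<odot>\<^bsub>N\<^esub> f \<zero>\<^bsub>M\<^esub>"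
    using module_homsD(4)[OF f] module_ring_closed[OF M] module_closed[OF M] by blast
  then show ?thesis
    using module_zero_simps[OF M] module_zero_simps[OF N] module_closed[OF M]
      module_ring_closed[OF M] module_homsD(1)[OF f] by simp
qed

lemma module_homs_compose:
  assumes M: "module R M" and f: "f \<in> module_homs R L M" and L: "module R L"
    and g: "g \<in> module_homs R M N"
  shows "compose (carrier L) g f \<in> module_homs R L N"
  by (rule module_homsI)
    (use module_homsD[OF f] module_homsD[OF g] module_closed[OF L] in \<open>auto simp: compose_def\<close>)

lemma module_homs_zero:
  assumes "module R M" "module R N"
  shows "(\<lambda>x\<in>carrier M. \<zero>\<^bsub>N\<^esub>) \<in> module_homs R M N"
  by (rule module_homsI)
    (use module_closed[OF assms(1)] module_closed[OF assms(2)] module_zero_simps[OF assms(2)] in auto)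

lemma category_Mod_cat: "category (Mod_cat R)"
proof
  fix X Y f assume "X \<in> Ob (Mod_cat R)" "Y \<in> Ob (Mod_cat R)" "f \<in> Hom (Mod_cat R) X Y"
  then have f: "module R X" "f \<in> module_homs R X Y" by (auto simp: Mod_cat_def)
  show "Comp (Mod_cat R) X X Y f (Ident (Mod_cat R) X) = f"
    and "Comp (Mod_cat R) X Y Y (Ident (Mod_cat R) Y) f = f"
    using f(1) module_homsD(1,2)[OF f(2)]
    by (auto simp: Mod_cat_def compose_def fun_eq_iff extensional_def restrict_def)
next
  fix W X Y Z f g h assume "f \<in> Hom (Mod_cat R) W X" "g \<in> Hom (Mod_cat R) X Y" "h \<in> Hom (Mod_cat R) Y Z"
  then show "Comp (Mod_cat R) W Y Z h (Comp (Mod_cat R) W X Y g f) =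
        Comp (Mod_cat R) W X Z (Comp (Mod_cat R) X Y Z h g) f"
    using module_homsD(1)[of f R W X] by (auto simp: Mod_cat_def compose_def fun_eq_iff)
qed (auto simp: Mod_cat_def module_homs_compose module_closed intro!: module_homsI)

lemma Mod_cat_simps [simp]:
  "M \<in> Ob (Mod_cat R) \<longleftrightarrow> module R M"
  "Hom (Mod_cat R) = module_homs R"
  "Ident (Mod_cat R) M = (\<lambda>x\<in>carrier M. x)"
  "Comp (Mod_cat R) L M N g f = compose (carrier L) g f"
  by (simp_all add: Mod_cat_def)

lemma bijective_hom_is_iso:
  assumes M: "module R M" and N: "module R N" and f: "f \<in> module_homs R M N"
    and bij: "bij_betw f (carrier M) (carrier N)"
  shows "is_iso (Mod_cat R) M N f"
proof (rule is_isoI)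
  let ?g = "\<lambda>y\<in>carrier N. inv_into (carrier M) f y"
  have g: "inv_into (carrier M) f y \<in> carrier M" "f (inv_into (carrier M) f y) = y" if "y \<in> carrier N" for y
    using bij that by (auto simp: bij_betw_def inv_into_into f_inv_into_f)
  have fg: "inv_into (carrier M) f (f x) = x" if "x \<in> carrier M" for x
    using bij that by (auto simp: bij_betw_def)
  have inj: "x = y" if "x \<in> carrier M" "y \<in> carrier M" "f x = f y" for x y
    using bij that by (auto simp: bij_betw_def dest: inj_onD)
  show "f \<in> Hom (Mod_cat R) M N" using f by simp
  have "?g \<in> module_homs R N M"
  proof (rule module_homsI)
    fix x y assume "x \<in> carrier N" "y \<in> carrier N"
    then show "?g (x \<oplus>\<^bsub>N\<^esub> y) = ?g x \<oplus>\<^bsub>M\<^esub> ?g y"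
      using g module_closed[OF M] module_closed[OF N] module_homsD[OF f] by - (rule inj, auto)
  next
    fix r x assume "r \<in> carrier R" "x \<in> carrier N"
    then show "?g (r \<odot>\<^bsub>N\<^esub> x) = r \<odot>\<^bsub>M\<^esub> ?g x"
      using g module_closed[OF M] module_closed[OF N] module_homsD[OF f] by - (rule inj, auto)
  qed (use g in auto)
  then show "?g \<in> Hom (Mod_cat R) N M" by simp
  show "Comp (Mod_cat R) M N M ?g f = Ident (Mod_cat R) M"
    "Comp (Mod_cat R) N M N f ?g = Ident (Mod_cat R) N"
    using g fg module_homsD(1)[OF f] by (auto simp: compose_def fun_eq_iff)
qed

text \<open>The module axioms are equations between operations, negation among them, so they pass to images.\<close>

lemma module_image:
  assumes M: "module R M" and onto: "carrier N = f ` carrier M"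
    and zero: "\<zero>\<^bsub>N\<^esub> = f \<zero>\<^bsub>M\<^esub>"
    and add: "\<And>x y. x \<in> carrier M \<Longrightarrow> y \<in> carrier M \<Longrightarrow> f x \<oplus>\<^bsub>N\<^esub> f y = f (x \<oplus>\<^bsub>M\<^esub> y)"
    and smult: "\<And>r x. r \<in> carrier R \<Longrightarrow> x \<in> carrier M \<Longrightarrow> r \<odot>\<^bsub>N\<^esub> f x = f (r \<odot>\<^bsub>M\<^esub> x)"
  shows "module R N"
proof -
  interpret module R M by fact
  have "abelian_group N"
  proof (rule abelian_groupI)
    fix x assume "x \<in> carrier N"
    then obtain a where "a \<in> carrier M" "x = f a" using onto by auto
    then show "\<exists>y\<in>carrier N. y \<oplus>\<^bsub>N\<^esub> x = \<zero>\<^bsub>N\<^esub>"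
      using onto add zero by (intro bexI[of _ "f (\<ominus>\<^bsub>M\<^esub> a)"]) (auto simp: M.l_neg)
  qed (auto simp: onto add zero M.add.m_ac)
  then show ?thesis
    using R.cring_axioms
    by (intro moduleI)
      (auto simp: onto add smult smult_l_distr smult_r_distr smult_assoc1)
qed

lemma submodule_closedI:
  assumes M: "module R M" and "K \<subseteq> carrier M" "\<zero>\<^bsub>M\<^esub> \<in> K"
    and "\<And>x y. x \<in> K \<Longrightarrow> y \<in> K \<Longrightarrow> x \<oplus>\<^bsub>M\<^esub> y \<in> K"
    and smult: "\<And>r x. r \<in> carrier R \<Longrightarrow> x \<in> K \<Longrightarrow> r \<odot>\<^bsub>M\<^esub> x \<in> K"
  shows "submodule K R M"
proof (rule module.submoduleI[OF M])
  fix x assume "x \<in> K"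
  then show "\<ominus>\<^bsub>M\<^esub> x \<in> K"
    using module_zero_simps(7)[OF M, of x] smult[of "\<ominus>\<^bsub>R\<^esub> \<one>\<^bsub>R\<^esub>" x] module_ring_closed[OF M] assms(2)
    by auto
qed (use assms in auto)

lemma submodule_zero: "module R M \<Longrightarrow> submodule {\<zero>\<^bsub>M\<^esub>} R M"
  using module_closed module_zero_simps by (intro submodule_closedI) fastforce+

text \<open>Cosets of a submodule, in the form in which cohomology uses them.\<close>

lemma submodule_cosets:
  assumes M: "module R M" and B: "submodule B R M"
  shows "B \<subseteq> carrier M" and "\<zero>\<^bsub>M\<^esub> \<in> B" and "B +>\<^bsub>M\<^esub> \<zero>\<^bsub>M\<^esub> = B"
    and "x \<in> carrier M \<Longrightarrow> x \<in> B +>\<^bsub>M\<^esub> x"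
    and "x \<in> carrier M \<Longrightarrow> y \<in> carrier M \<Longrightarrow>
      (B +>\<^bsub>M\<^esub> x) <+>\<^bsub>M\<^esub> (B +>\<^bsub>M\<^esub> y) = B +>\<^bsub>M\<^esub> (x \<oplus>\<^bsub>M\<^esub> y)"
    and "x \<in> carrier M \<Longrightarrow> y \<in> B +>\<^bsub>M\<^esub> x \<Longrightarrow> B +>\<^bsub>M\<^esub> y = B +>\<^bsub>M\<^esub> x"
    and "y \<in> B +>\<^bsub>M\<^esub> x \<longleftrightarrow> (\<exists>b\<in>B. y = b \<oplus>\<^bsub>M\<^esub> x)"
    and "x \<in> carrier M \<Longrightarrow> B +>\<^bsub>M\<^esub> x = B \<Longrightarrow> x \<in> B"
    and "x \<in> B \<Longrightarrow> B +>\<^bsub>M\<^esub> x = B"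
proof -
  interpret module R M by fact
  interpret submodule B R M by fact
  interpret abelian_subgroup B M
    by (intro abelian_subgroupI3 additive_subgroupI subgroup_axioms M.abelian_group_axioms)
  show "B \<subseteq> carrier M" and z: "\<zero>\<^bsub>M\<^esub> \<in> B" and "B +>\<^bsub>M\<^esub> \<zero>\<^bsub>M\<^esub> = B"
    using a_subset by auto
  show self: "x \<in> carrier M \<Longrightarrow> x \<in> B +>\<^bsub>M\<^esub> x" by (rule a_rcos_self)
  show "x \<in> carrier M \<Longrightarrow> y \<in> carrier M \<Longrightarrow>
      (B +>\<^bsub>M\<^esub> x) <+>\<^bsub>M\<^esub> (B +>\<^bsub>M\<^esub> y) = B +>\<^bsub>M\<^esub> (x \<oplus>\<^bsub>M\<^esub> y)" by (rule a_rcos_sum)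
  show "x \<in> carrier M \<Longrightarrow> y \<in> B +>\<^bsub>M\<^esub> x \<Longrightarrow> B +>\<^bsub>M\<^esub> y = B +>\<^bsub>M\<^esub> x"
    using a_repr_independence' by blast
  show "y \<in> B +>\<^bsub>M\<^esub> x \<longleftrightarrow> (\<exists>b\<in>B. y = b \<oplus>\<^bsub>M\<^esub> x)"
    by (simp add: a_r_coset_def r_coset_def)
  show "x \<in> carrier M \<Longrightarrow> B +>\<^bsub>M\<^esub> x = B \<Longrightarrow> x \<in> B" using self by auto
  show "x \<in> B \<Longrightarrow> B +>\<^bsub>M\<^esub> x = B" by (rule a_rcos_const)
qed

text \<open>
  The union on the left is the form in which scalar multiplication and induced maps on cohomology are
  given; all its members agree because \<open>g\<close> sends congruent elements to congruent elements.
\<close>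

lemma UN_coset:
  assumes M: "module R M" "submodule B R M" and N: "module R N" "submodule B' R N"
    and g: "\<And>x. x \<in> carrier M \<Longrightarrow> g x \<in> carrier N"
      "\<And>x y. x \<in> carrier M \<Longrightarrow> y \<in> carrier M \<Longrightarrow> g (x \<oplus>\<^bsub>M\<^esub> y) = g x \<oplus>\<^bsub>N\<^esub> g y"
    and sub: "\<And>b. b \<in> B \<Longrightarrow> g b \<in> B'"
    and x: "x \<in> carrier M"
  shows "(\<Union>y\<in>B +>\<^bsub>M\<^esub> x. B' +>\<^bsub>N\<^esub> g y) = B' +>\<^bsub>N\<^esub> g x"
proof -
  have "B' +>\<^bsub>N\<^esub> g y = B' +>\<^bsub>N\<^esub> g x" if y: "y \<in> B +>\<^bsub>M\<^esub> x" for y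
  proof -
    obtain b where b: "b \<in> B" "y = b \<oplus>\<^bsub>M\<^esub> x" using y submodule_cosets(7)[OF M] by auto
    moreover have "b \<in> carrier M" using b(1) submodule_cosets(1)[OF M] by auto
    ultimately have "g y \<in> B' +>\<^bsub>N\<^esub> g x"
      using g(2) sub x submodule_cosets(7)[OF N] by auto
    then show ?thesis using submodule_cosets(6)[OF N] g(1)[OF x] by blast
  qed
  moreover have "x \<in> B +>\<^bsub>M\<^esub> x" by (rule submodule_cosets(4)[OF M x])
  ultimately show ?thesis by blast
qed

lemma a_r_coset_carrier_update [simp]: "B +>\<^bsub>M\<lparr>carrier := K\<rparr>\<^esub> x = B +>\<^bsub>M\<^esub> x"
  by (simp add: a_r_coset_def r_coset_def)

lemma set_add_carrier_update [simp]: "(<+>\<^bsub>M\<lparr>carrier := K\<rparr>\<^esub>) = (<+>\<^bsub>M\<^esub>)"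
  by (intro ext) (simp add: set_add_def set_mult_def)

text \<open>
  A module moved along an injection \<open>e\<close> of its carrier into another type. Cohomology modules consist
  of cosets; choosing a representative of every coset brings them back to the type in which the
  modules of a complex live.
\<close>

definition transport :: "('m \<Rightarrow> 'n) \<Rightarrow> ('r, 'm) module \<Rightarrow> ('r, 'n) module" where
  "transport e M =
    \<lparr>carrier = e ` carrier M, mult = undefined, one = undefined, zero = e \<zero>\<^bsub>M\<^esub>,
     add = (\<lambda>a b. e (inv_into (carrier M) e a \<oplus>\<^bsub>M\<^esub> inv_into (carrier M) e b)),
     smult = (\<lambda>r a. e (r \<odot>\<^bsub>M\<^esub> inv_into (carrier M) e a))\<rparr>"

lemma transport_simps:
  assumes "inj_on e (carrier M)"
  shows "carrier (transport e M) = e ` carrier M" and "\<zero>\<^bsub>transport e M\<^esub> = e \<zero>\<^bsub>M\<^esub>"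
    and "x \<in> carrier M \<Longrightarrow> y \<in> carrier M \<Longrightarrow> e x \<oplus>\<^bsub>transport e M\<^esub> e y = e (x \<oplus>\<^bsub>M\<^esub> y)"
    and "x \<in> carrier M \<Longrightarrow> r \<odot>\<^bsub>transport e M\<^esub> e x = e (r \<odot>\<^bsub>M\<^esub> x)"
  using assms by (auto simp: transport_def)

lemma module_transport:
  assumes "module R M" "inj_on e (carrier M)"
  shows "module R (transport e M)"
  by (rule module_image[OF assms(1), where f = e]) (auto simp: transport_simps[OF assms(2)])

lemma transport_functor:
  fixes F :: "('o, 'a, ('r, 'm) module, 'm \<Rightarrow> 'm) functor_data" and e :: "'m \<Rightarrow> 'n"
  assumes F: "is_functor C (Mod_cat R) F"
    and e: "\<And>X. X \<in> Ob C \<Longrightarrow> inj_on e (carrier (on_ob F X))"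
  shows "is_functor C (Mod_cat R)
    \<lparr>on_ob = (\<lambda>X. transport e (on_ob F X)),
     on_hom = (\<lambda>X Y f. \<lambda>a\<in>e ` carrier (on_ob F X). e (on_hom F X Y f (inv_into (carrier (on_ob F X)) e a)))\<rparr>"
  unfolding is_functor_def
proof (intro conjI ballI; simp)
  note F' = is_functorD[OF F, simplified]
  fix X assume X: "X \<in> Ob C"
  note tX = transport_simps[OF e[OF X]]
  show "module R (transport e (on_ob F X))"
    using F' X e by (intro module_transport)
  show "(\<lambda>a\<in>e ` carrier (on_ob F X). e (on_hom F X X (Ident C X) (inv_into (carrier (on_ob F X)) e a))) =
      (\<lambda>x\<in>carrier (transport e (on_ob F X)). x)"
    using e X by (auto simp: tX F' fun_eq_iff)
  fix Y f assume Y: "Y \<in> Ob C" and f: "f \<in> Hom C X Y"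
  note tY = transport_simps[OF e[OF Y]] and h = module_homsD[OF F'(2)[OF X Y f]]
  show "(\<lambda>a\<in>e ` carrier (on_ob F X). e (on_hom F X Y f (inv_into (carrier (on_ob F X)) e a)))
      \<in> module_homs R (transport e (on_ob F X)) (transport e (on_ob F Y))"
    using e[OF X] h module_closed[OF F'(1)[OF X]]
    by (intro module_homsI) (auto simp: tX tY inj_on_eq_iff[OF e[OF X]])
  fix Z g assume Z: "Z \<in> Ob C" and g: "g \<in> Hom C Y Z"
  show "(\<lambda>a\<in>e ` carrier (on_ob F X). e (on_hom F X Z (Comp C X Y Z g f) (inv_into (carrier (on_ob F X)) e a))) =
       compose (carrier (transport e (on_ob F X)))
        (\<lambda>a\<in>e ` carrier (on_ob F Y). e (on_hom F Y Z g (inv_into (carrier (on_ob F Y)) e a)))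
        (\<lambda>a\<in>e ` carrier (on_ob F X). e (on_hom F X Y f (inv_into (carrier (on_ob F X)) e a)))"
    using e[OF X] e[OF Y] h(1) by (auto simp: tX F'(4)[OF X Y Z f g] compose_def fun_eq_iff)
qed


section \<open>Complexes and their cohomology\<close>

lemma is_complexD:
  assumes "is_complex R X"
  shows "module R (term_at X n)"
    and "diff X n \<in> module_homs R (term_at X n) (term_at X (n + 1))"
    and "x \<in> carrier (term_at X n) \<Longrightarrow> diff X (n + 1) (diff X n x) = \<zero>\<^bsub>term_at X (n + 2)\<^esub>"
  using assms by (auto simp: is_complex_def)

lemma chain_mapsD:
  assumes "f \<in> chain_maps R X Y"
  shows "f n \<in> module_homs R (term_at X n) (term_at Y n)"
    and "x \<in> carrier (term_at X n) \<Longrightarrow> diff Y n (f n x) = f (n + 1) (diff X n x)"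
  using assms by (auto simp: chain_maps_def)

lemma chain_maps_compose:
  assumes X: "is_complex R X" and Y: "is_complex R Y" and f: "f \<in> chain_maps R X Y" and g: "g \<in> chain_maps R Y Z"
  shows "(\<lambda>n. compose (carrier (term_at X n)) (g n) (f n)) \<in> chain_maps R X Z"
  using module_homs_compose[OF is_complexD(1)[OF Y] chain_mapsD(1)[OF f] is_complexD(1)[OF X] chain_mapsD(1)[OF g]]
    chain_mapsD(2)[OF f] chain_mapsD(2)[OF g] module_homsD(1)[OF chain_mapsD(1)[OF f]]
    module_homsD(1)[OF is_complexD(2)[OF X]]
  by (simp add: chain_maps_def compose_def)

lemma Ch_cat_simps [simp]:
  "X \<in> Ob (Ch_cat R) \<longleftrightarrow> is_complex R X"
  "Hom (Ch_cat R) = chain_maps R"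
  "Ident (Ch_cat R) X = (\<lambda>n. \<lambda>x\<in>carrier (term_at X n). x)"
  "Comp (Ch_cat R) X Y Z g f = (\<lambda>n. compose (carrier (term_at X n)) (g n) (f n))"
  by (simp_all add: Ch_cat_def)

lemma category_Ch_cat: "category (Ch_cat R)"
proof
  fix X assume "X \<in> Ob (Ch_cat R)"
  then have X: "is_complex R X" by simp
  show "Ident (Ch_cat R) X \<in> Hom (Ch_cat R) X X"
    using module_homsD(1)[OF is_complexD(2)[OF X]] module_closed[OF is_complexD(1)[OF X]]
    by (auto simp: chain_maps_def intro!: module_homsI)
next
  fix X Y f assume "X \<in> Ob (Ch_cat R)" "Y \<in> Ob (Ch_cat R)" "f \<in> Hom (Ch_cat R) X Y"
  then have f: "f \<in> chain_maps R X Y" by simp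
  show "Comp (Ch_cat R) X X Y f (Ident (Ch_cat R) X) = f"
    and "Comp (Ch_cat R) X Y Y (Ident (Ch_cat R) Y) f = f"
    using module_homsD(1,2)[OF chain_mapsD(1)[OF f]]
    by (auto simp: compose_def fun_eq_iff extensional_def restrict_def)
next
  fix W X Y Z f g h assume "f \<in> Hom (Ch_cat R) W X" "g \<in> Hom (Ch_cat R) X Y" "h \<in> Hom (Ch_cat R) Y Z"
  then show "Comp (Ch_cat R) W Y Z h (Comp (Ch_cat R) W X Y g f) =
        Comp (Ch_cat R) W X Z (Comp (Ch_cat R) X Y Z h g) f"
    using module_homsD(1)[OF chain_mapsD(1)[of f R W X]] by (auto simp: compose_def fun_eq_iff)
qed (auto simp: chain_maps_compose)

lemma submodule_cocycles:
  assumes X: "is_complex R X"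
  shows "submodule (cocycles X n) R (term_at X n)"
  unfolding cocycles_def
  using is_complexD(1)[OF X] module_closed[OF is_complexD(1)[OF X]] module_zero_simps[OF is_complexD(1)[OF X]]
    module_homsD[OF is_complexD(2)[OF X]]
    module_hom_zero[OF is_complexD(1)[OF X] is_complexD(1)[OF X] is_complexD(2)[OF X]]
  by (intro submodule_closedI) auto

lemma submodule_coboundaries:
  assumes X: "is_complex R X"
  shows "submodule (coboundaries X n) R (term_at X n)"
proof -
  have d: "diff X (n - 1) \<in> module_homs R (term_at X (n - 1)) (term_at X n)"
    using is_complexD(2)[OF X, of "n - 1"] by simp
  note M = is_complexD(1)[OF X, of "n - 1"]
  show ?thesis
    unfolding coboundaries_def
  proof (rule submodule_closedI[OF is_complexD(1)[OF X]])
    show "\<zero>\<^bsub>term_at X n\<^esub> \<in> diff X (n - 1) ` carrier (term_at X (n - 1))"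
      using module_hom_zero[OF M is_complexD(1)[OF X] d] module_closed(1)[OF M] by (metis imageI)
  qed (use module_homsD[OF d] module_closed[OF M] in
      \<open>auto simp: module_homsD(3)[OF d, symmetric] module_homsD(4)[OF d, symmetric]\<close>)
qed

lemma coboundaries_subset_cocycles: "is_complex R X \<Longrightarrow> coboundaries X n \<subseteq> cocycles X n"
  using is_complexD(3)[of R X _ "n - 1"] module_homsD(1)[OF is_complexD(2), of R X _ "n - 1"]
  by (auto simp: coboundaries_def cocycles_def add.commute[of 1 n])

lemma cocycles_carrier: "x \<in> cocycles X n \<Longrightarrow> x \<in> carrier (term_at X n)"
  by (simp add: cocycles_def)

lemma cohomology_simps:
  assumes X: "is_complex R X"
  shows "carrier (cohomology X n) = (\<lambda>x. coboundaries X n +>\<^bsub>term_at X n\<^esub> x) ` cocycles X n"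
    and "\<zero>\<^bsub>cohomology X n\<^esub> = coboundaries X n"
    and "x \<in> carrier (term_at X n) \<Longrightarrow> y \<in> carrier (term_at X n) \<Longrightarrow>
      (coboundaries X n +>\<^bsub>term_at X n\<^esub> x) \<oplus>\<^bsub>cohomology X n\<^esub> (coboundaries X n +>\<^bsub>term_at X n\<^esub> y) =
      coboundaries X n +>\<^bsub>term_at X n\<^esub> (x \<oplus>\<^bsub>term_at X n\<^esub> y)"
    and "r \<in> carrier R \<Longrightarrow> x \<in> carrier (term_at X n) \<Longrightarrow>
      r \<odot>\<^bsub>cohomology X n\<^esub> (coboundaries X n +>\<^bsub>term_at X n\<^esub> x) =
      coboundaries X n +>\<^bsub>term_at X n\<^esub> (r \<odot>\<^bsub>term_at X n\<^esub> x)"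
proof -
  note M = is_complexD(1)[OF X, of n] and B = submodule_coboundaries[OF X, of n]
  show "carrier (cohomology X n) = (\<lambda>x. coboundaries X n +>\<^bsub>term_at X n\<^esub> x) ` cocycles X n"
    by (auto simp: cohomology_def)
  show "\<zero>\<^bsub>cohomology X n\<^esub> = coboundaries X n" by (simp add: cohomology_def)
  show "x \<in> carrier (term_at X n) \<Longrightarrow> y \<in> carrier (term_at X n) \<Longrightarrow>
      (coboundaries X n +>\<^bsub>term_at X n\<^esub> x) \<oplus>\<^bsub>cohomology X n\<^esub> (coboundaries X n +>\<^bsub>term_at X n\<^esub> y) =
      coboundaries X n +>\<^bsub>term_at X n\<^esub> (x \<oplus>\<^bsub>term_at X n\<^esub> y)"
    using submodule_cosets(5)[OF M B] by (simp add: cohomology_def)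
  assume r: "r \<in> carrier R" and x: "x \<in> carrier (term_at X n)"
  have "r \<odot>\<^bsub>term_at X n\<^esub> b \<in> coboundaries X n" if "b \<in> coboundaries X n" for b
    using submodule.smult_closed[OF B r that] .
  moreover have "r \<odot>\<^bsub>term_at X n\<^esub> (a \<oplus>\<^bsub>term_at X n\<^esub> b) = r \<odot>\<^bsub>term_at X n\<^esub> a \<oplus>\<^bsub>term_at X n\<^esub> r \<odot>\<^bsub>term_at X n\<^esub> b"
    if "a \<in> carrier (term_at X n)" "b \<in> carrier (term_at X n)" for a b
    using module.smult_r_distr[OF M r that] .
  ultimately show "r \<odot>\<^bsub>cohomology X n\<^esub> (coboundaries X n +>\<^bsub>term_at X n\<^esub> x) =
      coboundaries X n +>\<^bsub>term_at X n\<^esub> (r \<odot>\<^bsub>term_at X n\<^esub> x)"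
    using UN_coset[OF M B M B, of "\<lambda>x. r \<odot>\<^bsub>term_at X n\<^esub> x" x] module_closed(3)[OF M r] x
    by (simp add: cohomology_def)
qed

lemma module_cohomology:
  assumes X: "is_complex R X"
  shows "module R (cohomology X n)"
proof -
  note M = is_complexD(1)[OF X, of n]
  have "module R (term_at X n\<lparr>carrier := cocycles X n\<rparr>)"
    using submodule.submodule_is_module[OF submodule_cocycles[OF X] M] .
  then show ?thesis
    by (rule module_image[where f = "\<lambda>x. coboundaries X n +>\<^bsub>term_at X n\<^esub> x"])
      (auto simp: cohomology_simps[OF X] submodule_cosets(3)[OF M submodule_coboundaries[OF X]]
        dest!: cocycles_carrier)
qed

lemma chain_map_cocycles:
  assumes X: "is_complex R X" and Y: "is_complex R Y" and f: "f \<in> chain_maps R X Y"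
  shows "x \<in> cocycles X n \<Longrightarrow> f n x \<in> cocycles Y n"
    and "x \<in> coboundaries X n \<Longrightarrow> f n x \<in> coboundaries Y n"
proof -
  show "f n x \<in> cocycles Y n" if "x \<in> cocycles X n"
    using that module_homsD(1)[OF chain_mapsD(1)[OF f]] chain_mapsD(2)[OF f, of x n]
      module_hom_zero[OF is_complexD(1)[OF X] is_complexD(1)[OF Y] chain_mapsD(1)[OF f]]
    by (auto simp: cocycles_def)
  show "f n x \<in> coboundaries Y n" if "x \<in> coboundaries X n"
    using that module_homsD(1)[OF chain_mapsD(1)[OF f]] chain_mapsD(2)[OF f, of _ "n - 1"]
    by (auto simp: coboundaries_def image_iff) metis
qed

lemma cohomology_map_coset:
  assumes X: "is_complex R X" and Y: "is_complex R Y" and f: "f \<in> chain_maps R X Y"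
    and x: "x \<in> cocycles X n"
  shows "cohomology_map X Y f n (coboundaries X n +>\<^bsub>term_at X n\<^esub> x) =
    coboundaries Y n +>\<^bsub>term_at Y n\<^esub> f n x"
  using x UN_coset[OF is_complexD(1)[OF X] submodule_coboundaries[OF X] is_complexD(1)[OF Y]
      submodule_coboundaries[OF Y], of n "f n" n x] module_homsD[OF chain_mapsD(1)[OF f]]
    chain_map_cocycles(2)[OF X Y f] cocycles_carrier[OF x]
  by (simp add: cohomology_map_def cohomology_simps[OF X])

lemma cohomology_map_hom:
  assumes X: "is_complex R X" and Y: "is_complex R Y" and f: "f \<in> chain_maps R X Y"
  shows "cohomology_map X Y f n \<in> module_homs R (cohomology X n) (cohomology Y n)"
proof (rule module_homsI)
  note c = cohomology_map_coset[OF X Y f] and Z = chain_map_cocycles(1)[OF X Y f]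
  note s = cohomology_simps[OF X] cohomology_simps[OF Y]
  note h = module_homsD[OF chain_mapsD(1)[OF f]]
  have closed: "x \<oplus>\<^bsub>term_at X n\<^esub> y \<in> cocycles X n" "r \<in> carrier R \<Longrightarrow> r \<odot>\<^bsub>term_at X n\<^esub> x \<in> cocycles X n"
    if "x \<in> cocycles X n" "y \<in> cocycles X n" for x y r
    using that module_closed[OF submodule.submodule_is_module[OF submodule_cocycles[OF X] is_complexD(1)[OF X]]]
    by auto
  show "cohomology_map X Y f n A \<in> carrier (cohomology Y n)" if "A \<in> carrier (cohomology X n)" for A
    using that by (auto simp: s c Z)
  show "cohomology_map X Y f n \<in> extensional (carrier (cohomology X n))"
    by (simp add: cohomology_map_def)
  show "cohomology_map X Y f n (A \<oplus>\<^bsub>cohomology X n\<^esub> B) =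
      cohomology_map X Y f n A \<oplus>\<^bsub>cohomology Y n\<^esub> cohomology_map X Y f n B"
    if "A \<in> carrier (cohomology X n)" "B \<in> carrier (cohomology X n)" for A B
    using that by (auto simp: s c closed h cocycles_carrier)
  show "cohomology_map X Y f n (r \<odot>\<^bsub>cohomology X n\<^esub> A) = r \<odot>\<^bsub>cohomology Y n\<^esub> cohomology_map X Y f n A"
    if "r \<in> carrier R" "A \<in> carrier (cohomology X n)" for r A
    using that by (auto simp: s c closed h cocycles_carrier)
qed

definition cohomology_functor ::
  "int \<Rightarrow> (('r, 'm) cochain, int \<Rightarrow> 'm \<Rightarrow> 'm, ('r, 'm set) module, 'm set \<Rightarrow> 'm set) functor_data" where
  "cohomology_functor n =
    \<lparr>on_ob = (\<lambda>X. cohomology X n), on_hom = (\<lambda>X Y f. cohomology_map X Y f n)\<rparr>"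

lemma cohomology_functor_simps [simp]:
  "on_ob (cohomology_functor n) X = cohomology X n"
  "on_hom (cohomology_functor n) X Y f = cohomology_map X Y f n"
  by (simp_all add: cohomology_functor_def)

lemma is_functor_cohomology: "is_functor (Ch_cat R) (Mod_cat R) (cohomology_functor n)"
  unfolding is_functor_def
proof (intro conjI ballI; simp)
  interpret Ch: category "Ch_cat R" by (rule category_Ch_cat)
  fix X :: "('a, 'b) cochain" assume X: "is_complex R X"
  show "module R (cohomology X n)" by (rule module_cohomology[OF X])
  have id: "(\<lambda>n. \<lambda>x\<in>carrier (term_at X n). x) \<in> chain_maps R X X"
    using Ch.ident_closed[of X] X by simp
  show "cohomology_map X X (\<lambda>n. \<lambda>x\<in>carrier (term_at X n). x) n = (\<lambda>x\<in>carrier (cohomology X n). x)"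
  proof (rule extensionalityI)
    show "cohomology_map X X (\<lambda>n. \<lambda>x\<in>carrier (term_at X n). x) n A = (\<lambda>x\<in>carrier (cohomology X n). x) A"
      if A: "A \<in> carrier (cohomology X n)" for A
    proof -
      obtain x where "x \<in> cocycles X n" "A = coboundaries X n +>\<^bsub>term_at X n\<^esub> x"
        using A by (auto simp: cohomology_simps[OF X])
      then show ?thesis
        using A cohomology_map_coset[OF X X id, of x n] by (simp add: cocycles_carrier)
    qed
  qed (auto simp: cohomology_map_def)
  fix Y f assume Y: "is_complex R Y" and f: "f \<in> chain_maps R X Y"
  show "cohomology_map X Y f n \<in> module_homs R (cohomology X n) (cohomology Y n)"
    by (rule cohomology_map_hom[OF X Y f])
  fix Z g assume Z: "is_complex R Z" and g: "g \<in> chain_maps R Y Z"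
  have gf: "(\<lambda>n. compose (carrier (term_at X n)) (g n) (f n)) \<in> chain_maps R X Z"
    by (rule chain_maps_compose[OF X Y f g])
  show "cohomology_map X Z (\<lambda>n. compose (carrier (term_at X n)) (g n) (f n)) n =
      compose (carrier (cohomology X n)) (cohomology_map Y Z g n) (cohomology_map X Y f n)"
    using cohomology_map_coset[OF X Z gf] cohomology_map_coset[OF X Y f] cohomology_map_coset[OF Y Z g]
      chain_map_cocycles(1)[OF X Y f]
    by (intro module_homs_eqI[OF cohomology_map_hom[OF X Z gf, of n]
          module_homs_compose[OF module_cohomology[OF Y] cohomology_map_hom[OF X Y f] module_cohomology[OF X] cohomology_map_hom[OF Y Z g]]])
      (auto simp: cohomology_simps[OF X] compose_def cocycles_carrier)
qed

lemma quasi_isosD: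
  assumes "f \<in> quasi_isos R X Y"
  shows "f \<in> chain_maps R X Y"
    and "bij_betw (cohomology_map X Y f n) (carrier (cohomology X n)) (carrier (cohomology Y n))"
  using assms by (auto simp: quasi_isos_def)

lemma inverting_cohomology:
  "inverting_functor (Ch_cat R) (Mod_cat R) (quasi_isos R) (cohomology_functor n)"
proof (intro inverting_functor.intro inverting_functor_axioms.intro category_Ch_cat category_Mod_cat
    is_functor_cohomology)
  fix X Y s assume "X \<in> Ob (Ch_cat R)" "Y \<in> Ob (Ch_cat R)" "s \<in> quasi_isos R X Y"
  then show "is_iso (Mod_cat R) (on_ob (cohomology_functor n) X) (on_ob (cohomology_functor n) Y)
      (on_hom (cohomology_functor n) X Y s)"
    by (auto intro!: bijective_hom_is_iso module_cohomology cohomology_map_hom dest: quasi_isosD)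
qed

definition some_elem :: "'m set \<Rightarrow> 'm" where
  "some_elem A = (SOME x. x \<in> A)"

text \<open>
  Distinct cosets are disjoint, so a representative determines its coset.
\<close>

lemma inj_on_some_elem:
  assumes X: "is_complex R X"
  shows "inj_on some_elem (carrier (cohomology X n))"
proof (rule inj_onI)
  note M = is_complexD(1)[OF X, of n] and B = submodule_coboundaries[OF X, of n]
  have coset: "coboundaries X n +>\<^bsub>term_at X n\<^esub> some_elem A = A" if A: "A \<in> carrier (cohomology X n)" for A
  proof -
    obtain x where x: "x \<in> carrier (term_at X n)" "A = coboundaries X n +>\<^bsub>term_at X n\<^esub> x"
      using A by (auto simp: cohomology_simps[OF X] dest: cocycles_carrier)
    have "some_elem A \<in> A"
      unfolding some_elem_def using submodule_cosets(4)[OF M B x(1)] x(2) by (intro someI) auto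
    then show ?thesis using submodule_cosets(6)[OF M B x(1)] x(2) by auto
  qed
  fix A A' assume "A \<in> carrier (cohomology X n)" "A' \<in> carrier (cohomology X n)" "some_elem A = some_elem A'"
  then show "A = A'" using coset by metis
qed

text \<open>
  Cohomology with values in modules over the type of the complexes themselves, as required for
  comparing it with \<open>M \<mapsto> M[0]\<close>.
\<close>

definition H_functor ::
  "int \<Rightarrow> (('r, 'm) cochain, int \<Rightarrow> 'm \<Rightarrow> 'm, ('r, 'm) module, 'm \<Rightarrow> 'm) functor_data" where
  "H_functor n =
    \<lparr>on_ob = (\<lambda>X. transport some_elem (cohomology X n)),
     on_hom = (\<lambda>X Y f. \<lambda>a\<in>some_elem ` carrier (cohomology X n).
       some_elem (cohomology_map X Y f n (inv_into (carrier (cohomology X n)) some_elem a)))\<rparr>"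

lemma is_functor_H: "is_functor (Ch_cat R) (Mod_cat R) (H_functor n)"
proof -
  have "inj_on some_elem (carrier (on_ob (cohomology_functor n) X))" if "X \<in> Ob (Ch_cat R)" for X
    using that inj_on_some_elem by simp
  from transport_functor[OF is_functor_cohomology this] show ?thesis
    by (simp add: H_functor_def)
qed

definition cohomology_rep :: "('r, 'm) cochain \<Rightarrow> int \<Rightarrow> 'm \<Rightarrow> 'm" where
  "cohomology_rep X n x = some_elem (coboundaries X n +>\<^bsub>term_at X n\<^esub> x)"

lemma H_simps:
  assumes X: "is_complex R X"
  shows "carrier (on_ob (H_functor n) X) = cohomology_rep X n ` cocycles X n"
    and "\<zero>\<^bsub>on_ob (H_functor n) X\<^esub> = cohomology_rep X n \<zero>\<^bsub>term_at X n\<^esub>"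
    and "x \<in> cocycles X n \<Longrightarrow> y \<in> cocycles X n \<Longrightarrow>
      cohomology_rep X n x \<oplus>\<^bsub>on_ob (H_functor n) X\<^esub> cohomology_rep X n y =
      cohomology_rep X n (x \<oplus>\<^bsub>term_at X n\<^esub> y)"
    and "r \<in> carrier R \<Longrightarrow> x \<in> cocycles X n \<Longrightarrow>
      r \<odot>\<^bsub>on_ob (H_functor n) X\<^esub> cohomology_rep X n x = cohomology_rep X n (r \<odot>\<^bsub>term_at X n\<^esub> x)"
    and "x \<in> cocycles X n \<Longrightarrow> y \<in> cocycles X n \<Longrightarrow>
      cohomology_rep X n x = cohomology_rep X n y \<longleftrightarrow>
      coboundaries X n +>\<^bsub>term_at X n\<^esub> x = coboundaries X n +>\<^bsub>term_at X n\<^esub> y"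
proof -
  note t = transport_simps[OF inj_on_some_elem[OF X, of n]] and s = cohomology_simps[OF X]
  have coset: "coboundaries X n +>\<^bsub>term_at X n\<^esub> x \<in> carrier (cohomology X n)" if "x \<in> cocycles X n" for x
    using that by (simp add: s)
  show "carrier (on_ob (H_functor n) X) = cohomology_rep X n ` cocycles X n"
    by (simp add: H_functor_def t s image_image cohomology_rep_def)
  show "\<zero>\<^bsub>on_ob (H_functor n) X\<^esub> = cohomology_rep X n \<zero>\<^bsub>term_at X n\<^esub>"
    using submodule_cosets(3)[OF is_complexD(1)[OF X] submodule_coboundaries[OF X]]
    by (simp add: H_functor_def t s cohomology_rep_def)
  show "x \<in> cocycles X n \<Longrightarrow> y \<in> cocycles X n \<Longrightarrow>
      cohomology_rep X n x \<oplus>\<^bsub>on_ob (H_functor n) X\<^esub> cohomology_rep X n y =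
      cohomology_rep X n (x \<oplus>\<^bsub>term_at X n\<^esub> y)"
    using coset t(3) s(3) by (simp add: H_functor_def cohomology_rep_def cocycles_carrier)
  show "r \<in> carrier R \<Longrightarrow> x \<in> cocycles X n \<Longrightarrow>
      r \<odot>\<^bsub>on_ob (H_functor n) X\<^esub> cohomology_rep X n x = cohomology_rep X n (r \<odot>\<^bsub>term_at X n\<^esub> x)"
    using coset t(4) s(4) by (simp add: H_functor_def cohomology_rep_def cocycles_carrier)
  show "x \<in> cocycles X n \<Longrightarrow> y \<in> cocycles X n \<Longrightarrow>
      cohomology_rep X n x = cohomology_rep X n y \<longleftrightarrow>
      coboundaries X n +>\<^bsub>term_at X n\<^esub> x = coboundaries X n +>\<^bsub>term_at X n\<^esub> y"
    unfolding cohomology_rep_def using coset inj_on_eq_iff[OF inj_on_some_elem[OF X, of n]] by blast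
qed

lemma H_map_rep:
  assumes X: "is_complex R X" and Y: "is_complex R Y" and f: "f \<in> chain_maps R X Y"
    and x: "x \<in> cocycles X n"
  shows "on_hom (H_functor n) X Y f (cohomology_rep X n x) = cohomology_rep Y n (f n x)"
  using x inj_on_some_elem[OF X, of n]
  by (auto simp: H_functor_def cohomology_rep_def cohomology_simps[OF X]
      inv_into_f_f cohomology_map_coset[OF X Y f])

lemma inverting_H:
  fixes R :: "('r, 'x) ring_scheme"
  shows "inverting_functor (Ch_cat R) (Mod_cat R) (quasi_isos R)
    (H_functor n :: (('r, 'm) cochain, _, _, _) functor_data)"
proof (intro inverting_functor.intro inverting_functor_axioms.intro category_Ch_cat category_Mod_cat
    is_functor_H)
  fix X Y :: "('r, 'm) cochain" and s
  assume "X \<in> Ob (Ch_cat R)" "Y \<in> Ob (Ch_cat R)" and s: "s \<in> quasi_isos R X Y"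
  then have X: "is_complex R X" and Y: "is_complex R Y" by auto
  note eX = inj_on_some_elem[OF X, of n] and eY = inj_on_some_elem[OF Y, of n]
  have "bij_betw (some_elem \<circ> (cohomology_map X Y s n \<circ> inv_into (carrier (cohomology X n)) some_elem))
      (some_elem ` carrier (cohomology X n)) (some_elem ` carrier (cohomology Y n))"
    using quasi_isosD(2)[OF s, of n] eX eY
    by (intro bij_betw_trans[of _ _ "carrier (cohomology Y n)"]
        bij_betw_trans[of _ _ "carrier (cohomology X n)"] bij_betw_inv_into)
      (auto simp: bij_betw_def)
  also have "?this \<longleftrightarrow> bij_betw (on_hom (H_functor n) X Y s)
      (carrier (on_ob (H_functor n) X)) (carrier (on_ob (H_functor n) Y))"
    by (auto simp: H_functor_def transport_simps[OF eX] transport_simps[OF eY] intro!: bij_betw_cong)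
  finally show "is_iso (Mod_cat R) (on_ob (H_functor n) X) (on_ob (H_functor n) Y)
      (on_hom (H_functor n) X Y s)"
    using is_functorD(1,2)[OF is_functor_H[of R n]] X Y quasi_isosD(1)[OF s]
    by - (rule bijective_hom_is_iso, simp_all)
qed


section \<open>The truncation to nonpositive degrees\<close>

text \<open>
  The truncation is a subcomplex. Its terms in positive degrees are zero submodules of the terms of
  \<open>X\<close>, so that every term is obtained by shrinking a carrier and the inclusion into \<open>X\<close> is the
  identity on elements.
\<close>

definition trunc_carrier :: "('r, 'm) cochain \<Rightarrow> int \<Rightarrow> 'm set" where
  "trunc_carrier X n =
    (if n < 0 then carrier (term_at X n) else if n = 0 then cocycles X 0 else {\<zero>\<^bsub>term_at X n\<^esub>})"

definition trunc :: "('r, 'm) cochain \<Rightarrow> ('r, 'm) cochain" where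
  "trunc X = \<lparr>term_at = (\<lambda>n. term_at X n\<lparr>carrier := trunc_carrier X n\<rparr>),
    diff = (\<lambda>n. restrict (diff X n) (trunc_carrier X n))\<rparr>"

definition trunc_functor ::
  "(('r, 'm) cochain, int \<Rightarrow> 'm \<Rightarrow> 'm, ('r, 'm) cochain, int \<Rightarrow> 'm \<Rightarrow> 'm) functor_data" where
  "trunc_functor = \<lparr>on_ob = trunc, on_hom = (\<lambda>X Y f n. restrict (f n) (trunc_carrier X n))\<rparr>"

definition trunc_incl :: "('r, 'm) cochain \<Rightarrow> int \<Rightarrow> 'm \<Rightarrow> 'm" where
  "trunc_incl X n = (\<lambda>x\<in>trunc_carrier X n. x)"

lemma trunc_simps [simp]:
  "term_at (trunc X) n = term_at X n\<lparr>carrier := trunc_carrier X n\<rparr>"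
  "diff (trunc X) n = restrict (diff X n) (trunc_carrier X n)"
  by (simp_all add: trunc_def)

lemma trunc_functor_simps [simp]:
  "on_ob trunc_functor X = trunc X"
  "on_hom trunc_functor X Y f = (\<lambda>n. restrict (f n) (trunc_carrier X n))"
  by (simp_all add: trunc_functor_def)

lemma submodule_trunc_carrier:
  assumes X: "is_complex R X"
  shows "submodule (trunc_carrier X n) R (term_at X n)"
  using submodule_cocycles[OF X, of 0] submodule_zero[OF is_complexD(1)[OF X]]
    module.carrier_is_submodule[OF is_complexD(1)[OF X]]
  by (simp add: trunc_carrier_def)

lemma trunc_carrier_subset: "is_complex R X \<Longrightarrow> x \<in> trunc_carrier X n \<Longrightarrow> x \<in> carrier (term_at X n)"
  using submodule_cosets(1)[OF is_complexD(1) submodule_trunc_carrier] by blast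

lemma module_trunc_term: "is_complex R X \<Longrightarrow> module R (term_at X n\<lparr>carrier := trunc_carrier X n\<rparr>)"
  by (rule submodule.submodule_is_module[OF submodule_trunc_carrier is_complexD(1)])

text \<open>
  Degree \<open>-1\<close> is the point where it matters that degree \<open>0\<close> keeps all cocycles.
\<close>

lemma trunc_carrier_diff:
  assumes X: "is_complex R X" and x: "x \<in> trunc_carrier X n"
  shows "diff X n x \<in> trunc_carrier X (n + 1)"
proof -
  consider "n + 1 < 0" | "n = - 1" | "n = 0" | "n > 0" by linarith
  then show ?thesis
  proof cases
    case 1
    then show ?thesis using x module_homsD(1)[OF is_complexD(2)[OF X]] by (simp add: trunc_carrier_def)
  next
    case 2
    then have "diff X n x \<in> coboundaries X 0" using x by (simp add: trunc_carrier_def coboundaries_def)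
    then show ?thesis using coboundaries_subset_cocycles[OF X, of 0] 2 by (auto simp: trunc_carrier_def)
  next
    case 3
    then show ?thesis using x by (simp add: trunc_carrier_def cocycles_def)
  next
    case 4
    then show ?thesis
      using x module_hom_zero[OF is_complexD(1)[OF X] is_complexD(1)[OF X] is_complexD(2)[OF X]]
      by (simp add: trunc_carrier_def)
  qed
qed

lemma is_complex_trunc:
  assumes X: "is_complex R X"
  shows "is_complex R (trunc X)"
  unfolding is_complex_def
  using module_trunc_term[OF X] trunc_carrier_diff[OF X] trunc_carrier_subset[OF X]
    module_homsD[OF is_complexD(2)[OF X]] is_complexD(3)[OF X] module_closed[OF module_trunc_term[OF X]]
  by (auto intro!: module_homsI)

lemma chain_map_trunc_carrier:
  assumes X: "is_complex R X" and Y: "is_complex R Y" and f: "f \<in> chain_maps R X Y"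
    and x: "x \<in> trunc_carrier X n"
  shows "f n x \<in> trunc_carrier Y n"
  using x chain_map_cocycles(1)[OF X Y f] module_homsD(1)[OF chain_mapsD(1)[OF f]]
    module_hom_zero[OF is_complexD(1)[OF X] is_complexD(1)[OF Y] chain_mapsD(1)[OF f]]
  by (auto simp: trunc_carrier_def split: if_splits)

lemma trunc_map:
  assumes X: "is_complex R X" and Y: "is_complex R Y" and f: "f \<in> chain_maps R X Y"
  shows "on_hom trunc_functor X Y f \<in> chain_maps R (trunc X) (trunc Y)"
  using chain_map_trunc_carrier[OF X Y f] trunc_carrier_subset[OF X] trunc_carrier_diff[OF X]
    module_homsD[OF chain_mapsD(1)[OF f]] chain_mapsD(2)[OF f] module_closed[OF module_trunc_term[OF X]]
  by (auto simp: chain_maps_def intro!: module_homsI)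

lemma is_functor_trunc: "is_functor (Ch_cat R) (Ch_cat R) trunc_functor"
  unfolding is_functor_def
  by (auto simp: is_complex_trunc trunc_map[simplified trunc_functor_simps] compose_def fun_eq_iff
      dest: chain_map_trunc_carrier trunc_carrier_subset)

lemma trunc_incl:
  assumes X: "is_complex R X"
  shows "trunc_incl X \<in> chain_maps R (trunc X) X"
  using trunc_carrier_subset[OF X] trunc_carrier_diff[OF X] module_closed[OF module_trunc_term[OF X]]
  by (auto simp: chain_maps_def trunc_incl_def intro!: module_homsI)

lemma trunc_incl_natural:
  assumes X: "is_complex R X" and Y: "is_complex R Y" and f: "f \<in> chain_maps R X Y"
  shows "Comp (Ch_cat R) (trunc X) (trunc Y) Y (trunc_incl Y) (on_hom trunc_functor X Y f) =
    Comp (Ch_cat R) (trunc X) X Y f (trunc_incl X)"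
  using chain_map_trunc_carrier[OF X Y f] by (auto simp: trunc_incl_def compose_def fun_eq_iff)

lemma cocycles_trunc: "n \<le> 0 \<Longrightarrow> cocycles (trunc X) n = cocycles X n"
  by (auto simp: cocycles_def trunc_carrier_def)

lemma coboundaries_trunc: "n \<le> 0 \<Longrightarrow> coboundaries (trunc X) n = coboundaries X n"
  by (auto simp: coboundaries_def trunc_carrier_def)

text \<open>
  Equality of modules, not just an isomorphism: up to degree \<open>0\<close> the truncation has the same cocycles
  and coboundaries, and its cosets are formed with the same addition.
\<close>

lemma cohomology_trunc: "n \<le> 0 \<Longrightarrow> cohomology (trunc X) n = cohomology X n"
  unfolding cohomology_def by (simp add: cocycles_trunc coboundaries_trunc)

lemma cohomology_trivial_iff:
  assumes X: "is_complex R X"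
  shows "carrier (cohomology X n) = {\<zero>\<^bsub>cohomology X n\<^esub>} \<longleftrightarrow> cocycles X n \<subseteq> coboundaries X n"
proof
  note C = submodule_cosets[OF is_complexD(1)[OF X] submodule_coboundaries[OF X, of n]]
  show "cocycles X n \<subseteq> coboundaries X n" if "carrier (cohomology X n) = {\<zero>\<^bsub>cohomology X n\<^esub>}"
  proof
    fix x assume x: "x \<in> cocycles X n"
    then have "coboundaries X n +>\<^bsub>term_at X n\<^esub> x \<in> carrier (cohomology X n)"
      by (simp add: cohomology_simps[OF X])
    then show "x \<in> coboundaries X n"
      using that C(8)[OF cocycles_carrier[OF x]] by (simp add: cohomology_simps(2)[OF X])
  qed
  show "carrier (cohomology X n) = {\<zero>\<^bsub>cohomology X n\<^esub>}" if "cocycles X n \<subseteq> coboundaries X n"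
    using that C(2,9) coboundaries_subset_cocycles[OF X, of n]
    by (auto simp: cohomology_simps[OF X] image_iff)
qed

lemma cohomology_trivialI:
  assumes X: "is_complex R X" and "carrier (term_at X n) \<subseteq> {\<zero>\<^bsub>term_at X n\<^esub>}"
  shows "carrier (cohomology X n) = {\<zero>\<^bsub>cohomology X n\<^esub>}"
  unfolding cohomology_trivial_iff[OF X]
  using assms(2) submodule_cosets(2)[OF is_complexD(1)[OF X] submodule_coboundaries[OF X, of n]]
  by (auto simp: cocycles_def)

lemma cohomology_trunc_positive:
  "is_complex R X \<Longrightarrow> n > 0 \<Longrightarrow> carrier (cohomology (trunc X) n) = {\<zero>\<^bsub>cohomology (trunc X) n\<^esub>}"
  by (rule cohomology_trivialI[OF is_complex_trunc]) (auto simp: trunc_carrier_def)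

lemma bij_betw_trivial_hom:
  assumes "module R M" "module R N" "f \<in> module_homs R M N" "carrier M = {\<zero>\<^bsub>M\<^esub>}" "carrier N = {\<zero>\<^bsub>N\<^esub>}"
  shows "bij_betw f (carrier M) (carrier N)"
  using module_hom_zero[OF assms(1-3)] assms(4,5) by (auto simp: bij_betw_def)

lemma quasi_isosI:
  assumes X: "is_complex R X" and Y: "is_complex R Y" and f: "f \<in> chain_maps R X Y"
    and "\<And>n. bij_betw (cohomology_map X Y f n) (carrier (cohomology X n)) (carrier (cohomology Y n)) \<or>
      carrier (cohomology X n) = {\<zero>\<^bsub>cohomology X n\<^esub>} \<and> carrier (cohomology Y n) = {\<zero>\<^bsub>cohomology Y n\<^esub>}"
  shows "f \<in> quasi_isos R X Y"
proof -
  have "bij_betw (cohomology_map X Y f n) (carrier (cohomology X n)) (carrier (cohomology Y n))" for n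
    using assms(4)[of n] bij_betw_trivial_hom[OF module_cohomology[OF X] module_cohomology[OF Y]
        cohomology_map_hom[OF X Y f], of n] by argo
  then show ?thesis using f by (simp add: quasi_isos_def)
qed

lemma cohomology_map_trunc_incl:
  assumes X: "is_complex R X" and n: "n \<le> 0"
  shows "bij_betw (cohomology_map (trunc X) X (trunc_incl X) n)
    (carrier (cohomology (trunc X) n)) (carrier (cohomology X n))"
proof -
  have "cohomology_map (trunc X) X (trunc_incl X) n A = A" if A: "A \<in> carrier (cohomology X n)" for A
  proof -
    obtain x where x: "x \<in> cocycles X n" "A = coboundaries X n +>\<^bsub>term_at X n\<^esub> x"
      using A by (auto simp: cohomology_simps[OF X])
    have "x \<in> trunc_carrier X n" using x n by (auto simp: trunc_carrier_def cocycles_carrier)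
    then show ?thesis
      using cohomology_map_coset[OF is_complex_trunc[OF X] X trunc_incl[OF X], of x n] x n
      by (simp add: cocycles_trunc coboundaries_trunc trunc_incl_def)
  qed
  then have "bij_betw (cohomology_map (trunc X) X (trunc_incl X) n)
      (carrier (cohomology X n)) (carrier (cohomology X n))"
    by (subst bij_betw_cong[of _ _ "\<lambda>x. x"]) (auto simp: bij_betw_def)
  then show ?thesis using n by (simp add: cohomology_trunc)
qed

lemma trunc_incl_quasi_iso:
  assumes X: "is_complex R X" and "\<And>n. n > 0 \<Longrightarrow> carrier (cohomology X n) = {\<zero>\<^bsub>cohomology X n\<^esub>}"
  shows "trunc_incl X \<in> quasi_isos R (trunc X) X"
  using assms(2) cohomology_map_trunc_incl[OF X] cohomology_trunc_positive[OF X]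
  by (intro quasi_isosI[OF is_complex_trunc[OF X] X trunc_incl[OF X]]) (meson not_less)

lemma trunc_preserves_quasi_isos:
  assumes X: "is_complex R X" and Y: "is_complex R Y" and f: "f \<in> quasi_isos R X Y"
  shows "on_hom trunc_functor X Y f \<in> quasi_isos R (trunc X) (trunc Y)"
proof (rule quasi_isosI[OF is_complex_trunc[OF X] is_complex_trunc[OF Y]])
  note fc = quasi_isosD(1)[OF f] and tX = is_complex_trunc[OF X] and tY = is_complex_trunc[OF Y]
  show tf: "on_hom trunc_functor X Y f \<in> chain_maps R (trunc X) (trunc Y)"
    using trunc_map[OF X Y fc] by simp
  fix n :: int
  show "bij_betw (cohomology_map (trunc X) (trunc Y) (on_hom trunc_functor X Y f) n)
        (carrier (cohomology (trunc X) n)) (carrier (cohomology (trunc Y) n)) \<or>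
      carrier (cohomology (trunc X) n) = {\<zero>\<^bsub>cohomology (trunc X) n\<^esub>} \<and>
      carrier (cohomology (trunc Y) n) = {\<zero>\<^bsub>cohomology (trunc Y) n\<^esub>}"
  proof (cases "n \<le> 0")
    case n: True
    have "cohomology_map (trunc X) (trunc Y) (on_hom trunc_functor X Y f) n A = cohomology_map X Y f n A"
      if A: "A \<in> carrier (cohomology X n)" for A
    proof -
      obtain x where x: "x \<in> cocycles X n" "A = coboundaries X n +>\<^bsub>term_at X n\<^esub> x"
        using A by (auto simp: cohomology_simps[OF X])
      have "x \<in> trunc_carrier X n" using x n by (auto simp: trunc_carrier_def cocycles_carrier)
      then show ?thesis
        using cohomology_map_coset[OF tX tY tf, of x n] cohomology_map_coset[OF X Y fc, of x n] x n
        by (simp add: cocycles_trunc coboundaries_trunc)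
    qed
    then have "bij_betw (cohomology_map (trunc X) (trunc Y) (on_hom trunc_functor X Y f) n)
        (carrier (cohomology X n)) (carrier (cohomology Y n))"
      using quasi_isosD(2)[OF f, of n] by (subst bij_betw_cong) auto
    then show ?thesis using n by (simp add: cohomology_trunc)
  next
    case False
    then show ?thesis using cohomology_trunc_positive[OF X] cohomology_trunc_positive[OF Y] by auto
  qed
qed


section \<open>Modules as complexes concentrated in degree zero\<close>

text \<open>
  The complex \<open>M[0]\<close>. Outside degree \<open>0\<close> its terms are the zero submodule of \<open>M\<close>, the one zero module
  that is at hand in every type.
\<close>

definition conc_carrier :: "('r, 'm) module \<Rightarrow> int \<Rightarrow> 'm set" where
  "conc_carrier M n = (if n = 0 then carrier M else {\<zero>\<^bsub>M\<^esub>})"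

definition conc :: "('r, 'm) module \<Rightarrow> ('r, 'm) cochain" where
  "conc M = \<lparr>term_at = (\<lambda>n. M\<lparr>carrier := conc_carrier M n\<rparr>), diff = (\<lambda>n. \<lambda>x\<in>conc_carrier M n. \<zero>\<^bsub>M\<^esub>)\<rparr>"

definition conc_functor ::
  "(('r, 'm) module, 'm \<Rightarrow> 'm, ('r, 'm) cochain, int \<Rightarrow> 'm \<Rightarrow> 'm) functor_data" where
  "conc_functor = \<lparr>on_ob = conc, on_hom = (\<lambda>M N f n. restrict f (conc_carrier M n))\<rparr>"

lemma conc_simps [simp]:
  "term_at (conc M) n = M\<lparr>carrier := conc_carrier M n\<rparr>"
  "diff (conc M) n = (\<lambda>x\<in>conc_carrier M n. \<zero>\<^bsub>M\<^esub>)"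
  by (simp_all add: conc_def)

lemma conc_functor_simps [simp]:
  "on_ob conc_functor M = conc M"
  "on_hom conc_functor M N f = (\<lambda>n. restrict f (conc_carrier M n))"
  by (simp_all add: conc_functor_def)

lemma submodule_conc_carrier: "module R M \<Longrightarrow> submodule (conc_carrier M n) R M"
  using submodule_zero[of R M] module.carrier_is_submodule[of R M] by (simp add: conc_carrier_def)

lemma module_conc_term: "module R M \<Longrightarrow> module R (M\<lparr>carrier := conc_carrier M n\<rparr>)"
  by (rule submodule.submodule_is_module[OF submodule_conc_carrier])

lemma conc_carrier_subset: "module R M \<Longrightarrow> x \<in> conc_carrier M n \<Longrightarrow> x \<in> carrier M"
  using submodule_cosets(1)[OF _ submodule_conc_carrier] by blast

lemma zero_conc_carrier: "module R M \<Longrightarrow> \<zero>\<^bsub>M\<^esub> \<in> conc_carrier M n"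
  by (simp add: conc_carrier_def module_closed)

lemma is_complex_conc:
  assumes M: "module R M"
  shows "is_complex R (conc M)"
  unfolding is_complex_def
  using module_conc_term[OF M] zero_conc_carrier[OF M] module_closed[OF module_conc_term[OF M]]
    module_zero_simps[OF M]
  by (auto intro!: module_homsI)

lemma conc_map:
  assumes M: "module R M" and N: "module R N" and f: "f \<in> module_homs R M N"
  shows "(\<lambda>n. restrict f (conc_carrier M n)) \<in> chain_maps R (conc M) (conc N)"
proof -
  have "f x \<in> conc_carrier N n" if "x \<in> conc_carrier M n" for x n
    using that module_homsD(1)[OF f] module_hom_zero[OF M N f] by (auto simp: conc_carrier_def split: if_splits)
  then show ?thesis
    using module_homsD[OF f] module_hom_zero[OF M N f] conc_carrier_subset[OF M] zero_conc_carrier[OF M]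
      module_closed[OF module_conc_term[OF M]]
    by (auto simp: chain_maps_def intro!: module_homsI)
qed

lemma is_functor_conc:
  fixes R :: "('r, 'x) ring_scheme"
  shows "is_functor (Mod_cat R) (Ch_cat R)
    (conc_functor :: (('r, 'm) module, 'm \<Rightarrow> 'm, _, _) functor_data)"
  unfolding is_functor_def
proof (intro conjI ballI; simp)
  fix L M :: "('r, 'm) module" and f g :: "'m \<Rightarrow> 'm"
  assume L: "module R L"
  show "is_complex R (conc L)" by (rule is_complex_conc[OF L])
  show "(\<lambda>n. \<lambda>x\<in>carrier L \<inter> conc_carrier L n. x) = (\<lambda>n. \<lambda>x\<in>conc_carrier L n. x)"
    using conc_carrier_subset[OF L] by (auto simp: fun_eq_iff)
  assume M: "module R M" and f: "f \<in> module_homs R L M"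
  show "(\<lambda>n. restrict f (conc_carrier L n)) \<in> chain_maps R (conc L) (conc M)"
    by (rule conc_map[OF L M f])
  show "(\<lambda>n. restrict (compose (carrier L) g f) (conc_carrier L n)) =
      (\<lambda>n. compose (conc_carrier L n) (restrict g (conc_carrier M n)) (restrict f (conc_carrier L n)))"
    using module_homsD(1)[OF f] module_hom_zero[OF L M f] conc_carrier_subset[OF L] module_closed(1)[OF L]
    by (auto simp: fun_eq_iff compose_def conc_carrier_def)
qed

lemma cohomology_conc_trivial:
  assumes "module R M" "n \<noteq> 0"
  shows "carrier (cohomology (conc M) n) = {\<zero>\<^bsub>cohomology (conc M) n\<^esub>}"
  by (rule cohomology_trivialI[OF is_complex_conc[OF assms(1)]]) (use assms in \<open>auto simp: conc_carrier_def\<close>)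

lemma cocycles_conc: "cocycles (conc M) 0 = carrier M"
  by (auto simp: cocycles_def conc_carrier_def)

lemma coboundaries_conc: "module R M \<Longrightarrow> coboundaries (conc M) 0 = {\<zero>\<^bsub>M\<^esub>}"
  by (auto simp: coboundaries_def conc_carrier_def)

lemma zero_coset:
  assumes M: "module R M" and x: "x \<in> carrier M"
  shows "{\<zero>\<^bsub>M\<^esub>} +>\<^bsub>M\<^esub> x = {x}"
proof -
  interpret module R M by fact
  show ?thesis using x by (simp add: a_r_coset_def r_coset_def)
qed

lemma cohomology_rep_conc: "module R M \<Longrightarrow> x \<in> carrier M \<Longrightarrow> cohomology_rep (conc M) 0 x = x"
  by (simp add: cohomology_rep_def coboundaries_conc zero_coset some_elem_def)

text \<open>
  The classes in \<open>H\<^sup>0(M[0])\<close> are one-element cosets, whose representatives leave no choice, so that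
  \<open>M\<close> is recovered on the nose up to the multiplicative fields of the record.
\<close>

lemma H_conc:
  assumes M: "module R M"
  shows "carrier (on_ob (H_functor 0) (conc M)) = carrier M"
    and "x \<in> carrier M \<Longrightarrow> y \<in> carrier M \<Longrightarrow> x \<oplus>\<^bsub>on_ob (H_functor 0) (conc M)\<^esub> y = x \<oplus>\<^bsub>M\<^esub> y"
    and "r \<in> carrier R \<Longrightarrow> x \<in> carrier M \<Longrightarrow> r \<odot>\<^bsub>on_ob (H_functor 0) (conc M)\<^esub> x = r \<odot>\<^bsub>M\<^esub> x"
proof -
  note rep = cohomology_rep_conc[OF M]
  show "carrier (on_ob (H_functor 0) (conc M)) = carrier M"
    using H_simps(1)[OF is_complex_conc[OF M], of 0] rep by (auto simp: cocycles_conc)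
  show "x \<oplus>\<^bsub>on_ob (H_functor 0) (conc M)\<^esub> y = x \<oplus>\<^bsub>M\<^esub> y" if "x \<in> carrier M" "y \<in> carrier M"
    using that H_simps(3)[OF is_complex_conc[OF M], of x 0 y] module_closed(2)[OF M] rep
    by (simp add: cocycles_conc)
  show "r \<odot>\<^bsub>on_ob (H_functor 0) (conc M)\<^esub> x = r \<odot>\<^bsub>M\<^esub> x" if "r \<in> carrier R" "x \<in> carrier M"
    using that H_simps(4)[OF is_complex_conc[OF M], of r x 0] module_closed(3)[OF M] rep
    by (simp add: cocycles_conc)
qed

text \<open>
  The canonical map \<open>\<tau>\<^sup>\<le>\<^sup>0 X \<rightarrow> H\<^sup>0(X)[0]\<close>, which exists on the truncation and not on \<open>X\<close> because only
  cocycles have a class.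
\<close>

definition trunc_proj :: "('r, 'm) cochain \<Rightarrow> int \<Rightarrow> 'm \<Rightarrow> 'm" where
  "trunc_proj X n = (\<lambda>x\<in>trunc_carrier X n.
    if n = 0 then cohomology_rep X 0 x else \<zero>\<^bsub>on_ob (H_functor 0) X\<^esub>)"

lemma module_H: "is_complex R X \<Longrightarrow> module R (on_ob (H_functor n) X)"
  using is_functorD(1)[OF is_functor_H[of R n], of X] by simp

lemma trunc_proj:
  assumes X: "is_complex R X"
  shows "trunc_proj X \<in> chain_maps R (trunc X) (conc (on_ob (H_functor 0) X))"
  unfolding chain_maps_def
proof (intro CollectI conjI allI ballI)
  let ?H = "on_ob (H_functor 0) X"
  note H = H_simps[OF X] and mH = module_H[OF X, of 0]
  note cl = module_closed[OF module_trunc_term[OF X]]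
  have c0: "trunc_carrier X 0 = cocycles X 0" by (simp add: trunc_carrier_def)
  note cl0 = module_closed(2,3)[OF module_trunc_term[OF X, of 0], simplified, unfolded c0]
  fix n :: int
  show "trunc_proj X n \<in> module_homs R (term_at (trunc X) n) (term_at (conc ?H) n)"
  proof (cases "n = 0")
    case True
    then show ?thesis
      using cl0 H by (auto intro!: module_homsI simp: trunc_proj_def conc_carrier_def c0)
  next
    case False
    then show ?thesis
      using cl module_zero_simps[OF mH]
      by (auto intro!: module_homsI simp: trunc_proj_def conc_carrier_def)
  qed
  fix x assume "x \<in> carrier (term_at (trunc X) n)"
  then have x: "x \<in> trunc_carrier X n" by simp
  have zero: "trunc_proj X (n + 1) (diff X n x) = \<zero>\<^bsub>?H\<^esub>"
  proof (cases "n = - 1")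
    case True
    then have b: "diff X n x \<in> coboundaries X 0"
      using x by (auto simp: coboundaries_def trunc_carrier_def)
    moreover have "diff X n x \<in> cocycles X 0"
      using b coboundaries_subset_cocycles[OF X] by auto
    moreover have "\<zero>\<^bsub>term_at X 0\<^esub> \<in> cocycles X 0" "\<zero>\<^bsub>term_at X 0\<^esub> \<in> coboundaries X 0"
      using submodule_cosets(2)[OF is_complexD(1)[OF X] submodule_cocycles[OF X, of 0]]
        submodule_cosets(2)[OF is_complexD(1)[OF X] submodule_coboundaries[OF X, of 0]] by auto
    ultimately show ?thesis
      using True H(2) H(5)[of "diff X n x" 0 "\<zero>\<^bsub>term_at X 0\<^esub>"]
        submodule_cosets(9)[OF is_complexD(1)[OF X] submodule_coboundaries[OF X, of 0]]
      by (simp add: trunc_proj_def c0)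
  next
    case False
    then show ?thesis using trunc_carrier_diff[OF X x] by (simp add: trunc_proj_def)
  qed
  have "trunc_proj X n x \<in> conc_carrier ?H n"
    using x H by (auto simp: trunc_proj_def conc_carrier_def c0)
  then show "diff (conc ?H) n (trunc_proj X n x) = trunc_proj X (n + 1) (diff (trunc X) n x)"
    using zero x by simp
qed

lemma trunc_proj_natural:
  assumes X: "is_complex R X" and Y: "is_complex R Y" and f: "f \<in> chain_maps R X Y"
  shows "Comp (Ch_cat R) (trunc X) (trunc Y) (conc (on_ob (H_functor 0) Y)) (trunc_proj Y) (on_hom trunc_functor X Y f) =
    Comp (Ch_cat R) (trunc X) (conc (on_ob (H_functor 0) X)) (conc (on_ob (H_functor 0) Y))
      (on_hom conc_functor (on_ob (H_functor 0) X) (on_ob (H_functor 0) Y) (on_hom (H_functor 0) X Y f)) (trunc_proj X)"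
proof (intro ext)
  fix n x
  let ?h = "on_hom (H_functor 0) X Y f"
  have h: "?h \<in> module_homs R (on_ob (H_functor 0) X) (on_ob (H_functor 0) Y)"
    using is_functorD(2)[OF is_functor_H[of R 0], of X Y f] X Y f by simp
  show "Comp (Ch_cat R) (trunc X) (trunc Y) (conc (on_ob (H_functor 0) Y)) (trunc_proj Y) (on_hom trunc_functor X Y f) n x =
    Comp (Ch_cat R) (trunc X) (conc (on_ob (H_functor 0) X)) (conc (on_ob (H_functor 0) Y))
      (on_hom conc_functor (on_ob (H_functor 0) X) (on_ob (H_functor 0) Y) ?h) (trunc_proj X) n x"
    using chain_map_trunc_carrier[OF X Y f, of x n] H_map_rep[OF X Y f, of x 0] H_simps(1)[OF X, of 0]
      module_hom_zero[OF module_H[OF X] module_H[OF Y] h]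
    by (auto simp: trunc_proj_def compose_def conc_carrier_def trunc_carrier_def)
qed

text \<open>
  Outside degree \<open>0\<close> neither complex has cohomology, and in degree \<open>0\<close> the map is the bijection
  between cosets and their representatives.
\<close>

lemma trunc_proj_quasi_iso:
  assumes X: "is_complex R X" and neg: "\<And>n. n < 0 \<Longrightarrow> carrier (cohomology X n) = {\<zero>\<^bsub>cohomology X n\<^esub>}"
  shows "trunc_proj X \<in> quasi_isos R (trunc X) (conc (on_ob (H_functor 0) X))"
proof (rule quasi_isosI[OF is_complex_trunc[OF X] is_complex_conc[OF module_H[OF X]] trunc_proj[OF X]])
  let ?H = "on_ob (H_functor 0) X" and ?p = "\<lambda>n. cohomology_map (trunc X) (conc (on_ob (H_functor 0) X)) (trunc_proj X) n"
  note mH = module_H[OF X, of 0]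
  note cX = is_complex_trunc[OF X] and cH = is_complex_conc[OF mH]
  fix n :: int
  show "bij_betw (?p n) (carrier (cohomology (trunc X) n)) (carrier (cohomology (conc ?H) n)) \<or>
      carrier (cohomology (trunc X) n) = {\<zero>\<^bsub>cohomology (trunc X) n\<^esub>} \<and>
      carrier (cohomology (conc ?H) n) = {\<zero>\<^bsub>cohomology (conc ?H) n\<^esub>}"
  proof (cases "n = 0")
    case True
    have p: "?p 0 (coboundaries X 0 +>\<^bsub>term_at X 0\<^esub> x) = {cohomology_rep X 0 x}" if "x \<in> cocycles X 0" for x
      using that cohomology_map_coset[OF cX cH trunc_proj[OF X], of x 0] H_simps(1)[OF X, of 0]
      by (simp add: cocycles_trunc coboundaries_trunc coboundaries_conc[OF mH] trunc_proj_def
          trunc_carrier_def zero_coset[OF mH])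
    have "carrier (cohomology (conc ?H) 0) = (\<lambda>x. {x}) ` carrier ?H"
      by (auto simp: cohomology_simps[OF cH] cocycles_conc coboundaries_conc[OF mH] zero_coset[OF mH])
    then have "bij_betw (?p 0) (carrier (cohomology X 0)) (carrier (cohomology (conc ?H) 0))"
      using H_simps(5)[OF X, of _ 0] p
      by (auto simp: bij_betw_def inj_on_def cohomology_simps[OF X] H_simps(1)[OF X] image_image)
    then show ?thesis using True by (simp add: cohomology_trunc)
  next
    case False
    then show ?thesis
      using cohomology_conc_trivial[OF mH] cohomology_trunc_positive[OF X, of n] neg[of n]
      by (cases "n < 0") (auto simp: cohomology_trunc)
  qed
qed


section \<open>Supports\<close>

lemma Spec_complement:
  assumes "p \<in> Spec R"
  shows "\<one>\<^bsub>R\<^esub> \<in> carrier R - p"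
    and "a \<in> carrier R - p \<Longrightarrow> b \<in> carrier R - p \<Longrightarrow> a \<otimes>\<^bsub>R\<^esub> b \<in> carrier R - p"
proof -
  interpret primeideal p R using assms by (simp add: Spec_def)
  show "\<one>\<^bsub>R\<^esub> \<in> carrier R - p" using one_imp_carrier I_notcarr by auto
  show "a \<in> carrier R - p \<Longrightarrow> b \<in> carrier R - p \<Longrightarrow> a \<otimes>\<^bsub>R\<^esub> b \<in> carrier R - p"
    using I_prime by auto
qed

text \<open>
  Zero fractions are recognized in \<open>M\<close> itself, which turns membership in the support into a
  condition on annihilators and spares the construction of the module structure on \<open>M\<^sub>p\<close>.
\<close>

lemma fraction_eq_zero_iff:
  assumes M: "module R M" and p: "p \<in> Spec R" and m: "m \<in> carrier M" and s: "s \<in> carrier R - p"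
  shows "fraction R M p m s = fraction R M p \<zero>\<^bsub>M\<^esub> \<one>\<^bsub>R\<^esub> \<longleftrightarrow>
    (\<exists>u\<in>carrier R - p. u \<odot>\<^bsub>M\<^esub> m = \<zero>\<^bsub>M\<^esub>)"
proof
  interpret module R M by fact
  note one = Spec_complement(1)[OF p] and mult = Spec_complement(2)[OF p]
  {
    assume eq: "fraction R M p m s = fraction R M p \<zero>\<^bsub>M\<^esub> \<one>\<^bsub>R\<^esub>"
    have "(m, s) \<in> fraction R M p m s"
      unfolding fraction_def using m s one by auto
    then have "(m, s) \<in> fraction R M p \<zero>\<^bsub>M\<^esub> \<one>\<^bsub>R\<^esub>" using eq by simp
    then obtain u where "u \<in> carrier R - p" "u \<odot>\<^bsub>M\<^esub> (s \<odot>\<^bsub>M\<^esub> \<zero>\<^bsub>M\<^esub>) = u \<odot>\<^bsub>M\<^esub> (\<one>\<^bsub>R\<^esub> \<odot>\<^bsub>M\<^esub> m)"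
      by (auto simp: fraction_def)
    then show "\<exists>u\<in>carrier R - p. u \<odot>\<^bsub>M\<^esub> m = \<zero>\<^bsub>M\<^esub>"
      using m s by (intro bexI[of _ u]) auto
  }
  assume "\<exists>u\<in>carrier R - p. u \<odot>\<^bsub>M\<^esub> m = \<zero>\<^bsub>M\<^esub>"
  then obtain u where u: "u \<in> carrier R - p" "u \<odot>\<^bsub>M\<^esub> m = \<zero>\<^bsub>M\<^esub>" by blast
  have kill: "(u \<otimes>\<^bsub>R\<^esub> a) \<odot>\<^bsub>M\<^esub> (t \<odot>\<^bsub>M\<^esub> m) = \<zero>\<^bsub>M\<^esub>" if "a \<in> carrier R" "t \<in> carrier R" for a t
  proof -
    have "(u \<otimes>\<^bsub>R\<^esub> a) \<odot>\<^bsub>M\<^esub> (t \<odot>\<^bsub>M\<^esub> m) = ((u \<otimes>\<^bsub>R\<^esub> a) \<otimes>\<^bsub>R\<^esub> t) \<odot>\<^bsub>M\<^esub> m"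
      using that u m by (simp add: smult_assoc1)
    also have "(u \<otimes>\<^bsub>R\<^esub> a) \<otimes>\<^bsub>R\<^esub> t = (a \<otimes>\<^bsub>R\<^esub> t) \<otimes>\<^bsub>R\<^esub> u"
      using that u by (simp add: R.m_ac)
    also have "\<dots> \<odot>\<^bsub>M\<^esub> m = (a \<otimes>\<^bsub>R\<^esub> t) \<odot>\<^bsub>M\<^esub> (u \<odot>\<^bsub>M\<^esub> m)"
      using that u m by (intro smult_assoc1) auto
    finally show ?thesis using that u by simp
  qed
  show "fraction R M p m s = fraction R M p \<zero>\<^bsub>M\<^esub> \<one>\<^bsub>R\<^esub>"
  proof (intro subset_antisym subrelI)
    fix n t assume "(n, t) \<in> fraction R M p m s"
    then obtain v where nt: "n \<in> carrier M" "t \<in> carrier R - p" and v: "v \<in> carrier R - p"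
      "v \<odot>\<^bsub>M\<^esub> (t \<odot>\<^bsub>M\<^esub> m) = v \<odot>\<^bsub>M\<^esub> (s \<odot>\<^bsub>M\<^esub> n)"
      by (auto simp: fraction_def)
    have "(u \<otimes>\<^bsub>R\<^esub> v \<otimes>\<^bsub>R\<^esub> s) \<odot>\<^bsub>M\<^esub> n = u \<odot>\<^bsub>M\<^esub> (v \<odot>\<^bsub>M\<^esub> (s \<odot>\<^bsub>M\<^esub> n))"
      using u v s nt by (simp add: smult_assoc1)
    also have "\<dots> = (u \<otimes>\<^bsub>R\<^esub> v) \<odot>\<^bsub>M\<^esub> (t \<odot>\<^bsub>M\<^esub> m)"
      using u v(1) nt m by (simp add: smult_assoc1 flip: v(2))
    finally have "(u \<otimes>\<^bsub>R\<^esub> v \<otimes>\<^bsub>R\<^esub> s) \<odot>\<^bsub>M\<^esub> n = \<zero>\<^bsub>M\<^esub>" using kill v nt by simp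
    then show "(n, t) \<in> fraction R M p \<zero>\<^bsub>M\<^esub> \<one>\<^bsub>R\<^esub>"
      unfolding fraction_def using nt mult[OF mult[OF u(1) v(1)] s]
      by (auto intro!: bexI[of _ "u \<otimes>\<^bsub>R\<^esub> v \<otimes>\<^bsub>R\<^esub> s"])
  next
    fix n t assume "(n, t) \<in> fraction R M p \<zero>\<^bsub>M\<^esub> \<one>\<^bsub>R\<^esub>"
    then obtain w where nt: "n \<in> carrier M" "t \<in> carrier R - p" and w: "w \<in> carrier R - p"
      "w \<odot>\<^bsub>M\<^esub> (t \<odot>\<^bsub>M\<^esub> \<zero>\<^bsub>M\<^esub>) = w \<odot>\<^bsub>M\<^esub> (\<one>\<^bsub>R\<^esub> \<odot>\<^bsub>M\<^esub> n)"
      by (auto simp: fraction_def)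
    then have wn: "w \<odot>\<^bsub>M\<^esub> n = \<zero>\<^bsub>M\<^esub>" by auto
    have "(u \<otimes>\<^bsub>R\<^esub> w) \<odot>\<^bsub>M\<^esub> (s \<odot>\<^bsub>M\<^esub> n) = (u \<otimes>\<^bsub>R\<^esub> w \<otimes>\<^bsub>R\<^esub> s) \<odot>\<^bsub>M\<^esub> n"
      using u w(1) s nt by (simp add: smult_assoc1)
    also have "u \<otimes>\<^bsub>R\<^esub> w \<otimes>\<^bsub>R\<^esub> s = (u \<otimes>\<^bsub>R\<^esub> s) \<otimes>\<^bsub>R\<^esub> w"
      using u w(1) s by (simp add: R.m_ac)
    also have "\<dots> \<odot>\<^bsub>M\<^esub> n = (u \<otimes>\<^bsub>R\<^esub> s) \<odot>\<^bsub>M\<^esub> (w \<odot>\<^bsub>M\<^esub> n)"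
      using u w(1) s nt by (intro smult_assoc1) auto
    also have "\<dots> = \<zero>\<^bsub>M\<^esub>" using wn u s by simp
    finally show "(n, t) \<in> fraction R M p m s"
      unfolding fraction_def using nt mult[OF u(1) w(1)] kill[of w t] w
      by (auto intro!: bexI[of _ "u \<otimes>\<^bsub>R\<^esub> w"])
  qed
qed

lemma mem_Supp_iff:
  assumes M: "module R M"
  shows "p \<in> Supp R M \<longleftrightarrow>
    p \<in> Spec R \<and> (\<exists>m\<in>carrier M. \<forall>u\<in>carrier R - p. u \<odot>\<^bsub>M\<^esub> m \<noteq> \<zero>\<^bsub>M\<^esub>)"
proof (cases "p \<in> Spec R")
  case p: True
  let ?z = "fraction R M p \<zero>\<^bsub>M\<^esub> \<one>\<^bsub>R\<^esub>"
  note one = Spec_complement(1)[OF p] and iff = fraction_eq_zero_iff[OF M p]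
  have "?z \<in> localized_module R M p"
    unfolding localized_module_def using module_closed(1)[OF M] one by blast
  then have "localized_module R M p = {?z} \<longleftrightarrow> (\<forall>x\<in>localized_module R M p. x = ?z)"
    by blast
  also have "\<dots> \<longleftrightarrow> (\<forall>m\<in>carrier M. \<forall>s\<in>carrier R - p. fraction R M p m s = ?z)"
    unfolding localized_module_def by blast
  also have "\<dots> \<longleftrightarrow> (\<forall>m\<in>carrier M. \<forall>s\<in>carrier R - p. \<exists>u\<in>carrier R - p. u \<odot>\<^bsub>M\<^esub> m = \<zero>\<^bsub>M\<^esub>)"
    by (intro ball_cong HOL.refl iff)
  also have "\<dots> \<longleftrightarrow> (\<forall>m\<in>carrier M. \<exists>u\<in>carrier R - p. u \<odot>\<^bsub>M\<^esub> m = \<zero>\<^bsub>M\<^esub>)"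
    using one by blast
  finally show ?thesis using p by (simp add: Supp_def)
qed (simp add: Supp_def)

text \<open>
  An injection that respects zero and scalars preserves annihilators of elements.
\<close>

lemma Supp_mono:
  assumes M: "module R M" and N: "module R N" and "inj_on f (carrier M)"
    and f: "\<And>x. x \<in> carrier M \<Longrightarrow> f x \<in> carrier N" "f \<zero>\<^bsub>M\<^esub> = \<zero>\<^bsub>N\<^esub>"
      "\<And>r x. r \<in> carrier R \<Longrightarrow> x \<in> carrier M \<Longrightarrow> f (r \<odot>\<^bsub>M\<^esub> x) = r \<odot>\<^bsub>N\<^esub> f x"
  shows "Supp R M \<subseteq> Supp R N"
proof
  fix p assume "p \<in> Supp R M"
  then obtain m where p: "p \<in> Spec R" and m: "m \<in> carrier M" "\<forall>u\<in>carrier R - p. u \<odot>\<^bsub>M\<^esub> m \<noteq> \<zero>\<^bsub>M\<^esub>"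
    using mem_Supp_iff[OF M] by blast
  have "u \<odot>\<^bsub>N\<^esub> f m \<noteq> \<zero>\<^bsub>N\<^esub>" if u: "u \<in> carrier R - p" for u
  proof
    assume "u \<odot>\<^bsub>N\<^esub> f m = \<zero>\<^bsub>N\<^esub>"
    then have "f (u \<odot>\<^bsub>M\<^esub> m) = f \<zero>\<^bsub>M\<^esub>" using f u m(1) by simp
    then have "u \<odot>\<^bsub>M\<^esub> m = \<zero>\<^bsub>M\<^esub>"
      using inj_onD[OF assms(3)] module_closed[OF M] u m(1) by blast
    then show False using m u by blast
  qed
  then show "p \<in> Supp R N" using mem_Supp_iff[OF N] p f(1)[OF m(1)] by blast
qed

lemma (in ring) ideal_Union_chain:
  assumes C: "C \<noteq> {}" "subset.chain {J. ideal J R} C"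
  shows "ideal (\<Union>C) R"
proof (rule idealI[OF ring_axioms])
  have id: "ideal J R" if "J \<in> C" for J using that C(2) by (auto simp: subset_chain_def)
  show "subgroup (\<Union>C) (add_monoid R)"
  proof (rule add.subgroupI)
    show "\<Union>C \<subseteq> carrier R"
    proof
      fix a assume "a \<in> \<Union>C"
      then obtain J where "J \<in> C" "a \<in> J" by blast
      then show "a \<in> carrier R" using ideal.Icarr[OF id] by simp
    qed
    show "\<Union>C \<noteq> {}"
    proof -
      obtain J where J: "J \<in> C" using C(1) by blast
      then have "\<zero> \<in> J" by (rule additive_subgroup.zero_closed[OF ideal.axioms(1)[OF id]])
      then show ?thesis using J by blast
    qed
    show "\<ominus> a \<in> \<Union>C" if a: "a \<in> \<Union>C" for a
    proof -
      obtain J where J: "J \<in> C" "a \<in> J" using a by blast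
      then have "\<ominus> a \<in> J" by (intro additive_subgroup.a_inv_closed[OF ideal.axioms(1)[OF id]])
      then show ?thesis using J by blast
    qed
    fix a b assume "a \<in> \<Union>C" "b \<in> \<Union>C"
    then obtain J K where JK: "a \<in> J" "J \<in> C" "b \<in> K" "K \<in> C" by blast
    have add: "a \<oplus> b \<in> L" if "L \<in> C" "a \<in> L" "b \<in> L" for L
      using that by (intro additive_subgroup.a_closed[OF ideal.axioms(1)[OF id]])
    have "J \<subseteq> K \<or> K \<subseteq> J" using C(2) JK by (auto simp: subset_chain_def)
    then show "a \<oplus> b \<in> \<Union>C"
      using add[OF JK(2)] add[OF JK(4)] JK by blast
  qed
  fix a x assume "a \<in> \<Union>C" and x: "x \<in> carrier R"
  then obtain J where J: "J \<in> C" "a \<in> J" by blast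
  then show "x \<otimes> a \<in> \<Union>C" "a \<otimes> x \<in> \<Union>C"
    using ideal.I_l_closed[OF id J(2) x] ideal.I_r_closed[OF id J(2) x] by auto
qed

text \<open>
  By Zorn's lemma: an ideal that is maximal among those avoiding \<open>1\<close> is a maximal ideal, hence prime.
\<close>

lemma (in cring) ex_prime_above:
  assumes I: "ideal I R" and one: "\<one> \<notin> I"
  shows "\<exists>p\<in>Spec R. I \<subseteq> p"
proof -
  let ?A = "{J. ideal J R \<and> I \<subseteq> J \<and> \<one> \<notin> J}"
  have "\<exists>J\<in>?A. \<forall>K\<in>?A. J \<subseteq> K \<longrightarrow> K = J"
  proof (rule subset_Zorn_nonempty)
    fix C assume C: "C \<noteq> {}" "subset.chain ?A C"
    then have "subset.chain {J. ideal J R} C" by (auto simp: subset_chain_def)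
    from ideal_Union_chain[OF C(1) this] have "ideal (\<Union>C) R" .
    then show "\<Union>C \<in> ?A" using C by (auto simp: subset_chain_def)
  qed (use I one in auto)
  then obtain J where JA: "J \<in> ?A" and max: "\<forall>K\<in>?A. J \<subseteq> K \<longrightarrow> K = J" ..
  then have J: "ideal J R" "I \<subseteq> J" "\<one> \<notin> J" by auto
  have "maximalideal J R"
  proof (rule maximalidealI[OF J(1)])
    show "carrier R \<noteq> J" using J(3) by auto
    fix K assume K: "ideal K R" "J \<subseteq> K" "K \<subseteq> carrier R"
    show "K = J \<or> K = carrier R"
    proof (cases "\<one> \<in> K")
      case True
      then show ?thesis using ideal.one_imp_carrier[OF K(1)] by simp
    next
      case False
      then have "K \<in> ?A" using K J(2) by auto
      then show ?thesis using max K(2) by simp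
    qed
  qed
  from maximalideal_prime[OF this] show ?thesis using J(2) by (auto simp: Spec_def)
qed

text \<open>A nonzero element has a proper annihilator, hence survives at some prime ideal.\<close>

lemma Supp_empty_imp_zero:
  assumes M: "module R M" and "Supp R M = {}"
  shows "carrier M = {\<zero>\<^bsub>M\<^esub>}"
proof -
  interpret module R M by fact
  have False if m: "m \<in> carrier M" "m \<noteq> \<zero>\<^bsub>M\<^esub>" for m
  proof -
    let ?I = "{r \<in> carrier R. r \<odot>\<^bsub>M\<^esub> m = \<zero>\<^bsub>M\<^esub>}"
    have "ideal ?I R"
    proof (rule idealI[OF R.ring_axioms])
      show "subgroup ?I (add_monoid R)"
        using m by (intro R.add.subgroupI)
          (auto simp: smult_l_distr smult_l_minus a_inv_def[symmetric] intro: exI[of _ "\<zero>\<^bsub>R\<^esub>"])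
    next
      fix a x assume ax: "a \<in> ?I" "x \<in> carrier R"
      then have "(x \<otimes>\<^bsub>R\<^esub> a) \<odot>\<^bsub>M\<^esub> m = \<zero>\<^bsub>M\<^esub>" using m by (simp add: smult_assoc1)
      with ax show "x \<otimes>\<^bsub>R\<^esub> a \<in> ?I" "a \<otimes>\<^bsub>R\<^esub> x \<in> ?I" by (auto simp: R.m_comm)
    qed
    moreover have "\<one>\<^bsub>R\<^esub> \<notin> ?I" using m by simp
    ultimately obtain p where "p \<in> Spec R" "?I \<subseteq> p" using R.ex_prime_above by blast
    then have "p \<in> Supp R M" using m by (auto simp: mem_Supp_iff[OF M])
    then show False using assms by simp
  qed
  then show ?thesis by auto
qed

lemma Supp_trivial:
  assumes M: "module R M" and "carrier M = {\<zero>\<^bsub>M\<^esub>}"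
  shows "Supp R M = {}"
proof -
  have "p \<notin> Supp R M" for p
    using mem_Supp_iff[OF M, of p] assms(2) module_zero_simps(6)[OF M] Spec_complement(1)[of p R] by fastforce
  then show ?thesis by blast
qed

lemma torsion_class_empty_iff:
  assumes "module R M"
  shows "M \<in> torsion_class R {} \<longleftrightarrow> carrier M = {\<zero>\<^bsub>M\<^esub>}"
  using assms Supp_empty_imp_zero[OF assms] Supp_trivial[OF assms] by (auto simp: torsion_class_def)

lemma torsion_class_trivial:
  "module R M \<Longrightarrow> carrier M = {\<zero>\<^bsub>M\<^esub>} \<Longrightarrow> M \<in> torsion_class R Z"
  using Supp_trivial[of R M] by (simp add: torsion_class_def)


section \<open>Truncation and cohomology on the derived category\<close>

lemma derived_cat_simps [simp]:
  "X \<in> Ob (derived_cat R) \<longleftrightarrow> is_complex R X"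
  by (simp add: derived_cat_def localization_def)

lemma category_derived_cat: "category (derived_cat R)"
  unfolding derived_cat_def by (rule category.category_localization[OF category_Ch_cat])

definition derived_map where
  "derived_map R = localization_map (Ch_cat R) (quasi_isos R)"

lemma derived_map:
  assumes X: "is_complex R X" and Y: "is_complex R Y"
  shows "f \<in> chain_maps R X Y \<Longrightarrow> derived_map R X Y f \<in> Hom (derived_cat R) X Y"
    and "is_complex R Z \<Longrightarrow> f \<in> chain_maps R X Y \<Longrightarrow> g \<in> chain_maps R Y Z \<Longrightarrow>
      derived_map R X Z (Comp (Ch_cat R) X Y Z g f) =
      Comp (derived_cat R) X Y Z (derived_map R Y Z g) (derived_map R X Y f)"
    and "f \<in> quasi_isos R X Y \<Longrightarrow> is_iso (derived_cat R) X Y (derived_map R X Y f)"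
proof -
  interpret category "Ch_cat R" by (rule category_Ch_cat)
  show "f \<in> chain_maps R X Y \<Longrightarrow> derived_map R X Y f \<in> Hom (derived_cat R) X Y"
    unfolding derived_map_def derived_cat_def using X Y by (intro localization_map_in_Hom) simp_all
  show "is_complex R Z \<Longrightarrow> f \<in> chain_maps R X Y \<Longrightarrow> g \<in> chain_maps R Y Z \<Longrightarrow>
      derived_map R X Z (Comp (Ch_cat R) X Y Z g f) =
      Comp (derived_cat R) X Y Z (derived_map R Y Z g) (derived_map R X Y f)"
    unfolding derived_map_def derived_cat_def using X Y
    by (intro localization_map_comp) simp_all
  show "f \<in> quasi_isos R X Y \<Longrightarrow> is_iso (derived_cat R) X Y (derived_map R X Y f)"
    unfolding derived_map_def derived_cat_def using X Y
    by (intro localization_map_iso) (simp_all add: quasi_isosD)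
qed

definition derived_quotient where
  "derived_quotient R = localization_functor (Ch_cat R) (quasi_isos R)"

lemma is_functor_derived_quotient: "is_functor (Ch_cat R) (derived_cat R) (derived_quotient R)"
  unfolding derived_cat_def derived_quotient_def
  by (rule category.is_functor_localization[OF category_Ch_cat])

lemma derived_quotient_simps [simp]:
  "on_ob (derived_quotient R) X = X"
  "on_hom (derived_quotient R) X Y f = derived_map R X Y f"
  by (simp_all add: derived_quotient_def derived_map_def)

definition derived_trunc where
  "derived_trunc R = lift_functor (derived_cat R) (comp_functor (derived_quotient R) trunc_functor)"

definition derived_H where
  "derived_H R = lift_functor (Mod_cat R) (H_functor 0)"

definition derived_conc where
  "derived_conc R = comp_functor (derived_quotient R) conc_functor"

lemma inverting_trunc:
  fixes R :: "('r, 'x) ring_scheme"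
  shows "inverting_functor (Ch_cat R) (derived_cat R) (quasi_isos R)
    (comp_functor (derived_quotient R) (trunc_functor :: (('r, 'm) cochain, _, _, _) functor_data))"
proof (intro inverting_functor.intro inverting_functor_axioms.intro category_Ch_cat category_derived_cat
    is_functor_comp[OF is_functor_trunc is_functor_derived_quotient])
  fix X Y :: "('r, 'm) cochain" and s
  assume XY: "X \<in> Ob (Ch_cat R)" "Y \<in> Ob (Ch_cat R)" and s: "s \<in> quasi_isos R X Y"
  then show "is_iso (derived_cat R) (on_ob (comp_functor (derived_quotient R) trunc_functor) X)
      (on_ob (comp_functor (derived_quotient R) trunc_functor) Y)
      (on_hom (comp_functor (derived_quotient R) trunc_functor) X Y s)"
    using derived_map(3)[OF is_complex_trunc is_complex_trunc trunc_preserves_quasi_isos, of R X Y s] by simp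
qed

lemma derived_trunc:
  shows "is_functor (derived_cat R) (derived_cat R) (derived_trunc R)"
    and "on_ob (derived_trunc R) X = trunc X"
    and "is_complex R X \<Longrightarrow> is_complex R Y \<Longrightarrow> f \<in> chain_maps R X Y \<Longrightarrow>
      on_hom (derived_trunc R) X Y (derived_map R X Y f) =
      derived_map R (trunc X) (trunc Y) (on_hom trunc_functor X Y f)"
proof -
  note inv = inverting_trunc[of R]
  show "is_functor (derived_cat R) (derived_cat R) (derived_trunc R)"
    using inverting_functor.is_functor_lift[OF inv] by (simp add: derived_trunc_def derived_cat_def)
  show "on_ob (derived_trunc R) X = trunc X"
    using inverting_functor.lift_functor_on_ob[OF inv] by (simp add: derived_trunc_def)
  show "is_complex R X \<Longrightarrow> is_complex R Y \<Longrightarrow> f \<in> chain_maps R X Y \<Longrightarrow>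
      on_hom (derived_trunc R) X Y (derived_map R X Y f) =
      derived_map R (trunc X) (trunc Y) (on_hom trunc_functor X Y f)"
    using inverting_functor.lift_functor_localization_map[OF inv, of X Y f]
    by (simp add: derived_trunc_def derived_map_def)
qed

lemma derived_H:
  shows "is_functor (derived_cat R) (Mod_cat R) (derived_H R)"
    and "on_ob (derived_H R) X = on_ob (H_functor 0) X"
    and "is_complex R X \<Longrightarrow> is_complex R Y \<Longrightarrow> f \<in> chain_maps R X Y \<Longrightarrow>
      on_hom (derived_H R) X Y (derived_map R X Y f) = on_hom (H_functor 0) X Y f"
proof -
  note inv = inverting_H[of R 0]
  show "is_functor (derived_cat R) (Mod_cat R) (derived_H R)"
    using inverting_functor.is_functor_lift[OF inv] by (simp add: derived_H_def derived_cat_def)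
  show "on_ob (derived_H R) X = on_ob (H_functor 0) X"
    using inverting_functor.lift_functor_on_ob[OF inv] by (simp add: derived_H_def)
  show "is_complex R X \<Longrightarrow> is_complex R Y \<Longrightarrow> f \<in> chain_maps R X Y \<Longrightarrow>
      on_hom (derived_H R) X Y (derived_map R X Y f) = on_hom (H_functor 0) X Y f"
    using inverting_functor.lift_functor_localization_map[OF inv, of X Y f]
    by (simp add: derived_H_def derived_map_def)
qed

lemma derived_conc:
  shows "is_functor (Mod_cat R) (derived_cat R) (derived_conc R)"
    and "on_ob (derived_conc R) M = conc M"
    and "on_hom (derived_conc R) M N f = derived_map R (conc M) (conc N) (on_hom conc_functor M N f)"
  using is_functor_comp[OF is_functor_conc is_functor_derived_quotient, of R]
  by (simp_all add: derived_conc_def)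

lemma natural_on_derived_cat:
  assumes "category D" "is_functor (derived_cat R) D K" "is_functor (derived_cat R) D L"
    and "\<And>X. is_complex R X \<Longrightarrow> \<nu> X \<in> Hom D (on_ob K X) (on_ob L X)"
    and "\<And>X Y f. is_complex R X \<Longrightarrow> is_complex R Y \<Longrightarrow> f \<in> chain_maps R X Y \<Longrightarrow>
      Comp D (on_ob K X) (on_ob K Y) (on_ob L Y) (\<nu> Y) (on_hom K X Y (derived_map R X Y f)) =
      Comp D (on_ob K X) (on_ob L X) (on_ob L Y) (on_hom L X Y (derived_map R X Y f)) (\<nu> X)"
    and "c \<in> Hom (derived_cat R) X Y"
  shows "Comp D (on_ob K X) (on_ob K Y) (on_ob L Y) (\<nu> Y) (on_hom K X Y c) =
    Comp D (on_ob K X) (on_ob L X) (on_ob L Y) (on_hom L X Y c) (\<nu> X)"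
proof -
  interpret category "Ch_cat R" by (rule category_Ch_cat)
  show ?thesis
    using assms unfolding derived_cat_def derived_map_def
    by - (rule natural_on_localization[where W = "quasi_isos R" and \<nu> = \<nu>], simp_all)
qed

text \<open>
  For chain maps this is the naturality of the inclusion of a subcomplex; it extends to zigzags.
\<close>

lemma derived_incl_natural:
  fixes R :: "('r, 'x) ring_scheme" and X Y :: "('r, 'm) cochain"
  assumes c: "c \<in> Hom (derived_cat R) X Y"
  shows "Comp (derived_cat R) (trunc X) (trunc Y) Y (derived_map R (trunc Y) Y (trunc_incl Y))
      (on_hom (derived_trunc R) X Y c) =
    Comp (derived_cat R) (trunc X) X Y c (derived_map R (trunc X) X (trunc_incl X))"
proof -
  let ?I = "id_functor :: (('r, 'm) cochain, ('r, 'm) derived_hom, _, _) functor_data"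
  have "Comp (derived_cat R) (on_ob (derived_trunc R) X) (on_ob (derived_trunc R) Y) (on_ob ?I Y)
      (derived_map R (trunc Y) Y (trunc_incl Y)) (on_hom (derived_trunc R) X Y c) =
    Comp (derived_cat R) (on_ob (derived_trunc R) X) (on_ob ?I X) (on_ob ?I Y)
      (on_hom ?I X Y c) (derived_map R (trunc X) X (trunc_incl X))"
    by (rule natural_on_derived_cat[where \<nu> = "\<lambda>X :: ('r, 'm) cochain. derived_map R (trunc X) X (trunc_incl X)",
          OF category_derived_cat derived_trunc(1) is_functor_id _ _ c])
      (simp_all add: derived_trunc(2,3) derived_map(1) is_complex_trunc trunc_incl trunc_incl_natural
        derived_map(2)[symmetric] trunc_map del: Ch_cat_simps trunc_functor_simps)
  then show ?thesis by (simp add: derived_trunc(2))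
qed

lemma derived_proj_natural:
  fixes R :: "('r, 'x) ring_scheme" and X Y :: "('r, 'm) cochain"
  assumes c: "c \<in> Hom (derived_cat R) X Y"
  shows "Comp (derived_cat R) (trunc X) (trunc Y) (conc (on_ob (H_functor 0) Y))
      (derived_map R (trunc Y) (conc (on_ob (H_functor 0) Y)) (trunc_proj Y)) (on_hom (derived_trunc R) X Y c) =
    Comp (derived_cat R) (trunc X) (conc (on_ob (H_functor 0) X)) (conc (on_ob (H_functor 0) Y))
      (on_hom (derived_conc R) (on_ob (H_functor 0) X) (on_ob (H_functor 0) Y) (on_hom (derived_H R) X Y c))
      (derived_map R (trunc X) (conc (on_ob (H_functor 0) X)) (trunc_proj X))"
proof -
  let ?GH = "comp_functor (derived_conc R) (derived_H R)"
  have "Comp (derived_cat R) (on_ob (derived_trunc R) X) (on_ob (derived_trunc R) Y) (on_ob ?GH Y)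
      (derived_map R (trunc Y) (conc (on_ob (H_functor 0) Y)) (trunc_proj Y)) (on_hom (derived_trunc R) X Y c) =
    Comp (derived_cat R) (on_ob (derived_trunc R) X) (on_ob ?GH X) (on_ob ?GH Y)
      (on_hom ?GH X Y c) (derived_map R (trunc X) (conc (on_ob (H_functor 0) X)) (trunc_proj X))"
  proof (rule natural_on_derived_cat[where \<nu> = "\<lambda>X. derived_map R (trunc X) (conc (on_ob (H_functor 0) X)) (trunc_proj X)",
        OF category_derived_cat derived_trunc(1)
        is_functor_comp[OF derived_H(1) derived_conc(1)] _ _ c])
    fix X :: "('r, 'm) cochain" assume X: "is_complex R X"
    show "derived_map R (trunc X) (conc (on_ob (H_functor 0) X)) (trunc_proj X)
        \<in> Hom (derived_cat R) (on_ob (derived_trunc R) X) (on_ob ?GH X)"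
      using X by (simp add: derived_trunc(2) derived_H(2) derived_conc(2) derived_map(1) is_complex_trunc
          is_complex_conc module_H trunc_proj)
    fix Y f assume Y: "is_complex R Y" and f: "f \<in> chain_maps R X Y"
    have h: "on_hom (H_functor 0) X Y f \<in> module_homs R (on_ob (H_functor 0) X) (on_ob (H_functor 0) Y)"
      using is_functorD(2)[OF is_functor_H[of R 0], of X Y f] X Y f by simp
    note cX = is_complex_conc[OF module_H[OF X, of 0]] and cY = is_complex_conc[OF module_H[OF Y, of 0]]
    note tX = is_complex_trunc[OF X] and tY = is_complex_trunc[OF Y]
    have t: "on_hom trunc_functor X Y f \<in> chain_maps R (trunc X) (trunc Y)"
      using trunc_map[OF X Y f] by simp
    have g: "on_hom conc_functor (on_ob (H_functor 0) X) (on_ob (H_functor 0) Y) (on_hom (H_functor 0) X Y f)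
        \<in> chain_maps R (conc (on_ob (H_functor 0) X)) (conc (on_ob (H_functor 0) Y))"
      using conc_map[OF module_H[OF X] module_H[OF Y] h] by simp
    show "Comp (derived_cat R) (on_ob (derived_trunc R) X) (on_ob (derived_trunc R) Y) (on_ob ?GH Y)
        (derived_map R (trunc Y) (conc (on_ob (H_functor 0) Y)) (trunc_proj Y))
        (on_hom (derived_trunc R) X Y (derived_map R X Y f)) =
      Comp (derived_cat R) (on_ob (derived_trunc R) X) (on_ob ?GH X) (on_ob ?GH Y)
        (on_hom ?GH X Y (derived_map R X Y f)) (derived_map R (trunc X) (conc (on_ob (H_functor 0) X)) (trunc_proj X))"
      using trunc_proj_natural[OF X Y f] derived_map(2)[OF tX tY cY t trunc_proj[OF Y]]
        derived_map(2)[OF tX cX cY trunc_proj[OF X] g]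
      by (simp add: derived_trunc(2,3) derived_H(2,3) derived_conc(2,3) X Y f
          del: Ch_cat_simps trunc_functor_simps conc_functor_simps)
  qed
  then show ?thesis by (simp add: derived_trunc(2) derived_H(2) derived_conc(2))
qed


section \<open>The heart\<close>

lemma zero_chain_map:
  assumes X: "is_complex R X" and Y: "is_complex R Y"
  shows "zero_chain_map X Y \<in> chain_maps R X Y"
  using module_homs_zero[OF is_complexD(1)[OF X] is_complexD(1)[OF Y]]
    module_homsD(1)[OF is_complexD(2)[OF X]]
    module_hom_zero[OF is_complexD(1)[OF Y] is_complexD(1)[OF Y] is_complexD(2)[OF Y]]
  by (simp add: chain_maps_def zero_chain_map_def)

lemma zero_chain_map_absorbs:
  assumes f: "f \<in> chain_maps R X X'"
  shows "Comp (Ch_cat R) X X' Y (zero_chain_map X' Y) f = zero_chain_map X Y"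
  using module_homsD(1)[OF chain_mapsD(1)[OF f]]
  by (auto simp: zero_chain_map_def compose_def fun_eq_iff)

text \<open>
  Zero maps are the stable family to which \<open>localization_map_absorbs\<close> applies.
\<close>

lemma derived_zero_absorbs:
  assumes Y: "is_complex R Y" and c: "c \<in> Hom (derived_cat R) X X'"
  shows "Comp (derived_cat R) X X' Y (derived_zero R X' Y) c = derived_zero R X Y"
  using c unfolding derived_cat_def derived_zero_def
  by (intro category.localization_map_absorbs[OF category_Ch_cat, where z = "\<lambda>X. zero_chain_map X Y"])
    (use Y in \<open>auto simp: zero_chain_map zero_chain_map_absorbs simp del: Ch_cat_simps(4)\<close>)

lemma derived_zero_in_Hom:
  "is_complex R X \<Longrightarrow> is_complex R Y \<Longrightarrow> derived_zero R X Y \<in> Hom (derived_cat R) X Y"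
  using derived_map(1)[OF _ _ zero_chain_map, of R X Y] by (simp add: derived_zero_def derived_map_def)

text \<open>
  Cohomology factors through \<open>D(R)\<close>, so it only sees the image of a chain map there.
\<close>

lemma derived_map_eq_imp_cohomology_map_eq:
  assumes X: "is_complex R X" and Y: "is_complex R Y" and f: "f \<in> chain_maps R X Y" and g: "g \<in> chain_maps R X Y"
    and eq: "derived_map R X Y f = derived_map R X Y g"
  shows "cohomology_map X Y f n = cohomology_map X Y g n"
proof -
  have "on_hom (lift_functor (Mod_cat R) (cohomology_functor n)) X Y (derived_map R X Y h) = cohomology_map X Y h n"
    if "h \<in> chain_maps R X Y" for h
    using inverting_functor.lift_functor_localization_map[OF inverting_cohomology[of R n], of X Y h] X Y that
    by (simp add: derived_map_def)
  from this[OF f] this[OF g] show ?thesis by (simp add: eq)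
qed

text \<open>
  The sign in the differential of the shift changes neither the kernel nor the image.
\<close>

lemma cohomology_shift: "cohomology (shift 1 Y) (n - 1) = cohomology Y n"
  if Y: "is_complex R Y"
proof -
  note M = is_complexD(1)[OF Y]
  have t: "term_at (shift 1 Y) (n - 1) = term_at Y n" by (simp add: shift_def)
  have "cocycles (shift 1 Y) (n - 1) = cocycles Y n"
  proof -
    have "\<ominus>\<^bsub>term_at Y (n + 1)\<^esub> y = \<zero>\<^bsub>term_at Y (n + 1)\<^esub> \<longleftrightarrow> y = \<zero>\<^bsub>term_at Y (n + 1)\<^esub>"
      if "y \<in> carrier (term_at Y (n + 1))" for y
      using module_zero_simps(3,8)[OF M] that by metis
    then show ?thesis
      using module_homsD(1)[OF is_complexD(2)[OF Y]]
      by (auto simp: cocycles_def shift_def add.commute[of 1 n])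
  qed
  moreover have "coboundaries (shift 1 Y) (n - 1) = coboundaries Y n"
  proof -
    have d: "diff Y (n - 1) \<in> module_homs R (term_at Y (n - 1)) (term_at Y n)"
      using is_complexD(2)[OF Y, of "n - 1"] by simp
    have neg: "\<ominus>\<^bsub>term_at Y n\<^esub> diff Y (n - 1) x = diff Y (n - 1) (\<ominus>\<^bsub>term_at Y (n - 1)\<^esub> x)"
      if "x \<in> carrier (term_at Y (n - 1))" for x
      using that module_zero_simps(7)[OF M] module_homsD(1,4)[OF d] module_ring_closed(3)[OF M] by simp
    have "coboundaries (shift 1 Y) (n - 1) =
        (\<lambda>x. diff Y (n - 1) (\<ominus>\<^bsub>term_at Y (n - 1)\<^esub> x)) ` carrier (term_at Y (n - 1))"
      by (auto simp: coboundaries_def shift_def neg)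
    also have "\<dots> = diff Y (n - 1) ` (\<lambda>x. \<ominus>\<^bsub>term_at Y (n - 1)\<^esub> x) ` carrier (term_at Y (n - 1))"
      by (simp add: image_image)
    also have "(\<lambda>x. \<ominus>\<^bsub>term_at Y (n - 1)\<^esub> x) ` carrier (term_at Y (n - 1)) = carrier (term_at Y (n - 1))"
      using module_closed(4)[OF M] module_zero_simps(8)[OF M] by (force simp: image_iff)
    finally show ?thesis by (simp add: coboundaries_def)
  qed
  ultimately show ?thesis by (simp add: cohomology_def t)
qed

text \<open>
  A complex in the right orthogonal of the aisle has no cohomology in degrees \<open>\<le> 0\<close> as soon as this
  cohomology is torsion: its truncation then lies in the aisle, so the inclusion of the truncation,
  which is bijective on cohomology in these degrees, vanishes in the derived category.
\<close>

lemma right_perp_cohomology: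
  assumes Y: "Y \<in> right_perp R (ajs_aisle R \<Phi>)"
    and tors: "\<And>n. n \<le> 0 \<Longrightarrow> cohomology Y n \<in> torsion_class R (\<Phi> n)" and n: "n \<le> 0"
  shows "carrier (cohomology Y n) = {\<zero>\<^bsub>cohomology Y n\<^esub>}"
proof -
  have cY: "is_complex R Y" using Y by (simp add: right_perp_def)
  note tY = is_complex_trunc[OF cY]
  have "cohomology (trunc Y) m \<in> torsion_class R (\<Phi> m)" for m
  proof (cases "m \<le> 0")
    case True
    then show ?thesis using tors by (simp add: cohomology_trunc)
  next
    case False
    then show ?thesis
      using torsion_class_trivial[OF module_cohomology[OF tY] cohomology_trunc_positive[OF cY]] by simp
  qed
  then have "trunc Y \<in> ajs_aisle R \<Phi>" using tY by (simp add: ajs_aisle_def)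
  then have "Hom (derived_cat R) (trunc Y) Y = {derived_zero R (trunc Y) Y}"
    using Y by (simp add: right_perp_def)
  then have "derived_map R (trunc Y) Y (trunc_incl Y) = derived_map R (trunc Y) Y (zero_chain_map (trunc Y) Y)"
    using derived_map(1)[OF tY cY trunc_incl[OF cY]] by (simp add: derived_zero_def derived_map_def)
  then have eq: "cohomology_map (trunc Y) Y (trunc_incl Y) n = cohomology_map (trunc Y) Y (zero_chain_map (trunc Y) Y) n"
    by (rule derived_map_eq_imp_cohomology_map_eq[OF tY cY trunc_incl[OF cY] zero_chain_map[OF tY cY]])
  have "A = \<zero>\<^bsub>cohomology Y n\<^esub>" if A: "A \<in> carrier (cohomology Y n)" for A
  proof -
    obtain B where B: "B \<in> carrier (cohomology (trunc Y) n)"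
      "A = cohomology_map (trunc Y) Y (trunc_incl Y) n B"
      using cohomology_map_trunc_incl[OF cY n] A unfolding bij_betw_def by blast
    then obtain x where x: "x \<in> cocycles (trunc Y) n"
      "B = coboundaries (trunc Y) n +>\<^bsub>term_at (trunc Y) n\<^esub> x"
      unfolding cohomology_simps(1)[OF tY] by blast
    show ?thesis
      using B(2) cohomology_map_coset[OF tY cY zero_chain_map[OF tY cY] x(1)] x(2) cocycles_carrier[OF x(1)]
        submodule_cosets(3)[OF is_complexD(1)[OF cY] submodule_coboundaries[OF cY, of n]]
      by (simp add: eq zero_chain_map_def cohomology_simps(2)[OF cY])
  qed
  then show ?thesis using module_closed(1)[OF module_cohomology[OF cY, of n]] by blast
qed

text \<open>
  The shift moves the vanishing range \<open>n \<le> 0\<close> of the orthogonal to \<open>n < 0\<close>. In positive degrees the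
  cohomology has empty support, hence is zero.
\<close>

lemma heart_cohomology:
  assumes \<Phi>: "\<Phi> = (\<lambda>n. if n \<le> 0 then Z else {})"
    and X: "X \<in> Ob (ajs_heart R \<Phi>)"
  shows "is_complex R X" and "n \<noteq> 0 \<Longrightarrow> carrier (cohomology X n) = {\<zero>\<^bsub>cohomology X n\<^esub>}"
    and "cohomology X 0 \<in> torsion_class R Z"
proof -
  show cX: "is_complex R X" using X by (simp add: ajs_heart_def)
  have tors: "cohomology X n \<in> torsion_class R (\<Phi> n)" for n
    using X by (simp add: ajs_heart_def ajs_aisle_def)
  show "cohomology X 0 \<in> torsion_class R Z" using tors[of 0] by (simp add: \<Phi>)
  obtain Y where Y: "Y \<in> right_perp R (ajs_aisle R \<Phi>)" "X = shift 1 Y"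
    using X by (auto simp: ajs_heart_def)
  have cY: "is_complex R Y" using Y by (simp add: right_perp_def)
  have coh: "cohomology Y n = cohomology X (n - 1)" for n
    using cohomology_shift[OF cY] Y(2) by simp
  have "cohomology Y n \<in> torsion_class R (\<Phi> n)" if "n \<le> 0" for n
    using tors[of "n - 1"] that by (simp add: coh \<Phi>)
  note neg = right_perp_cohomology[OF Y(1) this]
  show "carrier (cohomology X n) = {\<zero>\<^bsub>cohomology X n\<^esub>}" if "n \<noteq> 0"
  proof (cases "n > 0")
    case True
    then show ?thesis
      using tors[of n] torsion_class_empty_iff[OF module_cohomology[OF cX, of n]] by (simp add: \<Phi>)
  next
    case False
    then show ?thesis using neg[of "n + 1"] that by (simp add: coh)
  qed
qed

lemma torsion_class_inj:
  assumes "N \<in> torsion_class R Z" "module R M" "inj_on f (carrier M)"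
    "\<And>x. x \<in> carrier M \<Longrightarrow> f x \<in> carrier N" "f \<zero>\<^bsub>M\<^esub> = \<zero>\<^bsub>N\<^esub>"
    "\<And>r x. r \<in> carrier R \<Longrightarrow> x \<in> carrier M \<Longrightarrow> f (r \<odot>\<^bsub>M\<^esub> x) = r \<odot>\<^bsub>N\<^esub> f x"
  shows "M \<in> torsion_class R Z"
  using Supp_mono[OF assms(2) _ assms(3-6)] assms(1,2) by (auto simp: torsion_class_def)

text \<open>
  Going from representatives back to cosets embeds the realized cohomology into the actual one.
\<close>

lemma H_torsion:
  assumes X: "is_complex R X" and tors: "cohomology X n \<in> torsion_class R Z"
  shows "on_ob (H_functor n) X \<in> torsion_class R Z"
proof (rule torsion_class_inj[OF tors module_H[OF X]])
  note e = inj_on_some_elem[OF X, of n]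
  note t = transport_simps[OF e]
  show "inj_on (inv_into (carrier (cohomology X n)) some_elem) (carrier (on_ob (H_functor n) X))"
    by (simp add: H_functor_def t inj_on_inv_into)
qed (use inj_on_some_elem[OF X, of n] transport_simps[OF inj_on_some_elem[OF X, of n]]
    module_closed[OF module_cohomology[OF X, of n]] in \<open>auto simp: H_functor_def\<close>)

lemma conc_torsion:
  assumes M: "M \<in> torsion_class R Z"
  shows "cohomology (conc M) 0 \<in> torsion_class R Z"
proof -
  have mM: "module R M" using M by (simp add: torsion_class_def)
  note cM = is_complex_conc[OF mM]
  have car: "carrier (cohomology (conc M) 0) = (\<lambda>x. {x}) ` carrier M"
    by (auto simp: cohomology_simps[OF cM] cocycles_conc coboundaries_conc[OF mM] zero_coset[OF mM])
  have smult: "r \<odot>\<^bsub>cohomology (conc M) 0\<^esub> {x} = {r \<odot>\<^bsub>M\<^esub> x}" if "r \<in> carrier R" "x \<in> carrier M" for r x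
    using cohomology_simps(4)[OF cM that(1), of x 0] that module_closed(3)[OF mM that]
    by (simp add: coboundaries_conc[OF mM] zero_coset[OF mM] conc_carrier_def)
  show ?thesis
    by (rule torsion_class_inj[OF M module_cohomology[OF cM], where f = the_elem])
      (auto simp: car smult inj_on_def cohomology_simps(2)[OF cM] coboundaries_conc[OF mM])
qed

lemma shift_conc:
  assumes M: "module R M"
  shows "is_complex R (shift (- 1) (conc M))" and "shift 1 (shift (- 1) (conc M)) = conc M"
    and "n \<noteq> 1 \<Longrightarrow> carrier (term_at (shift (- 1) (conc M)) n) = {\<zero>\<^bsub>M\<^esub>}"
    and "\<zero>\<^bsub>term_at (shift (- 1) (conc M)) n\<^esub> = \<zero>\<^bsub>M\<^esub>"
proof -
  have zero: "\<ominus>\<^bsub>M\<lparr>carrier := conc_carrier M n\<rparr>\<^esub> \<zero>\<^bsub>M\<^esub> = \<zero>\<^bsub>M\<^esub>" for n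
    using module_zero_simps(3)[OF module_conc_term[OF M, of n]] by simp
  show "is_complex R (shift (- 1) (conc M))"
    unfolding is_complex_def shift_def
    using module_conc_term[OF M] zero_conc_carrier[OF M] module_closed[OF module_conc_term[OF M]]
      module_zero_simps[OF M] zero
    by (auto intro!: module_homsI)
  show "shift 1 (shift (- 1) (conc M)) = conc M"
    using zero by (auto simp: shift_def conc_def fun_eq_iff zero_conc_carrier[OF M])
  show "n \<noteq> 1 \<Longrightarrow> carrier (term_at (shift (- 1) (conc M)) n) = {\<zero>\<^bsub>M\<^esub>}"
    and "\<zero>\<^bsub>term_at (shift (- 1) (conc M)) n\<^esub> = \<zero>\<^bsub>M\<^esub>"
    by (simp_all add: shift_def conc_carrier_def)
qed

text \<open>
  A complex \<open>U\<close> without cohomology in positive degrees is isomorphic to its truncation, so morphisms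
  \<open>U \<rightarrow> Y\<close> factor through the truncation of \<open>Y\<close>; this is zero if \<open>Y\<close> starts in degree \<open>1\<close>.
\<close>

lemma derived_Hom_zero:
  assumes U: "is_complex R U" "\<And>n. n > 0 \<Longrightarrow> carrier (cohomology U n) = {\<zero>\<^bsub>cohomology U n\<^esub>}"
    and Y: "is_complex R Y" "\<And>n. n \<le> 0 \<Longrightarrow> carrier (term_at Y n) = {\<zero>\<^bsub>term_at Y n\<^esub>}"
  shows "Hom (derived_cat R) U Y = {derived_zero R U Y}"
proof -
  interpret D: category "derived_cat R" by (rule category_derived_cat)
  note tU = is_complex_trunc[OF U(1)] and tY = is_complex_trunc[OF Y(1)]
  let ?i = "derived_map R (trunc U) U (trunc_incl U)"
  have i: "is_iso (derived_cat R) (trunc U) U ?i"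
    by (rule derived_map(3)[OF tU U(1) trunc_incl_quasi_iso[OF U]])
  have "trunc_incl Y = zero_chain_map (trunc Y) Y"
    using Y(2) trunc_carrier_subset[OF Y(1)]
    by (fastforce simp: trunc_incl_def zero_chain_map_def fun_eq_iff trunc_carrier_def cocycles_def)
  then have iY: "derived_map R (trunc Y) Y (trunc_incl Y) = derived_zero R (trunc Y) Y"
    by (simp add: derived_zero_def derived_map_def)
  have "c = derived_zero R U Y" if c: "c \<in> Hom (derived_cat R) U Y" for c
  proof (rule D.is_iso_cancel_right[OF _ _ _ i c derived_zero_in_Hom])
    have "on_hom (derived_trunc R) U Y c \<in> Hom (derived_cat R) (trunc U) (trunc Y)"
      using is_functorD(2)[OF derived_trunc(1), of U R Y c] U Y c by (simp add: derived_trunc(2))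
    then have "Comp (derived_cat R) (trunc U) U Y c ?i = derived_zero R (trunc U) Y"
      using derived_incl_natural[OF c] derived_zero_absorbs[OF Y(1)] iY by metis
    also have "\<dots> = Comp (derived_cat R) (trunc U) U Y (derived_zero R U Y) ?i"
      using derived_zero_absorbs[OF Y(1)] i by (simp add: is_iso_def)
    finally show "Comp (derived_cat R) (trunc U) U Y c ?i = Comp (derived_cat R) (trunc U) U Y (derived_zero R U Y) ?i" .
  qed (use U Y tU in auto)
  then show ?thesis using derived_zero_in_Hom[OF U(1) Y(1)] by blast
qed

lemma conc_in_heart:
  assumes \<Phi>: "\<Phi> = (\<lambda>n. if n \<le> 0 then Z else {})"
    and M: "M \<in> torsion_class R Z"
  shows "conc M \<in> ajs_aisle R \<Phi> \<inter> shift 1 ` right_perp R (ajs_aisle R \<Phi>)"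
proof
  have mM: "module R M" using M by (simp add: torsion_class_def)
  note cM = is_complex_conc[OF mM]
  have "cohomology (conc M) n \<in> torsion_class R (\<Phi> n)" for n
  proof (cases "n = 0")
    case True
    then show ?thesis using conc_torsion[OF M] by (simp add: \<Phi>)
  next
    case False
    then show ?thesis
      using torsion_class_trivial[OF module_cohomology[OF cM]] cohomology_conc_trivial[OF mM] by blast
  qed
  then show "conc M \<in> ajs_aisle R \<Phi>" using cM by (simp add: ajs_aisle_def)
  let ?Y = "shift (- 1) (conc M)"
  have "Hom (derived_cat R) U ?Y = {derived_zero R U ?Y}" if U: "U \<in> ajs_aisle R \<Phi>" for U
  proof (rule derived_Hom_zero)
    show cU: "is_complex R U" using U by (simp add: ajs_aisle_def)
    show "carrier (cohomology U n) = {\<zero>\<^bsub>cohomology U n\<^esub>}" if "n > 0" for n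
    proof -
      have "cohomology U n \<in> torsion_class R (\<Phi> n)" using U by (simp add: ajs_aisle_def)
      then have "cohomology U n \<in> torsion_class R {}" using that by (simp add: \<Phi>)
      then show ?thesis using torsion_class_empty_iff[OF module_cohomology[OF cU]] by blast
    qed
  qed (use shift_conc[OF mM] in auto)
  then have "?Y \<in> right_perp R (ajs_aisle R \<Phi>)"
    using shift_conc(1)[OF mM] by (simp add: right_perp_def)
  then show "conc M \<in> shift 1 ` right_perp R (ajs_aisle R \<Phi>)"
    using shift_conc(2)[OF mM] by (metis imageI)
qed


section \<open>The equivalence\<close>

text \<open>
  The roof \<open>H\<^sup>0(X)[0] \<leftarrow> \<tau>\<^sup>\<le>\<^sup>0 X \<rightarrow> X\<close> as a morphism of \<open>D(R)\<close>, defined once the left leg is invertible.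
\<close>

definition conc_H_iso where
  "conc_H_iso R X = Comp (derived_cat R) (conc (on_ob (H_functor 0) X)) (trunc X) X
    (derived_map R (trunc X) X (trunc_incl X))
    (inverse_in (derived_cat R) (trunc X) (conc (on_ob (H_functor 0) X))
      (derived_map R (trunc X) (conc (on_ob (H_functor 0) X)) (trunc_proj X)))"

text \<open>
  Both legs of the roof are quasi-isomorphisms, since the cohomology is concentrated in degree \<open>0\<close>.
  Naturality is that of the two legs; the square of the left one is read backwards.
\<close>

lemma conc_H_natural_iso:
  fixes R :: "('r, 'x) ring_scheme" and X Y :: "('r, 'm) cochain"
  assumes X: "is_complex R X" "\<And>n. n \<noteq> 0 \<Longrightarrow> carrier (cohomology X n) = {\<zero>\<^bsub>cohomology X n\<^esub>}"
    and Y: "is_complex R Y" "\<And>n. n \<noteq> 0 \<Longrightarrow> carrier (cohomology Y n) = {\<zero>\<^bsub>cohomology Y n\<^esub>}"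
  shows "is_iso (derived_cat R) (conc (on_ob (H_functor 0) X)) X (conc_H_iso R X)"
    and "c \<in> Hom (derived_cat R) X Y \<Longrightarrow>
      Comp (derived_cat R) (conc (on_ob (H_functor 0) X)) (conc (on_ob (H_functor 0) Y)) Y (conc_H_iso R Y)
        (on_hom (derived_conc R) (on_ob (H_functor 0) X) (on_ob (H_functor 0) Y) (on_hom (derived_H R) X Y c)) =
      Comp (derived_cat R) (conc (on_ob (H_functor 0) X)) X Y c (conc_H_iso R X)"
proof -
  interpret D: category "derived_cat R" by (rule category_derived_cat)
  let ?GH = "\<lambda>X. conc (on_ob (H_functor 0) X)"
  let ?i = "\<lambda>X. derived_map R (trunc X) X (trunc_incl X)"
  let ?p = "\<lambda>X. derived_map R (trunc X) (?GH X) (trunc_proj X)"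
  let ?q = "\<lambda>X. inverse_in (derived_cat R) (trunc X) (?GH X) (?p X)"
  have cGH: "is_complex R (?GH X)" if "is_complex R X" for X :: "('r, 'm) cochain"
    by (rule is_complex_conc[OF module_H[OF that]])
  have i: "is_iso (derived_cat R) (trunc X) X (?i X)" and p: "is_iso (derived_cat R) (trunc X) (?GH X) (?p X)"
    if "is_complex R X" "\<And>n. n \<noteq> 0 \<Longrightarrow> carrier (cohomology X n) = {\<zero>\<^bsub>cohomology X n\<^esub>}"
    for X :: "('r, 'm) cochain"
    using that by (auto intro!: derived_map(3) is_complex_trunc cGH trunc_incl_quasi_iso trunc_proj_quasi_iso)
  note iX = i[OF X] and iY = i[OF Y] and pX = p[OF X] and pY = p[OF Y]
  note ob = X(1) Y(1) cGH[OF X(1)] cGH[OF Y(1)] is_complex_trunc[OF X(1)] is_complex_trunc[OF Y(1)]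
  show "is_iso (derived_cat R) (?GH X) X (conc_H_iso R X)"
    unfolding conc_H_iso_def using ob by (intro D.is_iso_comp iX is_iso_inverse_in pX) simp_all
  assume c: "c \<in> Hom (derived_cat R) X Y"
  let ?t = "on_hom (derived_trunc R) X Y c"
  let ?h = "on_hom (derived_conc R) (on_ob (H_functor 0) X) (on_ob (H_functor 0) Y) (on_hom (derived_H R) X Y c)"
  have t: "?t \<in> Hom (derived_cat R) (trunc X) (trunc Y)"
    using is_functorD(2)[OF derived_trunc(1), of X R Y c] ob c by (simp add: derived_trunc(2))
  have h: "?h \<in> Hom (derived_cat R) (?GH X) (?GH Y)"
    using is_functorD(2)[OF is_functor_comp[OF derived_H(1) derived_conc(1)], of X R Y c] ob c
    by (simp add: derived_H(2) derived_conc(2))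
  have hom: "?i X \<in> Hom (derived_cat R) (trunc X) X" "?i Y \<in> Hom (derived_cat R) (trunc Y) Y"
    "?p X \<in> Hom (derived_cat R) (trunc X) (?GH X)" "?p Y \<in> Hom (derived_cat R) (trunc Y) (?GH Y)"
    using iX iY pX pY by (simp_all add: is_iso_def)
  note qX = inverse_in[OF pX] and qY = inverse_in[OF pY]
  have sq: "Comp (derived_cat R) (?GH X) (?GH Y) (trunc Y) (?q Y) ?h =
      Comp (derived_cat R) (?GH X) (trunc X) (trunc Y) ?t (?q X)"
    using ob derived_proj_natural[OF c]
    by (intro D.square_invert[OF _ _ _ _ hom(3) qX(1,3) hom(4) qY(1,2) t h]) simp_all
  have "Comp (derived_cat R) (?GH X) (?GH Y) Y (conc_H_iso R Y) ?h =
      Comp (derived_cat R) (?GH X) (trunc Y) Y (?i Y) (Comp (derived_cat R) (?GH X) (?GH Y) (trunc Y) (?q Y) ?h)"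
    unfolding conc_H_iso_def using ob hom qX qY t h by (simp add: D.comp_assoc)
  also have "\<dots> = Comp (derived_cat R) (?GH X) (trunc X) Y
      (Comp (derived_cat R) (trunc X) (trunc Y) Y (?i Y) ?t) (?q X)"
    unfolding sq using ob hom qX qY t h by (simp add: D.comp_assoc)
  also have "\<dots> = Comp (derived_cat R) (?GH X) X Y c (conc_H_iso R X)"
    unfolding conc_H_iso_def derived_incl_natural[OF c] using ob hom qX c by (simp add: D.comp_assoc)
  finally show "Comp (derived_cat R) (?GH X) (?GH Y) Y (conc_H_iso R Y) ?h = Comp (derived_cat R) (?GH X) X Y c (conc_H_iso R X)" .
qed

text \<open>
  The isomorphism is the identity on elements, by \<open>H_conc\<close>.
\<close>

lemma H_conc_natural_iso:
  assumes M: "module R M"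
  shows "is_iso (Mod_cat R) (on_ob (H_functor 0) (conc M)) M (\<lambda>x\<in>carrier M. x)"
    and "module R N \<Longrightarrow> f \<in> module_homs R M N \<Longrightarrow>
      compose (carrier (on_ob (H_functor 0) (conc M))) (\<lambda>x\<in>carrier N. x)
        (on_hom (derived_H R) (conc M) (conc N) (on_hom (derived_conc R) M N f)) =
      compose (carrier (on_ob (H_functor 0) (conc M))) f (\<lambda>x\<in>carrier M. x)"
proof -
  note cM = is_complex_conc[OF M]
  have "(\<lambda>x\<in>carrier M. x) \<in> module_homs R (on_ob (H_functor 0) (conc M)) M"
    using module_closed[OF M] by (intro module_homsI) (auto simp: H_conc[OF M])
  then show "is_iso (Mod_cat R) (on_ob (H_functor 0) (conc M)) M (\<lambda>x\<in>carrier M. x)"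
    using M module_H[OF cM] by (intro bijective_hom_is_iso) (auto simp: H_conc[OF M] bij_betw_def inj_on_def)
  assume N: "module R N" and f: "f \<in> module_homs R M N"
  note cN = is_complex_conc[OF N] and cf = conc_map[OF M N f]
  have "on_hom (H_functor 0) (conc M) (conc N) (\<lambda>n. restrict f (conc_carrier M n)) x = f x"
    if "x \<in> carrier M" for x
    using H_map_rep[OF cM cN cf, of x 0] that module_homsD(1)[OF f that]
    by (simp add: cocycles_conc cohomology_rep_conc[OF M] cohomology_rep_conc[OF N] conc_carrier_def)
  then show "compose (carrier (on_ob (H_functor 0) (conc M))) (\<lambda>x\<in>carrier N. x)
        (on_hom (derived_H R) (conc M) (conc N) (on_hom (derived_conc R) M N f)) =
      compose (carrier (on_ob (H_functor 0) (conc M))) f (\<lambda>x\<in>carrier M. x)"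
    using module_homsD(1)[OF f]
    by (auto simp: derived_conc(3) derived_H(3)[OF cM cN cf] compose_def fun_eq_iff H_conc(1)[OF M])
qed

theorem proposition4p10:
  fixes R :: "('r, 'x) ring_scheme" and Z :: "'r set set" and \<Phi> :: "int \<Rightarrow> 'r set set"
  assumes "cring R"
    and "thomason R Z" and "Z \<subset> Spec R"
    and "\<And>n. n \<le> 0 \<Longrightarrow> \<Phi> n = Z" and "\<And>n. n > 0 \<Longrightarrow> \<Phi> n = {}"
  shows "equivalent_categories
    (ajs_heart R \<Phi> :: (('r, 'm) cochain, ('r, 'm) derived_hom) cat)
    (torsion_cat R Z :: (('r, 'm) module, 'm \<Rightarrow> 'm) cat)"
proof -
  let ?F = "derived_H R" and ?G = "derived_conc R"
  let ?\<H> = "ajs_heart R \<Phi> :: (('r, 'm) cochain, ('r, 'm) derived_hom) cat"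
  let ?\<T> = "torsion_cat R Z :: (('r, 'm) module, 'm \<Rightarrow> 'm) cat"
  have \<Phi>: "\<Phi> = (\<lambda>n. if n \<le> 0 then Z else {})"
    using assms(4,5) by (auto simp: fun_eq_iff not_le)
  note heart = heart_cohomology[OF \<Phi>]
  have heart_simps: "Hom ?\<H> = Hom (derived_cat R)" "Comp ?\<H> = Comp (derived_cat R)"
    "is_iso ?\<H> = is_iso (derived_cat R)"
    by (simp_all add: ajs_heart_def)
  have torsion_simps: "Hom ?\<T> = Hom (Mod_cat R)" "Comp ?\<T> = Comp (Mod_cat R)"
    "is_iso ?\<T> = is_iso (Mod_cat R)" "\<And>M. M \<in> Ob ?\<T> \<Longrightarrow> module R M"
    by (simp_all add: torsion_cat_def)
  have "category ?\<H>"
    unfolding ajs_heart_def by (rule category_full_subcategory[OF category_derived_cat])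
  moreover have "category ?\<T>"
    unfolding torsion_cat_def by (rule category_full_subcategory[OF category_Mod_cat])
  moreover have "is_functor ?\<H> ?\<T> ?F"
    unfolding ajs_heart_def torsion_cat_def
    using H_torsion[OF heart(1,3)]
    by (intro is_functor_full_subcategory[OF derived_H(1)]) (auto simp: derived_H(2) ajs_heart_def)
  moreover have "is_functor ?\<T> ?\<H> ?G"
    unfolding ajs_heart_def torsion_cat_def
    using conc_in_heart[OF \<Phi>]
    by (intro is_functor_full_subcategory[OF derived_conc(1)]) (simp add: derived_conc(2))
  moreover have "naturally_isomorphic ?\<H> ?\<H> (comp_functor ?G ?F) id_functor"
    unfolding naturally_isomorphic_def heart_simps
  proof (intro exI[of _ "conc_H_iso R"] conjI ballI)
    fix X Y c
    assume X: "X \<in> Ob ?\<H>"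
    show "is_iso (derived_cat R) (on_ob (comp_functor ?G ?F) X) (on_ob id_functor X) (conc_H_iso R X)"
      using conc_H_natural_iso(1)[OF heart(1,2)[OF X] heart(1,2)[OF X]]
      by (simp add: derived_H(2) derived_conc(2))
    assume Y: "Y \<in> Ob ?\<H>" and c: "c \<in> Hom (derived_cat R) X Y"
    show "Comp (derived_cat R) (on_ob (comp_functor ?G ?F) X) (on_ob (comp_functor ?G ?F) Y) (on_ob id_functor Y)
        (conc_H_iso R Y) (on_hom (comp_functor ?G ?F) X Y c) =
      Comp (derived_cat R) (on_ob (comp_functor ?G ?F) X) (on_ob id_functor X) (on_ob id_functor Y)
        (on_hom id_functor X Y c) (conc_H_iso R X)"
      using conc_H_natural_iso(2)[OF heart(1,2)[OF X] heart(1,2)[OF Y] c]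
      by (simp add: derived_H(2) derived_conc(2))
  qed
  moreover have "naturally_isomorphic ?\<T> ?\<T> (comp_functor ?F ?G) id_functor"
    unfolding naturally_isomorphic_def torsion_simps(1-3)
    using H_conc_natural_iso[OF torsion_simps(4)] torsion_simps(4)
    by (intro exI[of _ "\<lambda>M. \<lambda>x\<in>carrier M. x"]) (auto simp: derived_H(2) derived_conc(2))
  ultimately show ?thesis
    unfolding equivalent_categories_def by blast
qed

end
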